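(* Let $s_0$ be a central configuration for $U$ and let $y$ be an $s_0$-asymptotic solution. If $s_0$ satisfies the [BS]-condition, then the spectral index of $y$ is finite: $\iota_{\rm spec}(y)<+\infty$.
   Context: Setting. Let $n,d\ge 2$ be integers, $m_1,\dots,m_n>0$, $\alpha\in(0,2)$, $M=\mathrm{diag}(m_1I_d,\dots,m_nI_d)$, $\langle u,v\rangle_M=\langle Mu,v\rangle$, $|u|_M=\langle u,u\rangle_M^{1/2}$ on $\mathbb R^{nd}$. Let $\mathcal X=\{q\in\mathbb R^{nd}:\sum_i m_iq_i=0\}$, $N=\dim\mathcal X=d(n-1)$, $\widehat{\mathcal X}=\{q\in\mathcal X: q_i\ne q_j \text{ for } i\neq j\}$, $U(q)=\sum_{i<j}m_im_j\|q_i-q_j\|^{-\alpha}$ on $\widehat{\mathcal X}$, $\mathcal E=\{q\in\widehat{\mathcal X}:|q|_M=1\}$. A central configuration is a critical point $s_0\in\mathcal E$ of $U|_{\mathcal E}$. Asymptotic solutions. For $T\in(0,+\infty]$, an asymptotic solution is $\gamma\in C^2((0,T),\widehat{\mathcal X})$ solving $M\ddot\gamma=\nabla U(\gamma)$ on $(0,T)$ ($\nabla$ is the Euclidean gradient), and such that: if $T<+\infty$, $\gamma\in C^0([0,T],\mathcal X)$ and $\gamma(t)\to0$ as $t\to T^-$ (total collision); if $T=+\infty$, $\gamma\in C^0([0,+\infty),\mathcal X)$ and $\frac12|\dot\gamma(t)|_M^2\to 0$ as $t\to+\infty$ (parabolic). It is an $s_0$-asymptotic solution if $\gamma(t)/|\gamma(t)|_M\to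 s_0$ as $t\to T^-$. Its energy is $h=\frac12|\dot\gamma|_M^2-U(\gamma)$ (which is $0$ if $T=+\infty$). Regularised variables. Put $r=|\gamma|_M$, $s=\gamma/r$, $\tau(t)=\int_0^t r^{-(2+\alpha)/2}$ (strictly increasing, $\tau(0)=0$, ranging over $[0,+\infty)$), $\rho=r^{(2-\alpha)/4}$ and $y=\rho s$, all regarded as functions of $\tau\in[0,+\infty)$; $'=d/d\tau$. The curve $y$ is also called an $s_0$-asymptotic solution. Put $\beta=\frac{2(2+\alpha)}{2-\alpha}$, $c_\alpha=\left(\frac4{2-\alpha}\right)^2-1$, and $\bar\delta_\alpha=-\frac{2-\alpha}4\sqrt{2U(s_0)}$ if $T<+\infty$, $\bar\delta_\alpha=\frac{2-\alpha}4\sqrt{2U(s_0)}$ if $T=+\infty$. Coefficients. $(u\otimes_M v)\eta=\langle v,\eta\rangle_M u$; ${}^{\mathsf T}$ is the adjoint with respect to $\langle\cdot,\cdot\rangle_M$. $W(x)=|x|_M^{2+\alpha}U(x)-|x|_M^2U(s_0)$, $\widetilde U(x)=|x|_M^\alpha U(x)$; $D^2W(x)$ and $D^2\widetilde U(x)$ denote the endomorphisms of $\mathcal X$ representing the second differentials with respect to $\langle\cdot,\cdot\rangle_M$. Endomorphisms of $\mathcal X$: $P(\tau)=c_\alpha s\otimes_M s+I$; $Q(\tau)=c_\alpha\frac{\rho'}\rho(I-s\otimes_M s)+c_\alpha s\otimes_M s'$; $R(\tau)=\big[c_\alpha(\frac{\rho'}\rho)^2+\beta(\beta-2)h\rho^{\beta-2}\big]s\otimes_Ms+\big[2U(s_0)-c_\alpha(\frac{\rho'}\rho)^2+\beta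 h\rho^{\beta-2}\big]I+c_\alpha s'\otimes_Ms'-c_\alpha\frac{\rho'}\rho(s\otimes_Ms'+s'\otimes_Ms)$; $\widetilde R(\tau)=R(\tau)+D^2W(y(\tau))$. Quadratic form and spectral index. On $W^{1,2}_0([0,+\infty),\mathcal X)$ ($W^{1,2}$ functions vanishing at $0$) let $\mathcal Q(\eta)=\int_0^{+\infty}\big[\langle P\eta',\eta'\rangle_M+\langle Q\eta,\eta'\rangle_M+\langle Q^{\mathsf T}\eta',\eta\rangle_M+\langle\widetilde R\eta,\eta\rangle_M\big]d\tau$. The spectral index $\iota_{\rm spec}(y)\in\mathbb N\cup\{+\infty\}$ is the dimension of the negative spectral subspace of the bounded selfadjoint operator representing $\mathcal Q$ with respect to the Hilbert structure of $W^{1,2}_0$. [BS]-condition: the endomorphism $\widetilde R_0=c_\alpha\bar\delta_\alpha^2\,s_0\otimes_Ms_0+\frac{(2-\alpha)^2}8U(s_0)I+D^2\widetilde U(s_0)$ of $\mathcal X$ is positive definite; equivalently, the smallest eigenvalue $\mu_1$ of $D^2\widetilde U(s_0)$ satisfies $\mu_1>-\frac{(2-\alpha)^2}8U(s_0)$.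
   Formalization: The formal statement adds that γ(0) is collision-free; the definition of asymptotic solution asks this only for t in (0,T), but at a total collision at t=0 the time τ is infinite, and at a partial one s'(0) and D²W(y(0)) are undefined. *)

theory Defs
  imports "HOL-Analysis.Analysis" "HOL-Library.Extended_Nat" "HOL-Library.Extended_Real"
begin

text \<open>
  A configuration of n bodies in d-dimensional space is an element of \<open>real^'d^'n\<close>, so that
  \<open>n = CARD('n)\<close>, \<open>d = CARD('d)\<close> and \<open>q $ i\<close> is the position of body \<open>i\<close>.  Endomorphisms of the
  space of centred configurations are functions on \<open>real^'d^'n\<close> of which only the restriction to
  that space matters.
\<close>

section \<open>Configurations and the potential\<close>

definition inner_M :: "('n::finite \<Rightarrow> real) \<Rightarrow> real^'d^'n \<Rightarrow> real^'d^'n \<Rightarrow> real" where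
  "inner_M m u v = (\<Sum>i\<in>UNIV. m i * (u $ i \<bullet> v $ i))"

definition norm_M :: "('n::finite \<Rightarrow> real) \<Rightarrow> real^'d^'n \<Rightarrow> real" where
  "norm_M m u = sqrt (inner_M m u u)"

definition Xspace :: "('n::finite \<Rightarrow> real) \<Rightarrow> (real^'d^'n) set" where
  "Xspace m = {q. (\<Sum>i\<in>UNIV. m i *\<^sub>R (q $ i)) = 0}"

definition Xhat :: "('n::finite \<Rightarrow> real) \<Rightarrow> (real^'d^'n) set" where
  "Xhat m = {q \<in> Xspace m. \<forall>i j. i \<noteq> j \<longrightarrow> q $ i \<noteq> q $ j}"

text \<open>
  The index type carries no order; each unordered pair of bodies occurs twice in the sum over
  \<open>i \<noteq> j\<close>, hence the factor 1/2.
\<close>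

definition potential :: "('n::finite \<Rightarrow> real) \<Rightarrow> real \<Rightarrow> real^'d^'n \<Rightarrow> real" where
  "potential m \<alpha> q =
     (\<Sum>i\<in>UNIV. \<Sum>j\<in>UNIV - {i}. m i * m j * norm (q $ i - q $ j) powr (- \<alpha>)) / 2"

definition Esphere :: "('n::finite \<Rightarrow> real) \<Rightarrow> (real^'d^'n) set" where
  "Esphere m = {q \<in> Xhat m. norm_M m q = 1}"

text \<open>
  The tangent space at \<open>s\<^sub>0\<close> of the sphere of centred configurations consists of the \<open>v\<close> in
  \<open>Xspace m\<close> that are M-orthogonal to \<open>s\<^sub>0\<close>; a critical point of the restricted potential is one where
  the differential vanishes on this tangent space.
\<close>

definition central_configuration ::
  "('n::finite \<Rightarrow> real) \<Rightarrow> real \<Rightarrow> real^'d^'n \<Rightarrow> bool" where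
  "central_configuration m \<alpha> s\<^sub>0 \<longleftrightarrow> s\<^sub>0 \<in> Esphere m \<and>
     (\<forall>v\<in>Xspace m. inner_M m s\<^sub>0 v = 0 \<longrightarrow> frechet_derivative (potential m \<alpha>) (at s\<^sub>0) v = 0)"

section \<open>Asymptotic solutions\<close>

definition left_end :: "ereal \<Rightarrow> real filter" where
  "left_end T = (if T = \<infinity> then at_top else at_left (real_of_ereal T))"

definition velocity :: "(real \<Rightarrow> 'a::real_normed_vector) \<Rightarrow> real \<Rightarrow> 'a" where
  "velocity \<gamma> t = vector_derivative \<gamma> (at t)"

text \<open>
  The potential is differentiated on the open set of collision-free elements of \<open>real^'d^'n\<close>, where
  the same formula defines it; \<open>GDERIV\<close> is the gradient for the Euclidean inner product.
\<close>

definition asymptotic_solution ::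
  "('n::finite \<Rightarrow> real) \<Rightarrow> real \<Rightarrow> ereal \<Rightarrow> (real \<Rightarrow> real^'d^'n) \<Rightarrow> bool" where
  "asymptotic_solution m \<alpha> T \<gamma> \<longleftrightarrow>
     0 < T \<and>
     (\<forall>t. 0 < t \<and> ereal t < T \<longrightarrow>
        \<gamma> t \<in> Xhat m \<and> \<gamma> differentiable (at t) \<and> velocity \<gamma> differentiable (at t) \<and>
        GDERIV (potential m \<alpha>) (\<gamma> t) :> (\<chi> i. m i *\<^sub>R (velocity (velocity \<gamma>) t $ i))) \<and>
     continuous_on {t. 0 < t \<and> ereal t < T} (velocity (velocity \<gamma>)) \<and>
     (T < \<infinity> \<longrightarrow>
        continuous_on {0..real_of_ereal T} \<gamma> \<and> \<gamma> ` {0..real_of_ereal T} \<subseteq> Xspace m \<and>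
        (\<gamma> \<longlongrightarrow> 0) (left_end T)) \<and>
     (T = \<infinity> \<longrightarrow>
        continuous_on {0..} \<gamma> \<and> \<gamma> ` {0..} \<subseteq> Xspace m \<and>
        ((\<lambda>t. (norm_M m (velocity \<gamma> t))\<^sup>2 / 2) \<longlongrightarrow> 0) (left_end T))"

definition s0_asymptotic_solution ::
  "('n::finite \<Rightarrow> real) \<Rightarrow> real \<Rightarrow> ereal \<Rightarrow> real^'d^'n \<Rightarrow> (real \<Rightarrow> real^'d^'n) \<Rightarrow> bool" where
  "s0_asymptotic_solution m \<alpha> T s\<^sub>0 \<gamma> \<longleftrightarrow> asymptotic_solution m \<alpha> T \<gamma> \<and>
     ((\<lambda>t. \<gamma> t /\<^sub>R norm_M m (\<gamma> t)) \<longlongrightarrow> s\<^sub>0) (left_end T)"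

definition has_energy ::
  "('n::finite \<Rightarrow> real) \<Rightarrow> real \<Rightarrow> ereal \<Rightarrow> (real \<Rightarrow> real^'d^'n) \<Rightarrow> real \<Rightarrow> bool" where
  "has_energy m \<alpha> T \<gamma> h \<longleftrightarrow> (\<forall>t. 0 < t \<and> ereal t < T \<longrightarrow>
     h = (norm_M m (velocity \<gamma> t))\<^sup>2 / 2 - potential m \<alpha> (\<gamma> t))"

section \<open>Regularised variables\<close>

definition new_time ::
  "('n::finite \<Rightarrow> real) \<Rightarrow> real \<Rightarrow> (real \<Rightarrow> real^'d^'n) \<Rightarrow> real \<Rightarrow> real" where
  "new_time m \<alpha> \<gamma> t = integral {0..t} (\<lambda>u. norm_M m (\<gamma> u) powr (- (2 + \<alpha>) / 2))"

definition old_time ::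
  "('n::finite \<Rightarrow> real) \<Rightarrow> real \<Rightarrow> ereal \<Rightarrow> (real \<Rightarrow> real^'d^'n) \<Rightarrow> real \<Rightarrow> real" where
  "old_time m \<alpha> T \<gamma> = the_inv_into {t. 0 \<le> t \<and> ereal t < T} (new_time m \<alpha> \<gamma>)"

definition reg_rho ::
  "('n::finite \<Rightarrow> real) \<Rightarrow> real \<Rightarrow> ereal \<Rightarrow> (real \<Rightarrow> real^'d^'n) \<Rightarrow> real \<Rightarrow> real" where
  "reg_rho m \<alpha> T \<gamma> \<tau> = norm_M m (\<gamma> (old_time m \<alpha> T \<gamma> \<tau>)) powr ((2 - \<alpha>) / 4)"

definition reg_s ::
  "('n::finite \<Rightarrow> real) \<Rightarrow> real \<Rightarrow> ereal \<Rightarrow> (real \<Rightarrow> real^'d^'n) \<Rightarrow> real \<Rightarrow> real^'d^'n" where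
  "reg_s m \<alpha> T \<gamma> \<tau> = \<gamma> (old_time m \<alpha> T \<gamma> \<tau>) /\<^sub>R norm_M m (\<gamma> (old_time m \<alpha> T \<gamma> \<tau>))"

definition reg_y ::
  "('n::finite \<Rightarrow> real) \<Rightarrow> real \<Rightarrow> ereal \<Rightarrow> (real \<Rightarrow> real^'d^'n) \<Rightarrow> real \<Rightarrow> real^'d^'n" where
  "reg_y m \<alpha> T \<gamma> \<tau> = reg_rho m \<alpha> T \<gamma> \<tau> *\<^sub>R reg_s m \<alpha> T \<gamma> \<tau>"

text \<open>
  Derivative on the half-line: one-sided at 0, two-sided elsewhere.  The regularised variables and
  the coefficients below make sense on the closed half-line, including time 0, only when
  \<open>\<gamma> 0 \<in> Xhat m\<close> (otherwise \<open>D\<^sup>2W(y(0))\<close> is undefined).  Since \<open>asymptotic_solution\<close> itself only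
  constrains \<open>\<gamma>\<close> to \<open>Xhat m\<close> at positive times, this has to be assumed separately.
\<close>

definition dtau :: "(real \<Rightarrow> 'a::real_normed_vector) \<Rightarrow> real \<Rightarrow> 'a" where
  "dtau f \<tau> = vector_derivative f (at \<tau> within {0..})"

definition beta_exp :: "real \<Rightarrow> real" where
  "beta_exp \<alpha> = 2 * (2 + \<alpha>) / (2 - \<alpha>)"

definition c_coef :: "real \<Rightarrow> real" where
  "c_coef \<alpha> = (4 / (2 - \<alpha>))\<^sup>2 - 1"

definition delta_bar ::
  "('n::finite \<Rightarrow> real) \<Rightarrow> real \<Rightarrow> ereal \<Rightarrow> real^'d^'n \<Rightarrow> real" where
  "delta_bar m \<alpha> T s\<^sub>0 =
     (if T = \<infinity> then (2 - \<alpha>) / 4 * sqrt (2 * potential m \<alpha> s\<^sub>0)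
      else - ((2 - \<alpha>) / 4 * sqrt (2 * potential m \<alpha> s\<^sub>0)))"

section \<open>Coefficients\<close>

definition tensor_M ::
  "('n::finite \<Rightarrow> real) \<Rightarrow> real^'d^'n \<Rightarrow> real^'d^'n \<Rightarrow> real^'d^'n \<Rightarrow> real^'d^'n" where
  "tensor_M m u v \<eta> = inner_M m v \<eta> *\<^sub>R u"

text \<open>The vector of \<open>Xspace m\<close> representing a linear functional on \<open>Xspace m\<close>.\<close>

definition riesz_M ::
  "('n::finite \<Rightarrow> real) \<Rightarrow> (real^'d^'n \<Rightarrow> real) \<Rightarrow> real^'d^'n" where
  "riesz_M m \<phi> = (THE w. w \<in> Xspace m \<and> (\<forall>v\<in>Xspace m. inner_M m w v = \<phi> v))"

definition adjoint_M ::
  "('n::finite \<Rightarrow> real) \<Rightarrow> (real^'d^'n \<Rightarrow> real^'d^'n) \<Rightarrow> real^'d^'n \<Rightarrow> real^'d^'n" where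
  "adjoint_M m L u = riesz_M m (\<lambda>v. inner_M m u (L v))"

definition second_differential ::
  "('a::real_normed_vector \<Rightarrow> real) \<Rightarrow> 'a \<Rightarrow> 'a \<Rightarrow> 'a \<Rightarrow> real" where
  "second_differential f x u v =
     frechet_derivative (\<lambda>z. frechet_derivative f (at z) u) (at x) v"

definition hessian_M ::
  "('n::finite \<Rightarrow> real) \<Rightarrow> (real^'d^'n \<Rightarrow> real) \<Rightarrow> real^'d^'n \<Rightarrow> real^'d^'n \<Rightarrow> real^'d^'n" where
  "hessian_M m f x u = riesz_M m (second_differential f x u)"

definition W_fun ::
  "('n::finite \<Rightarrow> real) \<Rightarrow> real \<Rightarrow> real^'d^'n \<Rightarrow> real^'d^'n \<Rightarrow> real" where
  "W_fun m \<alpha> s\<^sub>0 x =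
     norm_M m x powr (2 + \<alpha>) * potential m \<alpha> x - (norm_M m x)\<^sup>2 * potential m \<alpha> s\<^sub>0"

definition U_tilde ::
  "('n::finite \<Rightarrow> real) \<Rightarrow> real \<Rightarrow> real^'d^'n \<Rightarrow> real" where
  "U_tilde m \<alpha> x = norm_M m x powr \<alpha> * potential m \<alpha> x"

definition P_coef ::
  "('n::finite \<Rightarrow> real) \<Rightarrow> real \<Rightarrow> ereal \<Rightarrow> (real \<Rightarrow> real^'d^'n) \<Rightarrow> real \<Rightarrow> real^'d^'n \<Rightarrow> real^'d^'n" where
  "P_coef m \<alpha> T \<gamma> \<tau> \<eta> =
     (let s = reg_s m \<alpha> T \<gamma> \<tau> in c_coef \<alpha> *\<^sub>R tensor_M m s s \<eta> + \<eta>)"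

definition Q_coef ::
  "('n::finite \<Rightarrow> real) \<Rightarrow> real \<Rightarrow> ereal \<Rightarrow> (real \<Rightarrow> real^'d^'n) \<Rightarrow> real \<Rightarrow> real^'d^'n \<Rightarrow> real^'d^'n" where
  "Q_coef m \<alpha> T \<gamma> \<tau> \<eta> =
     (let s = reg_s m \<alpha> T \<gamma> \<tau>;
          s' = dtau (reg_s m \<alpha> T \<gamma>) \<tau>;
          k = dtau (reg_rho m \<alpha> T \<gamma>) \<tau> / reg_rho m \<alpha> T \<gamma> \<tau>
      in (c_coef \<alpha> * k) *\<^sub>R (\<eta> - tensor_M m s s \<eta>) + c_coef \<alpha> *\<^sub>R tensor_M m s s' \<eta>)"

definition R_coef ::
  "('n::finite \<Rightarrow> real) \<Rightarrow> real \<Rightarrow> ereal \<Rightarrow> real^'d^'n \<Rightarrow> (real \<Rightarrow> real^'d^'n) \<Rightarrow> real \<Rightarrow>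
     real \<Rightarrow> real^'d^'n \<Rightarrow> real^'d^'n" where
  "R_coef m \<alpha> T s\<^sub>0 \<gamma> h \<tau> \<eta> =
     (let \<rho> = reg_rho m \<alpha> T \<gamma> \<tau>;
          s = reg_s m \<alpha> T \<gamma> \<tau>;
          s' = dtau (reg_s m \<alpha> T \<gamma>) \<tau>;
          k = dtau (reg_rho m \<alpha> T \<gamma>) \<tau> / \<rho>;
          c = c_coef \<alpha>;
          \<beta> = beta_exp \<alpha>
      in (c * k\<^sup>2 + \<beta> * (\<beta> - 2) * h * \<rho> powr (\<beta> - 2)) *\<^sub>R tensor_M m s s \<eta>
         + (2 * potential m \<alpha> s\<^sub>0 - c * k\<^sup>2 + \<beta> * h * \<rho> powr (\<beta> - 2)) *\<^sub>R \<eta>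
         + c *\<^sub>R tensor_M m s' s' \<eta>
         - (c * k) *\<^sub>R (tensor_M m s s' \<eta> + tensor_M m s' s \<eta>))"

definition R_tilde ::
  "('n::finite \<Rightarrow> real) \<Rightarrow> real \<Rightarrow> ereal \<Rightarrow> real^'d^'n \<Rightarrow> (real \<Rightarrow> real^'d^'n) \<Rightarrow> real \<Rightarrow>
     real \<Rightarrow> real^'d^'n \<Rightarrow> real^'d^'n" where
  "R_tilde m \<alpha> T s\<^sub>0 \<gamma> h \<tau> \<eta> =
     R_coef m \<alpha> T s\<^sub>0 \<gamma> h \<tau> \<eta> + hessian_M m (W_fun m \<alpha> s\<^sub>0) (reg_y m \<alpha> T \<gamma> \<tau>) \<eta>"

definition R_tilde_0 ::
  "('n::finite \<Rightarrow> real) \<Rightarrow> real \<Rightarrow> ereal \<Rightarrow> real^'d^'n \<Rightarrow> real^'d^'n \<Rightarrow> real^'d^'n" where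
  "R_tilde_0 m \<alpha> T s\<^sub>0 u =
     (c_coef \<alpha> * (delta_bar m \<alpha> T s\<^sub>0)\<^sup>2) *\<^sub>R tensor_M m s\<^sub>0 s\<^sub>0 u
     + ((2 - \<alpha>)\<^sup>2 / 8 * potential m \<alpha> s\<^sub>0) *\<^sub>R u
     + hessian_M m (U_tilde m \<alpha>) s\<^sub>0 u"

definition BS_condition ::
  "('n::finite \<Rightarrow> real) \<Rightarrow> real \<Rightarrow> ereal \<Rightarrow> real^'d^'n \<Rightarrow> bool" where
  "BS_condition m \<alpha> T s\<^sub>0 \<longleftrightarrow>
     (\<forall>u\<in>Xspace m. u \<noteq> 0 \<longrightarrow> 0 < inner_M m (R_tilde_0 m \<alpha> T s\<^sub>0 u) u)"

section \<open>The Sobolev space on the half-line\<close>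

definition L2_space :: "('n::finite \<Rightarrow> real) \<Rightarrow> (real \<Rightarrow> real^'d^'n) set" where
  "L2_space m = {f. f \<in> borel_measurable lborel \<and> (\<forall>t. f t \<in> Xspace m) \<and>
     set_integrable lborel {0..} (\<lambda>t. (norm_M m (f t))\<^sup>2)}"

definition is_weak_deriv ::
  "('n::finite \<Rightarrow> real) \<Rightarrow> (real \<Rightarrow> real^'d^'n) \<Rightarrow> (real \<Rightarrow> real^'d^'n) \<Rightarrow> bool" where
  "is_weak_deriv m \<eta> g \<longleftrightarrow> g \<in> L2_space m \<and> (\<forall>t\<ge>0. \<eta> t = \<eta> 0 + (LINT u:{0..t}|lborel. g u))"

text \<open>
  Elements are the continuous representatives, which are unique on the half-line; they are extended
  by 0 to negative times, so that distinct functions are distinct elements of the Sobolev space.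
\<close>

definition W12_0 :: "('n::finite \<Rightarrow> real) \<Rightarrow> (real \<Rightarrow> real^'d^'n) set" where
  "W12_0 m = {\<eta> \<in> L2_space m. (\<forall>t\<le>0. \<eta> t = 0) \<and> (\<exists>g. is_weak_deriv m \<eta> g)}"

text \<open>Determined up to null sets, hence unambiguous under integrals.\<close>

definition weak_deriv ::
  "('n::finite \<Rightarrow> real) \<Rightarrow> (real \<Rightarrow> real^'d^'n) \<Rightarrow> real \<Rightarrow> real^'d^'n" where
  "weak_deriv m \<eta> = (SOME g. is_weak_deriv m \<eta> g)"

definition inner_W12 ::
  "('n::finite \<Rightarrow> real) \<Rightarrow> (real \<Rightarrow> real^'d^'n) \<Rightarrow> (real \<Rightarrow> real^'d^'n) \<Rightarrow> real" where
  "inner_W12 m \<eta> \<xi> = (LINT t:{0..}|lborel.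
     inner_M m (weak_deriv m \<eta> t) (weak_deriv m \<xi> t) + inner_M m (\<eta> t) (\<xi> t))"

definition quad_form ::
  "('n::finite \<Rightarrow> real) \<Rightarrow> real \<Rightarrow> ereal \<Rightarrow> real^'d^'n \<Rightarrow> (real \<Rightarrow> real^'d^'n) \<Rightarrow> real \<Rightarrow>
     (real \<Rightarrow> real^'d^'n) \<Rightarrow> real" where
  "quad_form m \<alpha> T s\<^sub>0 \<gamma> h \<eta> = (LINT \<tau>:{0..}|lborel.
     (let \<eta>' = weak_deriv m \<eta> in
        inner_M m (P_coef m \<alpha> T \<gamma> \<tau> (\<eta>' \<tau>)) (\<eta>' \<tau>)
        + inner_M m (Q_coef m \<alpha> T \<gamma> \<tau> (\<eta> \<tau>)) (\<eta>' \<tau>)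
        + inner_M m (adjoint_M m (Q_coef m \<alpha> T \<gamma> \<tau>) (\<eta>' \<tau>)) (\<eta> \<tau>)
        + inner_M m (R_tilde m \<alpha> T s\<^sub>0 \<gamma> h \<tau> (\<eta> \<tau>)) (\<eta> \<tau>)))"

section \<open>Spectral measures and the spectral index\<close>

text \<open>
  A real Hilbert space of vector-valued functions is given by its carrier \<open>H\<close> and its inner
  product \<open>ip\<close>; the linear structure is pointwise.
\<close>

definition bounded_selfadjoint ::
  "('t \<Rightarrow> 'v::real_vector) set \<Rightarrow> (('t \<Rightarrow> 'v) \<Rightarrow> ('t \<Rightarrow> 'v) \<Rightarrow> real) \<Rightarrow> (('t \<Rightarrow> 'v) \<Rightarrow> ('t \<Rightarrow> 'v)) \<Rightarrow> bool" where
  "bounded_selfadjoint H ip A \<longleftrightarrow>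
     (\<forall>f\<in>H. A f \<in> H) \<and>
     (\<forall>f\<in>H. \<forall>g\<in>H. A (\<lambda>t. f t + g t) = (\<lambda>t. A f t + A g t)) \<and>
     (\<forall>f\<in>H. \<forall>c. A (\<lambda>t. c *\<^sub>R f t) = (\<lambda>t. c *\<^sub>R A f t)) \<and>
     (\<exists>C. \<forall>f\<in>H. sqrt (ip (A f) (A f)) \<le> C * sqrt (ip f f)) \<and>
     (\<forall>f\<in>H. \<forall>g\<in>H. ip (A f) g = ip f (A g))"

definition orth_projection ::
  "('t \<Rightarrow> 'v::real_vector) set \<Rightarrow> (('t \<Rightarrow> 'v) \<Rightarrow> ('t \<Rightarrow> 'v) \<Rightarrow> real) \<Rightarrow> (('t \<Rightarrow> 'v) \<Rightarrow> ('t \<Rightarrow> 'v)) \<Rightarrow> bool" where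
  "orth_projection H ip P \<longleftrightarrow> bounded_selfadjoint H ip P \<and> (\<forall>f\<in>H. P (P f) = P f)"

definition scalar_measure ::
  "(('t \<Rightarrow> 'v) \<Rightarrow> ('t \<Rightarrow> 'v) \<Rightarrow> real) \<Rightarrow> (real set \<Rightarrow> ('t \<Rightarrow> 'v) \<Rightarrow> ('t \<Rightarrow> 'v)) \<Rightarrow> ('t \<Rightarrow> 'v) \<Rightarrow> real measure" where
  "scalar_measure ip E f = measure_of UNIV (sets borel) (\<lambda>S. ennreal (ip (E S f) f))"

text \<open>
  \<open>E\<close> is the projection-valued measure on the Borel sets of the real line with \<open>A = \<integral> x dE(x)\<close>.
  The last two lines state this identity on the diagonal, which determines the selfadjoint
  operator \<open>A\<close> by polarisation.
\<close>

definition is_spectral_measure ::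
  "('t \<Rightarrow> 'v::real_vector) set \<Rightarrow> (('t \<Rightarrow> 'v) \<Rightarrow> ('t \<Rightarrow> 'v) \<Rightarrow> real) \<Rightarrow> (('t \<Rightarrow> 'v) \<Rightarrow> ('t \<Rightarrow> 'v)) \<Rightarrow>
     (real set \<Rightarrow> ('t \<Rightarrow> 'v) \<Rightarrow> ('t \<Rightarrow> 'v)) \<Rightarrow> bool" where
  "is_spectral_measure H ip A E \<longleftrightarrow>
     (\<forall>S\<in>sets borel. orth_projection H ip (E S)) \<and>
     (\<forall>f\<in>H. E UNIV f = f) \<and>
     (\<forall>S\<in>sets borel. \<forall>S'\<in>sets borel. \<forall>f\<in>H. E (S \<inter> S') f = E S (E S' f)) \<and>
     (\<forall>f\<in>H. \<forall>S::nat \<Rightarrow> real set. range S \<subseteq> sets borel \<longrightarrow> disjoint_family S \<longrightarrow>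
        (\<lambda>k. ip (E (S k) f) f) sums ip (E (\<Union>k. S k) f) f) \<and>
     (\<forall>f\<in>H. integrable (scalar_measure ip E f) (\<lambda>x. x) \<and>
        ip (A f) f = (LINT x|scalar_measure ip E f. x))"

text \<open>Dimension of a space of functions: the largest number of linearly independent elements.\<close>

definition lin_indep_set :: "('t \<Rightarrow> 'v::real_vector) set \<Rightarrow> bool" where
  "lin_indep_set B \<longleftrightarrow>
     (\<forall>c. (\<forall>t. (\<Sum>b\<in>B. c b *\<^sub>R b t) = 0) \<longrightarrow> (\<forall>b\<in>B. c b = (0::real)))"

definition fun_dim :: "('t \<Rightarrow> 'v::real_vector) set \<Rightarrow> enat" where
  "fun_dim V = Sup {enat (card B) | B. finite B \<and> B \<subseteq> V \<and> lin_indep_set B}"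

text \<open>
  \<open>k\<close> is the spectral index: the dimension of the negative spectral subspace, i.e. the range of
  the spectral projection of the open negative half-line, of the bounded selfadjoint operator
  representing the quadratic form.
\<close>

definition has_spectral_index ::
  "('n::finite \<Rightarrow> real) \<Rightarrow> real \<Rightarrow> ereal \<Rightarrow> real^'d^'n \<Rightarrow> (real \<Rightarrow> real^'d^'n) \<Rightarrow> real \<Rightarrow>
     enat \<Rightarrow> bool" where
  "has_spectral_index m \<alpha> T s\<^sub>0 \<gamma> h k \<longleftrightarrow>
     (\<exists>A E. bounded_selfadjoint (W12_0 m) (inner_W12 m) A \<and>
        (\<forall>\<eta>\<in>W12_0 m. quad_form m \<alpha> T s\<^sub>0 \<gamma> h \<eta> = inner_W12 m (A \<eta>) \<eta>) \<and>
        is_spectral_measure (W12_0 m) (inner_W12 m) A E \<and>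
        k = fun_dim (E {..<0} ` W12_0 m))"

end

theory Submission
  imports Defs
begin

text \<open>
  Along an asymptotic solution the rescaled radial velocity \<open>v = r\<^bsup>\<alpha>/2\<^esup> r'\<close> satisfies, in the new
  time, \<open>v' = (2-\<alpha>)/2 (2U(s\<^sub>0) - v\<^sup>2) + o(1)\<close> and \<open>v\<^sup>2 \<le> 2U(s\<^sub>0) + o(1)\<close>, while \<open>ln r\<close> is its
  primitive.  Since \<open>ln r\<close> tends to minus infinity (collision) or to infinity (parabolic), \<open>v\<close>
  converges to the corresponding root, and the energy relation then gives \<open>s' \<rightarrow> 0\<close>.  So the
  coefficients of the quadratic form converge.  By the [BS]-condition the limit form is positive up to
  the cross term, which is a total derivative; hence the form is nonnegative on functions supported
  in a late half-line.  On the remaining bounded interval it is nonnegative on functions that vanish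
  at the points of a fine grid, by the Poincare inequality in each cell.  Thus the form is nonnegative
  on a subspace cut out by finitely many linear conditions, whereas it is negative on the nonzero
  elements of the negative spectral subspace, whose dimension is therefore at most the number of
  conditions.
\<close>

text \<open>Only the convergence of the normalised configuration is assumed, with no growth rate for
  \<open>r\<close>, so the limit of \<open>v\<close> has to come from the flow itself. This is done
  in the old time with the factor \<open>\<theta>\<close> = d\<tau>/dt, because the convergence of
  \<open>v\<close> is what later shows that the new time fills the whole half-line. The curve y runs
  to 0 or to infinity, yet the Hessian of W along it converges: W is homogeneous of degree 2, so its
  Hessian at y is the one at s, and at \<open>s\<^sub>0\<close> it agrees on centred vectors with
  that of \<open>U_tilde\<close>. The constant of the [BS]-condition enters through
  2U(\<open>s\<^sub>0\<close>) - c \<delta>^2 = (2-\<alpha>)^2/8 U(\<open>s\<^sub>0\<close>), where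
  \<delta> is the limit of \<rho>'/\<rho>. Only the cross term with frozen coefficients integrates
  to zero; its deviation from the actual one is absorbed, like all other deviations, by a small
  multiple of |\<eta>|^2 + |\<eta>'|^2. At time 0 the solution is assumed to be merely continuous,
  so the coefficients on a bounded interval are controlled by the energy relation and not by
  continuity of the velocity. Point values serve as conditions because each costs finitely many
  scalar equations.\<close>

section \<open>The mass inner product and centred configurations\<close>

text \<open>This is the square root of the mass matrix. It carries the mass inner product to the
  Euclidean one, so Cauchy-Schwarz and the calculus of norms can be transported from the
  library.\<close>

definition mass_scale :: "('n::finite \<Rightarrow> real) \<Rightarrow> real^'d^'n \<Rightarrow> real^'d^'n" where
  "mass_scale m u = (\<chi> i. sqrt (m i) *\<^sub>R (u $ i))"

lemma bounded_linear_mass_scale: "bounded_linear (mass_scale m)"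
  by (rule linear_conv_bounded_linear[THEN iffD1], rule linearI)
    (auto simp: mass_scale_def vec_eq_iff algebra_simps)

lemma inner_M_mass_scale:
  assumes "\<forall>i. 0 < m i"
  shows "inner_M m u v = mass_scale m u \<bullet> mass_scale m v"
proof -
  have "m i * (u $ i \<bullet> v $ i) = mass_scale m u $ i \<bullet> mass_scale m v $ i" for i
    using assms[rule_format, of i] by (simp add: mass_scale_def flip: mult.assoc)
  then show ?thesis
    by (simp add: inner_M_def inner_vec_def[of "mass_scale m u"])
qed

lemma norm_M_mass_scale:
  assumes "\<forall>i. 0 < m i"
  shows "norm_M m u = norm (mass_scale m u)"
  by (simp add: norm_M_def inner_M_mass_scale[OF assms] norm_eq_sqrt_inner)

lemma bounded_bilinear_inner_M:
  fixes m :: "'n::finite \<Rightarrow> real"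
  shows "bounded_bilinear (inner_M m :: real^'d^'n \<Rightarrow> _)"
proof -
  have "bounded_linear (\<lambda>u :: real^'d^'n. (\<chi> i. m i *\<^sub>R (u $ i)))" for m :: "'n::finite \<Rightarrow> real"
    by (rule linear_conv_bounded_linear[THEN iffD1], rule linearI)
      (auto simp: vec_eq_iff algebra_simps)
  from bounded_bilinear.comp1[OF bounded_bilinear_inner this]
  have "bounded_bilinear (\<lambda>u v :: real^'d^'n. (\<chi> i. m i *\<^sub>R (u $ i)) \<bullet> v)" .
  moreover have "(\<chi> i. m i *\<^sub>R (u $ i)) \<bullet> v = inner_M m u v" for u v :: "real^'d^'n"
    by (simp add: inner_M_def inner_vec_def[of "\<chi> i. m i *\<^sub>R (u $ i)"])
  ultimately show ?thesis by simp
qed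

lemmas inner_M_bilinear_simps =
  bounded_bilinear.add_left[OF bounded_bilinear_inner_M]
  bounded_bilinear.add_right[OF bounded_bilinear_inner_M]
  bounded_bilinear.diff_left[OF bounded_bilinear_inner_M]
  bounded_bilinear.diff_right[OF bounded_bilinear_inner_M]
  bounded_bilinear.scaleR_left[OF bounded_bilinear_inner_M, unfolded real_scaleR_def]
  bounded_bilinear.scaleR_right[OF bounded_bilinear_inner_M, unfolded real_scaleR_def]
  bounded_bilinear.zero_left[OF bounded_bilinear_inner_M]
  bounded_bilinear.zero_right[OF bounded_bilinear_inner_M]
  bounded_bilinear.minus_left[OF bounded_bilinear_inner_M]
  bounded_bilinear.minus_right[OF bounded_bilinear_inner_M]

lemmas continuous_on_inner_M [continuous_intros] =
  bounded_bilinear.continuous_on[OF bounded_bilinear_inner_M]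

lemmas tendsto_inner_M [tendsto_intros] =
  bounded_bilinear.tendsto[OF bounded_bilinear_inner_M]

lemmas has_derivative_inner_M [derivative_intros] =
  bounded_bilinear.FDERIV[OF bounded_bilinear_inner_M]

lemma inner_M_commute: "inner_M m u v = inner_M m v u"
  by (simp add: inner_M_def inner_commute)

lemma inner_M_self_nonneg:
  assumes "\<forall>i. 0 < m i"
  shows "0 \<le> inner_M m u u"
  by (simp add: inner_M_mass_scale[OF assms])

lemma norm_M_sq:
  assumes "\<forall>i. 0 < m i"
  shows "(norm_M m u)\<^sup>2 = inner_M m u u"
  by (simp add: norm_M_def inner_M_self_nonneg[OF assms])

lemma norm_M_nonneg: 
  assumes "\<forall>i. 0 < m i"
  shows "0 \<le> norm_M m u"
  by (simp add: norm_M_mass_scale[OF assms])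

lemma inj_mass_scale:
  fixes m :: "'n::finite \<Rightarrow> real"
  assumes "\<forall>i. 0 < m i"
  shows "inj (mass_scale m :: real^'d^'n \<Rightarrow> _)"
proof (rule injI)
  fix u v :: "real^'d^'n"
  assume eq: "mass_scale m u = mass_scale m v"
  have "u $ i = v $ i" for i
    using arg_cong[OF eq, of "\<lambda>w. w $ i"] assms[rule_format, of i] by (simp add: mass_scale_def)
  then show "u = v" by (simp add: vec_eq_iff)
qed

lemma mass_scale_eq_0_iff:
  assumes "\<forall>i. 0 < m i"
  shows "mass_scale m u = 0 \<longleftrightarrow> u = 0"
  using injD[OF inj_mass_scale[OF assms], where x = u and y = 0]
  by (auto simp: linear_0[OF bounded_linear.linear[OF bounded_linear_mass_scale]])

lemma norm_M_eq_0_iff: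
  assumes "\<forall>i. 0 < m i"
  shows "norm_M m u = 0 \<longleftrightarrow> u = 0"
  by (simp add: norm_M_mass_scale[OF assms] mass_scale_eq_0_iff[OF assms])

lemma inner_M_self_eq_0_iff:
  assumes "\<forall>i. 0 < m i"
  shows "inner_M m u u = 0 \<longleftrightarrow> u = 0"
  by (simp add: norm_M_sq[OF assms, symmetric] norm_M_eq_0_iff[OF assms])

lemma norm_M_scaleR:
  assumes "\<forall>i. 0 < m i"
  shows "norm_M m (c *\<^sub>R u) = \<bar>c\<bar> * norm_M m u"
  by (simp add: norm_M_mass_scale[OF assms] linear_scale[OF bounded_linear.linear[OF bounded_linear_mass_scale]])

lemma continuous_on_norm_M [continuous_intros]:
  "continuous_on S f \<Longrightarrow> continuous_on S (\<lambda>x. norm_M m (f x))"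
  unfolding norm_M_def by (intro continuous_intros)

lemma tendsto_norm_M [tendsto_intros]:
  "(f \<longlongrightarrow> l) F \<Longrightarrow> ((\<lambda>x. norm_M m (f x)) \<longlongrightarrow> norm_M m l) F"
  unfolding norm_M_def by (intro tendsto_intros)

lemma abs_inner_M_le:
  assumes "\<forall>i. 0 < m i"
  shows "\<bar>inner_M m u v\<bar> \<le> norm_M m u * norm_M m v"
  by (simp add: norm_M_mass_scale[OF assms] inner_M_mass_scale[OF assms] Cauchy_Schwarz_ineq2)

text \<open>An injective linear map on a finite-dimensional space is bounded below as well as above;
  this is applied to \<open>mass_scale\<close>.\<close>

lemma norm_M_bounds:
  fixes m :: "'n::finite \<Rightarrow> real"
  assumes "\<forall>i. 0 < m i"
  obtains a b where "0 < a" "0 < b" "\<And>u :: real^'d^'n. a * norm u \<le> norm_M m u"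
    "\<And>u :: real^'d^'n. norm_M m u \<le> b * norm u"
proof -
  obtain a where a: "0 < a" "\<And>u :: real^'d^'n. a * norm u \<le> norm (mass_scale m u)"
    using linear_inj_bounded_below_pos[OF bounded_linear.linear[OF bounded_linear_mass_scale]
      inj_mass_scale[OF assms]] by metis
  obtain b where "0 < b" "\<And>u :: real^'d^'n. norm (mass_scale m u) \<le> norm u * b"
    using bounded_linear.pos_bounded[OF bounded_linear_mass_scale] by blast
  with a show ?thesis
    by (intro that[of a b]) (auto simp: norm_M_mass_scale[OF assms] mult.commute)
qed

lemma subspace_Xspace:
  fixes m :: "'n::finite \<Rightarrow> real"
  shows "subspace (Xspace m :: (real^'d^'n) set)"
proof (rule subspaceI)
  fix x y :: "real^'d^'n" and c :: real
  show "x \<in> Xspace m \<Longrightarrow> y \<in> Xspace m \<Longrightarrow> x + y \<in> Xspace m"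
    by (simp add: Xspace_def scaleR_add_right sum.distrib)
  have "(\<Sum>i\<in>UNIV. m i *\<^sub>R (c *\<^sub>R x) $ i) = c *\<^sub>R (\<Sum>i\<in>UNIV. m i *\<^sub>R x $ i)"
    by (simp add: scaleR_sum_right mult.commute)
  then show "x \<in> Xspace m \<Longrightarrow> c *\<^sub>R x \<in> Xspace m"
    by (simp add: Xspace_def)
qed (simp add: Xspace_def)

text \<open>The Euclidean representative \<open>w0\<close> divided by the masses represents \<phi>
  on the whole space. Constant configurations are M-orthogonal to \<open>Xspace m\<close>, so
  subtracting the centre of mass \<open>c\<close> centres the vector without changing its pairings
  there.\<close>

lemma riesz_M_ex1:
  fixes \<phi> :: "real^'d^'n \<Rightarrow> real"
  assumes m: "\<forall>i. 0 < m i" and "linear \<phi>"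
  shows "\<exists>!w. w \<in> Xspace m \<and> (\<forall>v\<in>Xspace m. inner_M m w v = \<phi> v)"
proof -
  obtain w0 where w0: "\<And>v. \<phi> v = w0 \<bullet> v"
    using adjoint_works[OF \<open>linear \<phi>\<close>, of _ 1] that[of "adjoint \<phi> 1"] by (simp add: inner_commute)
  define w1 :: "real^'d^'n" where "w1 = (\<chi> i. (1 / m i) *\<^sub>R w0 $ i)"
  have w1: "inner_M m w1 v = \<phi> v" for v
  proof -
    have "m i * (w1 $ i \<bullet> v $ i) = w0 $ i \<bullet> v $ i" for i
      using m[rule_format, of i] by (simp add: w1_def)
    then show ?thesis by (simp add: w0 inner_M_def inner_vec_def[of w0])
  qed
  have M: "0 < sum m UNIV"
    using m by (intro sum_pos) auto
  define c where "c = (1 / sum m UNIV) *\<^sub>R (\<Sum>i\<in>UNIV. m i *\<^sub>R w1 $ i)"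
  define w where "w = w1 - (\<chi> i. c)"
  have "(\<Sum>i\<in>UNIV. m i *\<^sub>R w $ i) = 0"
    using M by (simp add: w_def scaleR_diff_right sum_subtractf scaleR_sum_left[symmetric])
      (simp add: c_def)
  then have wX: "w \<in> Xspace m" by (simp add: Xspace_def)
  have "inner_M m (\<chi> i. c) v = 0" if "v \<in> Xspace m" for v
  proof -
    have "inner_M m (\<chi> i. c) v = c \<bullet> (\<Sum>i\<in>UNIV. m i *\<^sub>R v $ i)"
      by (simp add: inner_M_def inner_sum_right)
    then show ?thesis using that by (simp add: Xspace_def)
  qed
  then have w: "\<forall>v\<in>Xspace m. inner_M m w v = \<phi> v"
    by (simp add: w_def inner_M_bilinear_simps w1)
  show ?thesis
  proof (intro ex1I[of _ w] conjI)
    fix w' assume w': "w' \<in> Xspace m \<and> (\<forall>v\<in>Xspace m. inner_M m w' v = \<phi> v)"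
    have "w' - w \<in> Xspace m"
      using w' wX subspace_Xspace by (auto intro: subspace_diff)
    then have "inner_M m (w' - w) (w' - w) = 0"
      using w w' by (simp add: inner_M_bilinear_simps(3))
    then show "w' = w" by (simp add: inner_M_self_eq_0_iff[OF m])
  qed (use wX w in auto)
qed

lemma inner_riesz_M:
  assumes "\<forall>i. 0 < m i" "linear \<phi>" "v \<in> Xspace m"
  shows "inner_M m (riesz_M m \<phi>) v = \<phi> v"
  using theI'[OF riesz_M_ex1[OF assms(1,2)]] assms(3) by (auto simp: riesz_M_def)

lemma inner_adjoint_M:
  assumes "\<forall>i. 0 < m i" "linear L" "v \<in> Xspace m"
  shows "inner_M m (adjoint_M m L u) v = inner_M m u (L v)"
proof -
  have "linear (\<lambda>v. inner_M m u (L v))"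
    using assms(2) by (auto intro!: linearI simp: inner_M_bilinear_simps linear_add linear_scale)
  from inner_riesz_M[OF assms(1) this assms(3)] show ?thesis by (simp add: adjoint_M_def)
qed

section \<open>Differentials of the potential\<close>

text \<open>\<open>Xhat m\<close> lies in a proper subspace and is not open in the ambient space.
  Differentials are therefore taken on this larger set, which is open and on which the potential is
  smooth.\<close>

definition collision_free :: "(real^'d^'n) set" where
  "collision_free = {x. \<forall>i j. i \<noteq> j \<longrightarrow> x $ i \<noteq> x $ j}"

lemma open_collision_free: "open (collision_free :: (real^'d^'n) set)"
proof -
  have eq: "(collision_free :: (real^'d^'n) set) =
      (\<Inter>p\<in>{p. fst p \<noteq> snd p}. {x. x $ fst p \<noteq> x $ snd p})"
    by (auto simp: collision_free_def)
  have "open {x :: real^'d^'n. x $ i \<noteq> x $ j}" for i j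
    by (intro open_Collect_neq continuous_intros)
  then show ?thesis unfolding eq by (intro open_INT finite ballI)
qed

lemma Xhat_subset: "Xhat m \<subseteq> collision_free"
  by (auto simp: Xhat_def collision_free_def)

lemma collision_free_nonzero:
  fixes x :: "real^'d^'n"
  assumes "2 \<le> CARD('n)" "x \<in> collision_free"
  shows "x \<noteq> 0"
proof
  assume "x = 0"
  have "\<not> (\<forall>i j :: 'n. i = j)"
  proof
    assume "\<forall>i j :: 'n. i = j"
    then have "CARD('n) \<le> Suc 0" by (subst card_le_Suc0_iff_eq) auto
    with assms(1) show False by simp
  qed
  then obtain i j :: 'n where "i \<noteq> j" by blast
  with assms(2) \<open>x = 0\<close> show False by (auto simp: collision_free_def)
qed

lemma collision_free_scaleR: "c \<noteq> 0 \<Longrightarrow> c *\<^sub>R x \<in> collision_free \<longleftrightarrow> x \<in> collision_free"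
  by (auto simp: collision_free_def)

text \<open>The first and second differentials are kept in closed form, so that homogeneity and
  joint continuity in the base point and the directions can be read off.\<close>

definition potential' :: "('n::finite \<Rightarrow> real) \<Rightarrow> real \<Rightarrow> real^'d^'n \<Rightarrow> real^'d^'n \<Rightarrow> real" where
  "potential' m \<alpha> x u = (\<Sum>i\<in>UNIV. \<Sum>j\<in>UNIV - {i}. m i * m j *
     (- \<alpha> * norm (x $ i - x $ j) powr (- \<alpha> - 2) * ((x $ i - x $ j) \<bullet> (u $ i - u $ j)))) / 2"

definition potential'' ::
  "('n::finite \<Rightarrow> real) \<Rightarrow> real \<Rightarrow> real^'d^'n \<Rightarrow> real^'d^'n \<Rightarrow> real^'d^'n \<Rightarrow> real" where
  "potential'' m \<alpha> x u v = (\<Sum>i\<in>UNIV. \<Sum>j\<in>UNIV - {i}. m i * m j *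
     (- \<alpha> * (norm (x $ i - x $ j) powr (- \<alpha> - 2) * ((u $ i - u $ j) \<bullet> (v $ i - v $ j))
        - (\<alpha> + 2) * norm (x $ i - x $ j) powr (- \<alpha> - 4) *
            ((x $ i - x $ j) \<bullet> (u $ i - u $ j)) * ((x $ i - x $ j) \<bullet> (v $ i - v $ j))))) / 2"

lemma has_derivative_norm_powr:
  fixes z :: "'a::real_inner"
  assumes "z \<noteq> 0"
  shows "((\<lambda>z. norm z powr p) has_derivative (\<lambda>u. p * norm z powr (p - 2) * (z \<bullet> u))) (at z)"
proof -
  have "((\<lambda>z. norm z powr p) has_derivative
      (\<lambda>u. norm z powr p * (p * (sgn z \<bullet> u) / norm z))) (at z)"
    by (rule has_derivative_eq_rhs[OF has_derivative_powr[OF has_derivative_norm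
      has_derivative_const]]) (use assms in \<open>auto simp: inner_commute\<close>)
  moreover have "norm z powr p * (p * (sgn z \<bullet> u) / norm z) = p * norm z powr (p - 2) * (z \<bullet> u)" for u
  proof -
    have "norm z powr (p - 2) = norm z powr p / (norm z * norm z)"
      using assms by (simp add: powr_diff power2_eq_square)
    then show ?thesis by (simp add: sgn_div_norm divide_inverse)
  qed
  ultimately show ?thesis by simp
qed

lemma has_derivative_pair_diff:
  "((\<lambda>x::real^'d^'n. x $ i - x $ j) has_derivative (\<lambda>u. u $ i - u $ j)) (at x)"
  by (intro has_derivative_diff bounded_linear_imp_has_derivative bounded_linear_vec_nth)

lemma has_derivative_pair_norm_powr:
  fixes x :: "real^'d^'n"
  assumes "x $ i \<noteq> x $ j"
  shows "((\<lambda>x. norm (x $ i - x $ j) powr p) has_derivative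
     (\<lambda>u. p * norm (x $ i - x $ j) powr (p - 2) * ((x $ i - x $ j) \<bullet> (u $ i - u $ j)))) (at x)"
proof -
  from diff_chain_at[OF has_derivative_pair_diff has_derivative_norm_powr[of "x $ i - x $ j" p]] assms
  show ?thesis by (simp add: o_def)
qed

lemma has_derivative_potential:
  fixes x :: "real^'d^'n"
  assumes "x \<in> collision_free"
  shows "(potential m \<alpha> has_derivative potential' m \<alpha> x) (at x)"
proof -
  have "((\<lambda>x. m i * m j * norm (x $ i - x $ j) powr (- \<alpha>)) has_derivative (\<lambda>u. m i * m j *
     (- \<alpha> * norm (x $ i - x $ j) powr (- \<alpha> - 2) * ((x $ i - x $ j) \<bullet> (u $ i - u $ j))))) (at x)"
    if "j \<in> UNIV - {i}" for i j
    by (rule has_derivative_mult_right, rule has_derivative_pair_norm_powr)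
      (use that assms in \<open>auto simp: collision_free_def\<close>)
  then show ?thesis
    unfolding potential_def[abs_def] potential'_def[abs_def]
    by (intro bounded_linear.has_derivative[OF bounded_linear_divide] has_derivative_sum)
qed

lemma has_derivative_potential':
  fixes x :: "real^'d^'n"
  assumes "x \<in> collision_free"
  shows "((\<lambda>x. potential' m \<alpha> x u) has_derivative potential'' m \<alpha> x u) (at x)"
proof -
  have "((\<lambda>x. m i * m j *
     (- \<alpha> * norm (x $ i - x $ j) powr (- \<alpha> - 2) * ((x $ i - x $ j) \<bullet> (u $ i - u $ j))))
     has_derivative (\<lambda>v. m i * m j *
     (- \<alpha> * (norm (x $ i - x $ j) powr (- \<alpha> - 2) * ((u $ i - u $ j) \<bullet> (v $ i - v $ j))
        - (\<alpha> + 2) * norm (x $ i - x $ j) powr (- \<alpha> - 4) *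
            ((x $ i - x $ j) \<bullet> (u $ i - u $ j)) * ((x $ i - x $ j) \<bullet> (v $ i - v $ j)))))) (at x)"
    if "j \<in> UNIV - {i}" for i j
  proof -
    have ne: "x $ i \<noteq> x $ j" using that assms by (auto simp: collision_free_def)
    have d: "((\<lambda>x::real^'d^'n. (x $ i - x $ j) \<bullet> (u $ i - u $ j)) has_derivative
        (\<lambda>v. (u $ i - u $ j) \<bullet> (v $ i - v $ j))) (at x)"
      by (rule has_derivative_eq_rhs[OF has_derivative_inner_left[OF has_derivative_pair_diff]])
        (simp add: fun_eq_iff inner_commute)
    have eq: "- \<alpha> - 2 - 2 = - \<alpha> - 4" by simp
    have aux: "- \<alpha> * A * a + - \<alpha> * ((- \<alpha> - 2) * B * b) * c =
        - \<alpha> * (A * a - (\<alpha> + 2) * B * c * b)" for A B a b c :: real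
      by (simp add: algebra_simps)
    show ?thesis
      by (rule has_derivative_eq_rhs[OF has_derivative_mult_right[OF has_derivative_mult[OF
        has_derivative_mult_right[OF has_derivative_pair_norm_powr[OF ne]] d]]])
        (rule ext, simp only: eq aux)
  qed
  then show ?thesis
    unfolding potential'_def[abs_def] potential''_def[abs_def]
    by (intro bounded_linear.has_derivative[OF bounded_linear_divide] has_derivative_sum)
qed

text \<open>The inner \<open>frechet_derivative\<close> is evaluated at moving points, so the first
  derivative must be known on a neighbourhood of x before the second one can be computed at
  x.\<close>

lemma second_differential_eq:
  assumes "open S" "x \<in> S" "\<And>z. z \<in> S \<Longrightarrow> (f has_derivative f' z) (at z)"
    and "((\<lambda>z. f' z u) has_derivative D) (at x)"
  shows "second_differential f x u = D"
proof -
  have "((\<lambda>z. frechet_derivative f (at z) u) has_derivative D) (at x)"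
    by (rule has_derivative_transform_within_open[OF assms(4,1,2)])
      (simp add: frechet_derivative_at[OF assms(3), symmetric])
  from frechet_derivative_at[OF this] show ?thesis
    by (simp add: second_differential_def[abs_def])
qed

lemma potential_scaleR:
  assumes "0 < c"
  shows "potential m \<alpha> (c *\<^sub>R x) = c powr (- \<alpha>) * potential m \<alpha> x"
proof -
  have "norm ((c *\<^sub>R x) $ i - (c *\<^sub>R x) $ j) powr p = c powr p * norm (x $ i - x $ j) powr p" for i j p
    using assms by (simp add: powr_mult flip: scaleR_diff_right)
  then show ?thesis
    by (simp add: potential_def sum_distrib_left mult_ac)
qed

lemma potential'_scaleR:
  assumes "0 < c"
  shows "potential' m \<alpha> (c *\<^sub>R x) u = c powr (- \<alpha> - 1) * potential' m \<alpha> x u"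
proof -
  have 1: "norm ((c *\<^sub>R x) $ i - (c *\<^sub>R x) $ j) powr p = c powr p * norm (x $ i - x $ j) powr p" for i j p
    using assms by (simp add: powr_mult flip: scaleR_diff_right)
  have 2: "((c *\<^sub>R x) $ i - (c *\<^sub>R x) $ j) \<bullet> w = c * ((x $ i - x $ j) \<bullet> w)" for i j w
    by (simp flip: scaleR_diff_right)
  have 3: "c powr (- \<alpha> - 2) * c = c powr (- \<alpha> - 1)"
  proof -
    have "- \<alpha> - 1 = - \<alpha> - 2 + 1" by simp
    then show ?thesis using assms by (simp only: powr_add) simp
  qed
  have "m i * m j * (- \<alpha> * norm ((c *\<^sub>R x) $ i - (c *\<^sub>R x) $ j) powr (- \<alpha> - 2) *
        (((c *\<^sub>R x) $ i - (c *\<^sub>R x) $ j) \<bullet> (u $ i - u $ j))) =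
      c powr (- \<alpha> - 1) * (m i * m j * (- \<alpha> * norm (x $ i - x $ j) powr (- \<alpha> - 2) *
        ((x $ i - x $ j) \<bullet> (u $ i - u $ j))))" for i j
    unfolding 1 2 3[symmetric] by (simp only: mult_ac)
  then show ?thesis
    unfolding potential'_def by (simp only: sum_distrib_left[symmetric] times_divide_eq_right)
qed

lemma potential''_scaleR:
  assumes "0 < c"
  shows "potential'' m \<alpha> (c *\<^sub>R x) u v = c powr (- \<alpha> - 2) * potential'' m \<alpha> x u v"
proof -
  have 1: "norm ((c *\<^sub>R x) $ i - (c *\<^sub>R x) $ j) powr p = c powr p * norm (x $ i - x $ j) powr p" for i j p
    using assms by (simp add: powr_mult flip: scaleR_diff_right)
  have 2: "((c *\<^sub>R x) $ i - (c *\<^sub>R x) $ j) \<bullet> w = c * ((x $ i - x $ j) \<bullet> w)" for i j w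
    by (simp flip: scaleR_diff_right)
  have 3: "c powr (- \<alpha> - 2) = c powr (- \<alpha> - 4) * c * c"
  proof -
    have "- \<alpha> - 2 = - \<alpha> - 4 + 2" by simp
    then show ?thesis using assms by (simp only: powr_add) (simp add: power2_eq_square)
  qed
  have aux: "mi * mj * (- \<alpha> * (C * A * a - (\<alpha> + 2) * (C' * B) * (c * b) * (c * d))) =
      C * (mi * mj * (- \<alpha> * (A * a - (\<alpha> + 2) * B * b * d)))"
    if "C = C' * c * c" for mi mj C A a C' B b d :: real
    using that by (simp add: algebra_simps)
  have "m i * m j *
     (- \<alpha> * (norm ((c *\<^sub>R x) $ i - (c *\<^sub>R x) $ j) powr (- \<alpha> - 2) * ((u $ i - u $ j) \<bullet> (v $ i - v $ j))
        - (\<alpha> + 2) * norm ((c *\<^sub>R x) $ i - (c *\<^sub>R x) $ j) powr (- \<alpha> - 4) *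
            (((c *\<^sub>R x) $ i - (c *\<^sub>R x) $ j) \<bullet> (u $ i - u $ j)) *
            (((c *\<^sub>R x) $ i - (c *\<^sub>R x) $ j) \<bullet> (v $ i - v $ j)))) =
      c powr (- \<alpha> - 2) * (m i * m j *
     (- \<alpha> * (norm (x $ i - x $ j) powr (- \<alpha> - 2) * ((u $ i - u $ j) \<bullet> (v $ i - v $ j))
        - (\<alpha> + 2) * norm (x $ i - x $ j) powr (- \<alpha> - 4) *
            ((x $ i - x $ j) \<bullet> (u $ i - u $ j)) * ((x $ i - x $ j) \<bullet> (v $ i - v $ j)))))" for i j
    unfolding 1 2 by (rule aux[OF 3])
  then show ?thesis
    unfolding potential''_def by (simp only: sum_distrib_left[symmetric] times_divide_eq_right)
qed

text \<open>Euler's identity for a function homogeneous of degree -\<alpha>, verified pair by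
  pair.\<close>

lemma potential'_self:
  assumes "x \<in> collision_free"
  shows "potential' m \<alpha> x x = - \<alpha> * potential m \<alpha> x"
proof -
  have "m i * m j * (- \<alpha> * norm (x $ i - x $ j) powr (- \<alpha> - 2) * ((x $ i - x $ j) \<bullet> (x $ i - x $ j)))
      = - \<alpha> * (m i * m j * norm (x $ i - x $ j) powr (- \<alpha>))" if "j \<in> UNIV - {i}" for i j
  proof -
    have "0 < norm (x $ i - x $ j)"
      using assms that by (auto simp: collision_free_def)
    then have "norm (x $ i - x $ j) powr (- \<alpha> - 2) * ((x $ i - x $ j) \<bullet> (x $ i - x $ j)) =
        norm (x $ i - x $ j) powr (- \<alpha>)"
      using powr_add[of "norm (x $ i - x $ j)" "- \<alpha> - 2" 2]
      by (simp add: power2_norm_eq_inner)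
    then show ?thesis by (simp only: mult_ac)
  qed
  then show ?thesis
    unfolding potential'_def potential_def sum_distrib_left times_divide_eq_right
    by (intro arg_cong2[where f = "(/)"] sum.cong refl) simp
qed

lemma potential_pos:
  fixes x :: "real^'d^'n"
  assumes m: "\<forall>i. 0 < m i" and "2 \<le> CARD('n)" "x \<in> collision_free"
  shows "0 < potential m \<alpha> x"
proof -
  have "0 < (\<Sum>j\<in>UNIV - {i}. m i * m j * norm (x $ i - x $ j) powr - \<alpha>)" for i
  proof (rule sum_pos)
    have "card (UNIV - {i}) \<noteq> 0" using assms(2) by (simp add: card_Diff_singleton)
    then show "UNIV - {i} \<noteq> {}" by force
    show "0 < m i * m j * norm (x $ i - x $ j) powr - \<alpha>" if "j \<in> UNIV - {i}" for j
      using assms(3) that m by (auto simp: collision_free_def)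
  qed simp
  then have "0 < (\<Sum>i\<in>UNIV. \<Sum>j\<in>UNIV - {i}. m i * m j * norm (x $ i - x $ j) powr - \<alpha>)"
    by (intro sum_pos[OF finite UNIV_not_empty]) blast
  then show ?thesis by (simp add: potential_def)
qed

section \<open>Hessians of the potential weighted by a power of the norm\<close>

definition norm_M_powr' :: "('n::finite \<Rightarrow> real) \<Rightarrow> real \<Rightarrow> real^'d^'n \<Rightarrow> real^'d^'n \<Rightarrow> real" where
  "norm_M_powr' m p x u = p * norm_M m x powr (p - 2) * inner_M m x u"

definition norm_M_powr'' ::
  "('n::finite \<Rightarrow> real) \<Rightarrow> real \<Rightarrow> real^'d^'n \<Rightarrow> real^'d^'n \<Rightarrow> real^'d^'n \<Rightarrow> real" where
  "norm_M_powr'' m p x u v = p * (norm_M m x powr (p - 2) * inner_M m u v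
     + (p - 2) * norm_M m x powr (p - 4) * inner_M m x u * inner_M m x v)"

lemma has_derivative_norm_M_powr:
  assumes m: "\<forall>i. 0 < m i" and "x \<noteq> 0"
  shows "((\<lambda>x. norm_M m x powr p) has_derivative norm_M_powr' m p x) (at x)"
proof -
  have "mass_scale m x \<noteq> 0" using assms by (simp add: mass_scale_eq_0_iff)
  from diff_chain_at[OF bounded_linear_imp_has_derivative[OF bounded_linear_mass_scale]
      has_derivative_norm_powr[OF this]]
  show ?thesis
    by (simp add: norm_M_mass_scale[OF m] norm_M_powr'_def[abs_def] inner_M_mass_scale[OF m] o_def)
qed

lemma has_derivative_norm_M_powr':
  assumes m: "\<forall>i. 0 < m i" and "x \<noteq> 0"
  shows "((\<lambda>x. norm_M_powr' m p x u) has_derivative norm_M_powr'' m p x u) (at x)"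
proof -
  have d: "((\<lambda>x. inner_M m x u) has_derivative inner_M m u) (at x)"
    by (rule has_derivative_eq_rhs[OF has_derivative_inner_M[OF has_derivative_ident has_derivative_const]])
      (simp add: fun_eq_iff inner_M_bilinear_simps inner_M_commute)
  have eq: "p - 2 - 2 = p - 4" by simp
  have aux: "p * A * a + p * ((p - 2) * B * b) * c = p * (A * a + (p - 2) * B * c * b)"
    for A B a b c :: real
    by (simp add: algebra_simps)
  show ?thesis
    unfolding norm_M_powr'_def[abs_def]
    by (rule has_derivative_eq_rhs[OF has_derivative_mult[OF
      has_derivative_mult_right[OF has_derivative_norm_M_powr[OF assms]] d]])
      (rule ext, simp only: norm_M_powr'_def norm_M_powr''_def eq aux)
qed

text \<open>Differentials of |x|^p U(x) by the product rule. The exponent p = 2+\<alpha> serves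
  \<open>W_fun\<close> and p = \<alpha> serves \<open>U_tilde\<close>, so both Hessians come from
  one computation.\<close>

definition weighted_potential' ::
  "('n::finite \<Rightarrow> real) \<Rightarrow> real \<Rightarrow> real \<Rightarrow> real^'d^'n \<Rightarrow> real^'d^'n \<Rightarrow> real" where
  "weighted_potential' m \<alpha> p x u =
     norm_M m x powr p * potential' m \<alpha> x u + norm_M_powr' m p x u * potential m \<alpha> x"

definition weighted_potential'' ::
  "('n::finite \<Rightarrow> real) \<Rightarrow> real \<Rightarrow> real \<Rightarrow> real^'d^'n \<Rightarrow> real^'d^'n \<Rightarrow> real^'d^'n \<Rightarrow> real" where
  "weighted_potential'' m \<alpha> p x u v =
     norm_M m x powr p * potential'' m \<alpha> x u v + norm_M_powr' m p x v * potential' m \<alpha> x u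
     + (norm_M_powr' m p x u * potential' m \<alpha> x v + norm_M_powr'' m p x u v * potential m \<alpha> x)"

lemma has_derivative_weighted_potential:
  fixes x :: "real^'d^'n"
  assumes m: "\<forall>i. 0 < m i" and "2 \<le> CARD('n)" "x \<in> collision_free"
  shows "((\<lambda>x. norm_M m x powr p * potential m \<alpha> x) has_derivative weighted_potential' m \<alpha> p x) (at x)"
    and "((\<lambda>x. weighted_potential' m \<alpha> p x u) has_derivative weighted_potential'' m \<alpha> p x u) (at x)"
proof -
  have x: "x \<noteq> 0" using collision_free_nonzero assms(2,3) by blast
  show "((\<lambda>x. norm_M m x powr p * potential m \<alpha> x) has_derivative weighted_potential' m \<alpha> p x) (at x)"
    unfolding weighted_potential'_def[abs_def]
    by (rule has_derivative_mult[OF has_derivative_norm_M_powr[OF m x] has_derivative_potential[OF assms(3)]])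
  show "((\<lambda>x. weighted_potential' m \<alpha> p x u) has_derivative weighted_potential'' m \<alpha> p x u) (at x)"
    unfolding weighted_potential'_def[abs_def] weighted_potential''_def[abs_def]
    by (intro has_derivative_add has_derivative_mult has_derivative_norm_M_powr[OF m x]
      has_derivative_potential[OF assms(3)] has_derivative_norm_M_powr'[OF m x]
      has_derivative_potential'[OF assms(3)])
qed

lemma linear_has_derivative: "(f has_derivative f') F \<Longrightarrow> linear f'"
  by (intro bounded_linear.linear has_derivative_bounded_linear)

text \<open>The parameter \<open>b\<close> stands for the value of the potential at the central
  configuration.\<close>

definition W_hess ::
  "('n::finite \<Rightarrow> real) \<Rightarrow> real \<Rightarrow> real \<Rightarrow> real^'d^'n \<Rightarrow> real^'d^'n \<Rightarrow> real^'d^'n \<Rightarrow> real" where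
  "W_hess m \<alpha> b x u v = weighted_potential'' m \<alpha> (2 + \<alpha>) x u v - 2 * b * inner_M m u v"

lemma inner_hessian_M_W:
  fixes x :: "real^'d^'n"
  assumes m: "\<forall>i. 0 < m i" and "2 \<le> CARD('n)" "x \<in> collision_free" "v \<in> Xspace m"
  shows "inner_M m (hessian_M m (W_fun m \<alpha> s\<^sub>0) x u) v = W_hess m \<alpha> (potential m \<alpha> s\<^sub>0) x u v"
proof -
  let ?b = "potential m \<alpha> s\<^sub>0"
  have 1: "(W_fun m \<alpha> s\<^sub>0 has_derivative
      (\<lambda>u. weighted_potential' m \<alpha> (2 + \<alpha>) z u - 2 * ?b * inner_M m z u)) (at z)"
    if "z \<in> collision_free" for z
    unfolding W_fun_def[abs_def] norm_M_sq[OF m]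
    by (rule has_derivative_eq_rhs[OF has_derivative_diff[OF has_derivative_weighted_potential(1)[OF m assms(2) that]
      has_derivative_mult_left[OF has_derivative_inner_M[OF has_derivative_ident has_derivative_ident]]]])
      (auto simp: fun_eq_iff inner_M_commute)
  have 2: "((\<lambda>z. weighted_potential' m \<alpha> (2 + \<alpha>) z u - 2 * ?b * inner_M m z u)
      has_derivative W_hess m \<alpha> ?b x u) (at x)"
    unfolding W_hess_def[abs_def]
    by (rule has_derivative_eq_rhs[OF has_derivative_diff[OF has_derivative_weighted_potential(2)[OF m assms(2,3)]
      has_derivative_mult_right[OF has_derivative_inner_M[OF has_derivative_ident has_derivative_const]]]])
      (auto simp: fun_eq_iff inner_M_commute inner_M_bilinear_simps)
  have "second_differential (W_fun m \<alpha> s\<^sub>0) x u = W_hess m \<alpha> ?b x u"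
    by (rule second_differential_eq[OF open_collision_free assms(3) 1 2])
  then show ?thesis
    using inner_riesz_M[OF m linear_has_derivative[OF 2] assms(4)]
    by (simp add: hessian_M_def)
qed

lemma inner_hessian_M_U_tilde:
  fixes x :: "real^'d^'n"
  assumes m: "\<forall>i. 0 < m i" and "2 \<le> CARD('n)" "x \<in> collision_free" "v \<in> Xspace m"
  shows "inner_M m (hessian_M m (U_tilde m \<alpha>) x u) v = weighted_potential'' m \<alpha> \<alpha> x u v"
proof -
  have "second_differential (U_tilde m \<alpha>) x u = weighted_potential'' m \<alpha> \<alpha> x u"
    unfolding U_tilde_def[abs_def]
    by (rule second_differential_eq[OF open_collision_free assms(3)
      has_derivative_weighted_potential(1)[OF m assms(2)]
      has_derivative_weighted_potential(2)[OF m assms(2,3)]])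
  then show ?thesis
    using inner_riesz_M[OF m linear_has_derivative[OF has_derivative_weighted_potential(2)[OF m assms(2,3)]] assms(4)]
    by (simp add: hessian_M_def)
qed

text \<open>Both |x|^(2+\<alpha>) U(x) and |x|^2 are homogeneous of degree 2, so their second
  differentials have degree 0. This is what allows y to be replaced by s in the
  coefficients.\<close>

lemma W_hess_scaleR:
  assumes m: "\<forall>i. 0 < m i" and c: "0 < c"
  shows "W_hess m \<alpha> b (c *\<^sub>R x) u v = W_hess m \<alpha> b x u v"
proof -
  have N: "norm_M m (c *\<^sub>R x) powr p = c powr p * norm_M m x powr p" for p
    using c by (simp add: norm_M_scaleR[OF m] powr_mult norm_M_nonneg[OF m])
  have N': "norm_M_powr' m (2 + \<alpha>) (c *\<^sub>R x) u = c powr (1 + \<alpha>) * norm_M_powr' m (2 + \<alpha>) x u" for u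
    using c by (simp add: norm_M_powr'_def N inner_M_bilinear_simps powr_add)
  have e2: "c powr \<alpha> = c powr (\<alpha> - 2) * (c * c)"
    using c powr_add[of c "\<alpha> - 2" 2] by (simp add: power2_eq_square)
  have aux2: "q * (C * A * a + r * (D * B) * (c * b) * (c * d)) = C * (q * (A * a + r * B * b * d))"
    if "C = D * (c * c)" for q r A B C D a b d :: real
    using that by (simp add: algebra_simps)
  have e3: "2 + \<alpha> - 2 = \<alpha>" "2 + \<alpha> - 4 = \<alpha> - 2" by simp_all
  have N'': "norm_M_powr'' m (2 + \<alpha>) (c *\<^sub>R x) u v = c powr \<alpha> * norm_M_powr'' m (2 + \<alpha>) x u v"
    unfolding norm_M_powr''_def N e3 inner_M_bilinear_simps by (rule aux2[OF e2])
  have e: "c powr (2 + \<alpha>) * c powr (- \<alpha> - 2) = 1" "c powr (1 + \<alpha>) * c powr (- \<alpha> - 1) = 1"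
    "c powr \<alpha> * c powr (- \<alpha>) = 1"
    using c by (simp_all flip: powr_add)
  have aux: "(A * a) * (B * b) = a * b" if "A * B = 1" for A B a b :: real
  proof -
    have "(A * a) * (B * b) = (A * B) * (a * b)" by (simp only: mult_ac)
    then show ?thesis using that by simp
  qed
  show ?thesis
    unfolding W_hess_def weighted_potential''_def N N' N'' potential_scaleR[OF c]
      potential'_scaleR[OF c] potential''_scaleR[OF c]
    by (simp only: aux[OF e(1)] aux[OF e(2)] aux[OF e(3)])
qed

text \<open>Split v along \<open>s\<^sub>0\<close>: criticality kills the part that is M-orthogonal
  to \<open>s\<^sub>0\<close>, and Euler's identity evaluates the radial part. The factor -\<alpha>
  U(\<open>s\<^sub>0\<close>) is the Lagrange multiplier.\<close>

lemma potential'_central_configuration: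
  fixes s\<^sub>0 :: "real^'d^'n"
  assumes m: "\<forall>i. 0 < m i" and cc: "central_configuration m \<alpha> s\<^sub>0" and v: "v \<in> Xspace m"
  shows "potential' m \<alpha> s\<^sub>0 v = - \<alpha> * potential m \<alpha> s\<^sub>0 * inner_M m s\<^sub>0 v"
proof -
  from cc have s0: "s\<^sub>0 \<in> Xspace m" "s\<^sub>0 \<in> collision_free" "norm_M m s\<^sub>0 = 1"
    using Xhat_subset[of m] by (auto simp: central_configuration_def Esphere_def Xhat_def)
  have lin: "linear (potential' m \<alpha> s\<^sub>0)"
    by (rule linear_has_derivative[OF has_derivative_potential[OF s0(2)]])
  define w where "w = v - inner_M m s\<^sub>0 v *\<^sub>R s\<^sub>0"
  have "w \<in> Xspace m"
    unfolding w_def by (intro subspace_diff subspace_scale subspace_Xspace v s0)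
  moreover have "inner_M m s\<^sub>0 s\<^sub>0 = 1"
    using norm_M_sq[OF m, of s\<^sub>0] s0(3) by simp
  then have "inner_M m s\<^sub>0 w = 0" by (simp add: w_def inner_M_bilinear_simps)
  ultimately have "potential' m \<alpha> s\<^sub>0 w = 0"
    using cc by (simp add: central_configuration_def frechet_derivative_at[OF has_derivative_potential[OF s0(2)], symmetric])
  then have "potential' m \<alpha> s\<^sub>0 v = inner_M m s\<^sub>0 v * potential' m \<alpha> s\<^sub>0 s\<^sub>0"
    by (simp add: w_def linear_diff[OF lin] linear_scale[OF lin])
  then show ?thesis by (simp add: potential'_self[OF s0(2)])
qed

text \<open>The two Hessians differ by a multiple of \<open>U(s\<^sub>0)\<close> that vanishes because \<open>s\<^sub>0\<close> is critical
  and \<open>U\<close> is homogeneous.\<close>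

lemma W_hess_central_configuration:
  fixes s\<^sub>0 :: "real^'d^'n"
  assumes m: "\<forall>i. 0 < m i" and cc: "central_configuration m \<alpha> s\<^sub>0"
    and u: "u \<in> Xspace m" and v: "v \<in> Xspace m"
  shows "W_hess m \<alpha> (potential m \<alpha> s\<^sub>0) s\<^sub>0 u v = weighted_potential'' m \<alpha> \<alpha> s\<^sub>0 u v"
proof -
  have "norm_M m s\<^sub>0 = 1" using cc by (simp add: central_configuration_def Esphere_def)
  then show ?thesis
    by (simp add: W_hess_def weighted_potential''_def norm_M_powr'_def norm_M_powr''_def
      potential'_central_configuration[OF m cc u] potential'_central_configuration[OF m cc v] algebra_simps)
qed

lemma continuous_on_potential [continuous_intros]:
  assumes "continuous_on S f" "f ` S \<subseteq> collision_free"
  shows "continuous_on S (\<lambda>x. potential m \<alpha> (f x))"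
  unfolding potential_def using assms(2)
  by (intro continuous_intros assms(1)) (auto simp: collision_free_def)

lemma continuous_on_W_hess [continuous_intros]:
  fixes f :: "'a::topological_space \<Rightarrow> real^'d^'n"
  assumes m: "\<forall>i. 0 < m i" and n: "2 \<le> CARD('n)"
    and f: "continuous_on S f" "f ` S \<subseteq> collision_free" and g: "continuous_on S g" "continuous_on S h"
  shows "continuous_on S (\<lambda>x. W_hess m \<alpha> b (f x) (g x) (h x))"
proof -
  have N: "norm_M m (f x) \<noteq> 0" if "x \<in> S" for x
    using f(2) that collision_free_nonzero[OF n] by (auto simp: norm_M_eq_0_iff[OF m])
  have P: "norm (f x $ i - f x $ j) \<noteq> 0" if "x \<in> S" "j \<in> UNIV - {i}" for x i j
    using f(2) that by (auto simp: collision_free_def)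
  have 1: "continuous_on S (\<lambda>x. norm_M m (f x) powr p)" for p
    by (intro continuous_on_powr continuous_on_norm_M continuous_on_const f ballI N)
  have 2: "continuous_on S (\<lambda>x. potential' m \<alpha> (f x) (h x))" if "continuous_on S h" for h
    unfolding potential'_def by (intro continuous_intros f that ballI P) auto
  have 3: "continuous_on S (\<lambda>x. potential'' m \<alpha> (f x) (g x) (h x))"
    unfolding potential''_def by (intro continuous_intros f g ballI P) auto
  show ?thesis
    unfolding W_hess_def weighted_potential''_def norm_M_powr'_def norm_M_powr''_def
    by (intro continuous_on_add continuous_on_diff continuous_on_mult continuous_on_const
      continuous_on_inner_M continuous_on_potential 1 2 3 f g)
qed

section \<open>A Riccati-type flow\<close>

text \<open>One description covers collision and parabolic escape. A positive \<open>t0\<close> is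
  asked for so that the equations of motion hold from \<open>t0\<close> on.\<close>

lemma eventually_left_end:
  assumes "0 < T"
  shows "eventually P (left_end T) \<longleftrightarrow>
    (\<exists>t0>0. ereal t0 < T \<and> (\<forall>t. t0 \<le> t \<and> ereal t < T \<longrightarrow> P t))"
proof (cases "T = \<infinity>")
  case True
  show ?thesis
  proof
    assume "eventually P (left_end T)"
    then obtain N where "\<And>t. N \<le> t \<Longrightarrow> P t"
      using True by (auto simp: left_end_def eventually_at_top_linorder)
    then show "\<exists>t0>0. ereal t0 < T \<and> (\<forall>t. t0 \<le> t \<and> ereal t < T \<longrightarrow> P t)"
      using True by (intro exI[of _ "max 1 N"]) (auto simp del: ereal_max)
  qed (use True in \<open>auto simp: left_end_def eventually_at_top_linorder\<close>)
next
  case False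
  then obtain T' where T': "T = ereal T'" "0 < T'"
    using assms by (cases T) auto
  show ?thesis
  proof
    assume "eventually P (left_end T)"
    then obtain N where N: "N < T'" "\<And>t. N < t \<Longrightarrow> t < T' \<Longrightarrow> P t"
      using T' eventually_at_left[of 0 T'] by (auto simp: left_end_def)
    obtain t0 where "max 0 N < t0" "t0 < T'"
      using dense[of "max 0 N" T'] N T' by auto
    then show "\<exists>t0>0. ereal t0 < T \<and> (\<forall>t. t0 \<le> t \<and> ereal t < T \<longrightarrow> P t)"
      using T' N by (intro exI[of _ t0]) auto
  next
    assume "\<exists>t0>0. ereal t0 < T \<and> (\<forall>t. t0 \<le> t \<and> ereal t < T \<longrightarrow> P t)"
    then obtain t0 where "t0 < T'" "\<And>t. t0 \<le> t \<Longrightarrow> t < T' \<Longrightarrow> P t"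
      using T' by auto
    then show "eventually P (left_end T)"
      using T' eventually_at_left[of 0 T'] by (auto simp: left_end_def intro!: exI[of _ t0])
  qed
qed

lemma left_end_neq_bot: "0 < T \<Longrightarrow> left_end T \<noteq> bot"
  unfolding trivial_limit_def by (subst eventually_left_end) auto

text \<open>At every time with value c the function is strictly increasing, so it cannot leave {c..}
  downwards. The contradiction is drawn at the last time at which f is at least c.\<close>

lemma barrier:
  fixes f :: "real \<Rightarrow> real"
  assumes "t1 \<le> t2" and der: "\<And>t. t1 \<le> t \<Longrightarrow> t \<le> t2 \<Longrightarrow> (f has_real_derivative f' t) (at t)"
    and pos: "\<And>t. t1 \<le> t \<Longrightarrow> t \<le> t2 \<Longrightarrow> f t = c \<Longrightarrow> 0 < f' t"
    and "c \<le> f t1"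
  shows "c \<le> f t2"
proof (rule ccontr)
  assume neg: "\<not> c \<le> f t2"
  have cont: "continuous_on {t1..t2} f"
    by (intro DERIV_atLeastAtMost_imp_continuous_on) (use der in auto)
  define S where "S = {t \<in> {t1..t2}. c \<le> f t}"
  have "closed S"
    unfolding S_def by (intro continuous_on_closed_Collect_le continuous_on_const cont closed_atLeastAtMost)
  then have "compact ({t1..t2} \<inter> S)" by (intro compact_Int_closed) auto
  moreover have "{t1..t2} \<inter> S = S" by (auto simp: S_def)
  ultimately have cpt: "compact S" by simp
  have "t1 \<in> S" using assms(1,4) by (simp add: S_def)
  then obtain s where s: "s \<in> S" "\<And>t. t \<in> S \<Longrightarrow> t \<le> s"
    using compact_attains_sup[OF cpt] by auto
  then have sb: "t1 \<le> s" "s < t2" "c \<le> f s" using neg by (auto simp: S_def order_le_less)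
  show False
  proof (cases "f s = c")
    case True
    have "s \<le> t2" using sb by simp
    from DERIV_pos_inc_right[OF der[OF sb(1) this] pos[OF sb(1) this True]] obtain d where
      d: "0 < d" "\<And>h. 0 < h \<Longrightarrow> h < d \<Longrightarrow> f s < f (s + h)" by blast
    define h where "h = min (d / 2) (t2 - s)"
    have "0 < h" "h < d" "h \<le> t2 - s" using d sb by (auto simp: h_def)
    then have "s + h \<in> S" using d(2)[of h] True sb by (auto simp: S_def)
    with s(2)[of "s + h"] \<open>0 < h\<close> show False by auto
  next
    case False
    have "\<exists>x\<ge>s. x \<le> t2 \<and> f x = c"
      by (rule IVT2') (use sb neg continuous_on_subset[OF cont] in auto)
    then obtain x where "s \<le> x" "x \<le> t2" "f x = c" by blast
    with False s(2)[of x] sb show False by (auto simp: S_def)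
  qed
qed

lemma has_real_derivative_mono:
  fixes f g :: "real \<Rightarrow> real"
  assumes "a \<le> b" "\<And>t. a \<le> t \<Longrightarrow> t \<le> b \<Longrightarrow> (f has_real_derivative f' t) (at t)"
    "\<And>t. a \<le> t \<Longrightarrow> t \<le> b \<Longrightarrow> (g has_real_derivative g' t) (at t)"
    "\<And>t. a \<le> t \<Longrightarrow> t \<le> b \<Longrightarrow> f' t \<le> g' t"
  shows "f b - f a \<le> g b - g a"
proof -
  have "g a - f a \<le> g b - f b"
    by (rule DERIV_nonneg_imp_nondecreasing[OF assms(1)])
      (use assms(2-4) in \<open>auto intro!: exI[of _ "g' _ - f' _"] derivative_intros\<close>)
  then show ?thesis by simp
qed

text \<open>In the application \<open>L\<close> is ln r, \<open>v\<close> its derivative with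
  respect to the new time and \<theta> the derivative of the new time. Keeping \<theta> explicit
  avoids an inverse time change, whose domain is not yet known to be the whole half-line.\<close>

locale sundman_flow =
  fixes T :: ereal and L v \<theta> \<epsilon> :: "real \<Rightarrow> real" and \<kappa> a :: real
  assumes T: "0 < T" and \<kappa>: "0 < \<kappa>" and a: "0 < a"
    and L: "\<And>t. 0 < t \<Longrightarrow> ereal t < T \<Longrightarrow> (L has_real_derivative v t * \<theta> t) (at t)"
    and v: "\<And>t. 0 < t \<Longrightarrow> ereal t < T \<Longrightarrow>
      (v has_real_derivative (\<kappa> * (a\<^sup>2 - (v t)\<^sup>2) + \<epsilon> t) * \<theta> t) (at t)"
    and \<theta>: "\<And>t. 0 < t \<Longrightarrow> ereal t < T \<Longrightarrow> 0 < \<theta> t"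
    and \<epsilon>: "(\<epsilon> \<longlongrightarrow> 0) (left_end T)"
    and v_le: "\<And>\<delta>. 0 < \<delta> \<Longrightarrow> \<forall>\<^sub>F t in left_end T. \<bar>v t\<bar> \<le> a + \<delta>"
begin

text \<open>Inside the band between -a+\<delta> and a-\<delta> the drift of \<open>v\<close> is
  uniformly positive, so both edges can only be crossed upwards. If \<open>v\<close> stays in the
  band to the end, then \<open>L\<close> moves at most a fixed multiple of the amount by which
  \<open>v\<close> moves, and that amount is bounded.\<close>

lemma trichotomy:
  assumes \<delta>: "0 < \<delta>" "\<delta> < a"
  shows "(\<forall>\<^sub>F t in left_end T. v t \<le> - a + \<delta>) \<or> (\<forall>\<^sub>F t in left_end T. a - \<delta> \<le> v t) \<or>
    (\<exists>K. \<forall>\<^sub>F t in left_end T. \<bar>L t\<bar> \<le> K)"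
proof -
  \<comment> \<open>Half of the least unperturbed drift in the band; the other half outweighs
    \<epsilon>.\<close>
  define c where "c = \<kappa> * (a\<^sup>2 - (a - \<delta>)\<^sup>2) / 2"
  have "(a - \<delta>)\<^sup>2 < a\<^sup>2" using \<delta> by (intro power_strict_mono) auto
  then have c: "0 < c" using \<kappa> by (simp add: c_def)
  have "\<forall>\<^sub>F t in left_end T. dist (\<epsilon> t) 0 < c"
    using tendstoD[OF \<epsilon> c] .
  then obtain t0 where t0: "0 < t0" "ereal t0 < T"
    and \<epsilon>c: "\<And>t. t0 \<le> t \<Longrightarrow> ereal t < T \<Longrightarrow> \<bar>\<epsilon> t\<bar> < c"
    using eventually_left_end[OF T] by auto
  have up: "c \<le> \<kappa> * (a\<^sup>2 - (v t)\<^sup>2) + \<epsilon> t"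
    if "t0 \<le> t" "ereal t < T" "- a + \<delta> \<le> v t" "v t \<le> a - \<delta>" for t
  proof -
    have "(v t)\<^sup>2 \<le> (a - \<delta>)\<^sup>2" using that by (intro power2_le_iff_abs_le[THEN iffD2]) (auto simp: abs_le_iff \<delta> less_imp_le)
    then have "\<kappa> * (a\<^sup>2 - (a - \<delta>)\<^sup>2) \<le> \<kappa> * (a\<^sup>2 - (v t)\<^sup>2)" using \<kappa> by simp
    then show ?thesis using \<epsilon>c[OF that(1,2)] by (simp add: c_def)
  qed
  have lt: "ereal t < T" if "t \<le> t'" "ereal t' < T" for t t'
    using that by (metis ereal_less_eq(3) order_le_less_trans)
  have bar: "k \<le> v t2" if "t0 \<le> t1" "t1 \<le> t2" "ereal t2 < T" "k \<le> v t1" "- a + \<delta> \<le> k" "k \<le> a - \<delta>" for k t1 t2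
  proof (rule barrier[OF that(2), where f' = "\<lambda>t. (\<kappa> * (a\<^sup>2 - (v t)\<^sup>2) + \<epsilon> t) * \<theta> t"])
    fix t assume t: "t1 \<le> t" "t \<le> t2"
    then have t': "0 < t" "ereal t < T" using that t0 lt by auto
    then show "(v has_real_derivative (\<kappa> * (a\<^sup>2 - (v t)\<^sup>2) + \<epsilon> t) * \<theta> t) (at t)" by (rule v)
    show "0 < (\<kappa> * (a\<^sup>2 - (v t)\<^sup>2) + \<epsilon> t) * \<theta> t" if "v t = k"
      using up[of t] \<theta>[OF t'] t t' c that \<open>t0 \<le> t1\<close> \<open>- a + \<delta> \<le> k\<close> \<open>k \<le> a - \<delta>\<close> by simp
  qed (use that in simp)
  show ?thesis
  proof (cases "\<exists>t1\<ge>t0. ereal t1 < T \<and> - a + \<delta> \<le> v t1")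
    case False
    then have "\<forall>\<^sub>F t in left_end T. v t \<le> - a + \<delta>"
      unfolding eventually_left_end[OF T] using t0 by (intro exI[of _ t0]) force
    then show ?thesis by blast
  next
    case True
    then obtain t1 where t1: "t0 \<le> t1" "ereal t1 < T" "- a + \<delta> \<le> v t1" by blast
    have lo: "- a + \<delta> \<le> v t" if "t1 \<le> t" "ereal t < T" for t
      using bar[of t1 t "- a + \<delta>"] t1 that \<delta> by simp
    show ?thesis
    proof (cases "\<exists>t2\<ge>t1. ereal t2 < T \<and> a - \<delta> \<le> v t2")
      case True
      then obtain t2 where t2: "t1 \<le> t2" "ereal t2 < T" "a - \<delta> \<le> v t2" by blast
      have "a - \<delta> \<le> v t" if "t2 \<le> t" "ereal t < T" for t
        using bar[of t2 t "a - \<delta>"] t1 t2 that \<delta> by simp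
      then have "\<forall>\<^sub>F t in left_end T. a - \<delta> \<le> v t"
        unfolding eventually_left_end[OF T] using t0 t1 t2 by (intro exI[of _ t2]) auto
      then show ?thesis by blast
    next
      case False
      then have hi: "v t \<le> a - \<delta>" if "t1 \<le> t" "ereal t < T" for t
        using that by force
      have pos: "0 < t" if "t1 \<le> t" for t using t0 t1 that by simp
      \<comment> \<open>In the band |v| is at most a while the drift is at least c, hence |L'| is at
        most (a/c) v'. Integrating this bounds the variation of \<open>L\<close>.\<close>
      have *: "\<bar>v t * \<theta> t\<bar> \<le> a / c * ((\<kappa> * (a\<^sup>2 - (v t)\<^sup>2) + \<epsilon> t) * \<theta> t)"
        if "t1 \<le> t" "ereal t < T" for t
      proof -
        have "\<bar>v t\<bar> \<le> a / c * c" using lo[OF that] hi[OF that] \<delta> c by simp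
        also have "\<dots> \<le> a / c * (\<kappa> * (a\<^sup>2 - (v t)\<^sup>2) + \<epsilon> t)"
          using up[of t] that t1 lo[OF that] hi[OF that] a c by (intro mult_left_mono) auto
        finally have "\<bar>v t\<bar> * \<theta> t \<le> a / c * (\<kappa> * (a\<^sup>2 - (v t)\<^sup>2) + \<epsilon> t) * \<theta> t"
          using \<theta>[OF pos[OF that(1)] that(2)] by (intro mult_right_mono) auto
        then show ?thesis
          using \<theta>[OF pos[OF that(1)] that(2)] by (simp only: abs_mult mult.assoc abs_of_pos)
      qed
      have "\<bar>L t\<bar> \<le> \<bar>L t1\<bar> + a / c * (2 * a)" if t: "t1 \<le> t" "ereal t < T" for t
      proof -
        have dv: "((\<lambda>t. a / c * v t) has_real_derivative
            a / c * ((\<kappa> * (a\<^sup>2 - (v x)\<^sup>2) + \<epsilon> x) * \<theta> x)) (at x)" if "t1 \<le> x" "x \<le> t" for x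
          using that pos lt t by (intro DERIV_cmult v) auto
        have dL: "(L has_real_derivative v x * \<theta> x) (at x)" if "t1 \<le> x" "x \<le> t" for x
          using that pos lt t by (intro L) auto
        have "L t - L t1 \<le> a / c * v t - a / c * v t1"
          by (rule has_real_derivative_mono[OF t(1) dL dv]) (use * t lt in \<open>auto simp: abs_le_iff\<close>)
        moreover have "(- L t) - (- L t1) \<le> a / c * v t - a / c * v t1"
          by (rule has_real_derivative_mono[OF t(1) DERIV_minus[OF dL] dv])
            (use * t lt in \<open>auto simp: abs_le_iff\<close>)
        moreover have "a / c * (v t - v t1) \<le> a / c * (2 * a)"
          using lo[of t1] hi[of t] t t1 a c \<delta> by (intro mult_left_mono) auto
        ultimately show ?thesis by (simp add: right_diff_distrib)
      qed
      then have "\<forall>\<^sub>F t in left_end T. \<bar>L t\<bar> \<le> \<bar>L t1\<bar> + a / c * (2 * a)"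
        unfolding eventually_left_end[OF T] using t0 t1 by (intro exI[of _ t1]) auto
      then show ?thesis by blast
    qed
  qed
qed

text \<open>The sign of \<open>v\<close> makes \<open>L\<close> monotone. This rules out the wrong
  root once \<open>L\<close> is known to diverge in the opposite direction.\<close>

lemma monotone_L:
  shows "\<forall>\<^sub>F t in left_end T. 0 \<le> v t \<Longrightarrow> \<exists>K. \<forall>\<^sub>F t in left_end T. K \<le> L t"
    and "\<forall>\<^sub>F t in left_end T. v t \<le> 0 \<Longrightarrow> \<exists>K. \<forall>\<^sub>F t in left_end T. L t \<le> K"
proof -
  have lt: "ereal t < T" if "t \<le> t'" "ereal t' < T" for t t'
    using that by (metis ereal_less_eq(3) order_le_less_trans)
  assume "\<forall>\<^sub>F t in left_end T. 0 \<le> v t"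
  then obtain t0 where t0: "0 < t0" "ereal t0 < T" "\<And>t. t0 \<le> t \<Longrightarrow> ereal t < T \<Longrightarrow> 0 \<le> v t"
    using eventually_left_end[OF T] by auto
  have "L t0 \<le> L t" if "t0 \<le> t" "ereal t < T" for t
    using has_real_derivative_mono[of t0 t "\<lambda>_. 0" "\<lambda>_. 0" L "\<lambda>t. v t * \<theta> t"] that t0 lt L \<theta>
    by (simp add: less_imp_le)
  then show "\<exists>K. \<forall>\<^sub>F t in left_end T. K \<le> L t"
    unfolding eventually_left_end[OF T] using t0 by blast
next
  have lt: "ereal t < T" if "t \<le> t'" "ereal t' < T" for t t'
    using that by (metis ereal_less_eq(3) order_le_less_trans)
  assume "\<forall>\<^sub>F t in left_end T. v t \<le> 0"
  then obtain t0 where t0: "0 < t0" "ereal t0 < T" "\<And>t. t0 \<le> t \<Longrightarrow> ereal t < T \<Longrightarrow> v t \<le> 0"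
    using eventually_left_end[OF T] by auto
  have "L t \<le> L t0" if "t0 \<le> t" "ereal t < T" for t
    using has_real_derivative_mono[of t0 t L "\<lambda>t. v t * \<theta> t" "\<lambda>_. 0" "\<lambda>_. 0"] that t0 lt L \<theta>
    by (simp add: less_imp_le mult_nonpos_nonneg)
  then show "\<exists>K. \<forall>\<^sub>F t in left_end T. L t \<le> K"
    unfolding eventually_left_end[OF T] using t0 by blast
qed

lemma unbounded:
  assumes "filterlim L at_top (left_end T)"
  shows "\<not> (\<forall>\<^sub>F t in left_end T. L t \<le> K)"
proof
  assume "\<forall>\<^sub>F t in left_end T. L t \<le> K"
  moreover have "\<forall>\<^sub>F t in left_end T. K + 1 \<le> L t"
    using assms by (simp add: filterlim_at_top)
  ultimately have "\<forall>\<^sub>F t in left_end T. False" by eventually_elim simp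
  then show False using left_end_neq_bot[OF T] by simp
qed

lemma unbounded':
  assumes "filterlim L at_bot (left_end T)"
  shows "\<not> (\<forall>\<^sub>F t in left_end T. K \<le> L t)"
proof
  assume "\<forall>\<^sub>F t in left_end T. K \<le> L t"
  moreover have "\<forall>\<^sub>F t in left_end T. L t \<le> K - 1"
    using assms by (simp add: filterlim_at_bot)
  ultimately have "\<forall>\<^sub>F t in left_end T. False" by eventually_elim simp
  then show False using left_end_neq_bot[OF T] by simp
qed

text \<open>Divergence of \<open>L\<close> excludes two of the three alternatives of
  \<open>trichotomy\<close>. The remaining one is the lower estimate for \<open>v\<close>, and
  \<open>v_le\<close> is the upper one.\<close>

lemma tendsto_at_top:
  assumes lim: "filterlim L at_top (left_end T)"
  shows "(v \<longlongrightarrow> a) (left_end T)"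
proof (rule tendstoI)
  fix e :: real assume e: "0 < e"
  define \<delta> where "\<delta> = min (e / 2) (a / 2)"
  have \<delta>: "0 < \<delta>" "\<delta> < a" "\<delta> < e" using e a by (auto simp: \<delta>_def)
  have "\<not> (\<forall>\<^sub>F t in left_end T. v t \<le> - a + \<delta>)"
  proof
    assume "\<forall>\<^sub>F t in left_end T. v t \<le> - a + \<delta>"
    then have "\<forall>\<^sub>F t in left_end T. v t \<le> 0" by eventually_elim (use \<delta> in simp)
    with monotone_L(2) unbounded[OF lim] show False by blast
  qed
  moreover have "\<not> (\<exists>K. \<forall>\<^sub>F t in left_end T. \<bar>L t\<bar> \<le> K)"
  proof
    assume "\<exists>K. \<forall>\<^sub>F t in left_end T. \<bar>L t\<bar> \<le> K"
    then obtain K where "\<forall>\<^sub>F t in left_end T. \<bar>L t\<bar> \<le> K" ..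
    then have "\<forall>\<^sub>F t in left_end T. L t \<le> K" by eventually_elim simp
    with unbounded[OF lim] show False by blast
  qed
  ultimately have "\<forall>\<^sub>F t in left_end T. a - \<delta> \<le> v t"
    using trichotomy[OF \<delta>(1,2)] by blast
  then show "\<forall>\<^sub>F t in left_end T. dist (v t) a < e"
    using v_le[OF \<delta>(1)] by eventually_elim (use \<delta> in \<open>auto simp: dist_real_def abs_less_iff\<close>)
qed

lemma tendsto_at_bot:
  assumes lim: "filterlim L at_bot (left_end T)"
  shows "(v \<longlongrightarrow> - a) (left_end T)"
proof (rule tendstoI)
  fix e :: real assume e: "0 < e"
  define \<delta> where "\<delta> = min (e / 2) (a / 2)"
  have \<delta>: "0 < \<delta>" "\<delta> < a" "\<delta> < e" using e a by (auto simp: \<delta>_def)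
  have "\<not> (\<forall>\<^sub>F t in left_end T. a - \<delta> \<le> v t)"
  proof
    assume "\<forall>\<^sub>F t in left_end T. a - \<delta> \<le> v t"
    then have "\<forall>\<^sub>F t in left_end T. 0 \<le> v t" by eventually_elim (use \<delta> in simp)
    with monotone_L(1) unbounded'[OF lim] show False by blast
  qed
  moreover have "\<not> (\<exists>K. \<forall>\<^sub>F t in left_end T. \<bar>L t\<bar> \<le> K)"
  proof
    assume "\<exists>K. \<forall>\<^sub>F t in left_end T. \<bar>L t\<bar> \<le> K"
    then obtain K where "\<forall>\<^sub>F t in left_end T. \<bar>L t\<bar> \<le> K" ..
    then have "\<forall>\<^sub>F t in left_end T. - K \<le> L t" by eventually_elim simp
    with unbounded'[OF lim] show False by blast
  qed
  ultimately have "\<forall>\<^sub>F t in left_end T. v t \<le> - a + \<delta>"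
    using trichotomy[OF \<delta>(1,2)] by blast
  then show "\<forall>\<^sub>F t in left_end T. dist (v t) (- a) < e"
    using v_le[OF \<delta>(1)] by eventually_elim (use \<delta> in \<open>auto simp: dist_real_def abs_less_iff\<close>)
qed

end

section \<open>Asymptotics of the radial velocity\<close>

locale asymptotic_orbit =
  fixes m :: "'n::finite \<Rightarrow> real" and \<alpha> h :: real and T :: ereal
    and s\<^sub>0 :: "real^'d^'n" and \<gamma> :: "real \<Rightarrow> real^'d^'n"
  assumes m: "\<forall>i. 0 < m i" and n: "2 \<le> CARD('n)" and \<alpha>: "0 < \<alpha>" "\<alpha> < 2"
    and cc: "central_configuration m \<alpha> s\<^sub>0"
    and sol: "s0_asymptotic_solution m \<alpha> T s\<^sub>0 \<gamma>"
    and start: "\<gamma> 0 \<in> Xhat m"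
    and energy: "has_energy m \<alpha> T \<gamma> h"
begin

abbreviation "r t \<equiv> norm_M m (\<gamma> t)"
abbreviation "pot t \<equiv> potential m \<alpha> (\<gamma> t)"
abbreviation "b \<equiv> potential m \<alpha> s\<^sub>0"
abbreviation "dot t \<equiv> inner_M m (\<gamma> t) (velocity \<gamma> t)"

text \<open>Since \<open>dot\<close> equals r r', this is r^(\<alpha>/2) r'. Below,
  \<open>\<theta>\<close> is d\<tau>/dt, and \<open>w\<close> is the potential of the normalised
  configuration by homogeneity.\<close>

definition "v t = r t powr (\<alpha> / 2 - 1) * dot t"
definition "\<theta> t = r t powr (- (2 + \<alpha>) / 2)"
definition "w t = r t powr \<alpha> * pot t"
definition "L t = ln (r t)"

lemma T_pos: "0 < T"
  and asym: "asymptotic_solution m \<alpha> T \<gamma>"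
  and s_tendsto: "((\<lambda>t. \<gamma> t /\<^sub>R r t) \<longlongrightarrow> s\<^sub>0) (left_end T)"
  using sol by (auto simp: s0_asymptotic_solution_def asymptotic_solution_def)

lemma s0: "s\<^sub>0 \<in> Xspace m" "s\<^sub>0 \<in> collision_free" "norm_M m s\<^sub>0 = 1"
  using cc Xhat_subset[of m] by (auto simp: central_configuration_def Esphere_def Xhat_def)

lemma b_pos: "0 < b"
  by (rule potential_pos[OF m n s0(2)])

lemma less_T: "ereal t' < T \<Longrightarrow> t \<le> t' \<Longrightarrow> ereal t < T"
  by (metis ereal_less_eq(3) order_le_less_trans)

lemma \<gamma>_Xhat: "0 \<le> t \<Longrightarrow> ereal t < T \<Longrightarrow> \<gamma> t \<in> Xhat m"
  using asym start by (cases "t = 0") (auto simp: asymptotic_solution_def)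

lemma \<gamma>_free: "0 \<le> t \<Longrightarrow> ereal t < T \<Longrightarrow> \<gamma> t \<in> collision_free"
  using \<gamma>_Xhat Xhat_subset by blast

lemma r_pos: "0 \<le> t \<Longrightarrow> ereal t < T \<Longrightarrow> 0 < r t"
  using collision_free_nonzero[OF n \<gamma>_free] norm_M_nonneg[OF m, of "\<gamma> t"] norm_M_eq_0_iff[OF m, of "\<gamma> t"]
  by (auto simp: order_le_less)

lemma r_sq: "(r t)\<^sup>2 = inner_M m (\<gamma> t) (\<gamma> t)"
  by (rule norm_M_sq[OF m])

lemma pot_pos: "0 \<le> t \<Longrightarrow> ereal t < T \<Longrightarrow> 0 < pot t"
  by (rule potential_pos[OF m n \<gamma>_free])

lemma continuous_on_\<gamma>: "continuous_on {t. 0 \<le> t \<and> ereal t < T} \<gamma>"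
proof (cases "T = \<infinity>")
  case True
  then show ?thesis
    using asym by (auto simp: asymptotic_solution_def intro: continuous_on_subset[of "{0..}"])
next
  case False
  then obtain T' where "T = ereal T'" using T_pos by (cases T) auto
  then show ?thesis
    using asym by (auto simp: asymptotic_solution_def intro: continuous_on_subset[of "{0..T'}"])
qed

lemma continuous_on_\<gamma>_Icc: "ereal t < T \<Longrightarrow> continuous_on {0..t} \<gamma>"
  by (rule continuous_on_subset[OF continuous_on_\<gamma>]) (auto intro: less_T)

lemma eventually_inside: "\<forall>\<^sub>F t in left_end T. 0 < t \<and> ereal t < T"
  unfolding eventually_left_end[OF T_pos]
  using ereal_dense2[of 0 T] T_pos by (auto simp: zero_ereal_def)

context
  fixes t assumes t: "0 < t" "ereal t < T"
begin

lemma d\<gamma>: "(\<gamma> has_vector_derivative velocity \<gamma> t) (at t)"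
  and dvel: "(velocity \<gamma> has_vector_derivative velocity (velocity \<gamma>) t) (at t)"
  using asym t unfolding velocity_def[of _ t]
  by (auto simp: asymptotic_solution_def vector_derivative_works)

lemma acceleration: "inner_M m (velocity (velocity \<gamma>) t) u = potential' m \<alpha> (\<gamma> t) u"
proof -
  have "GDERIV (potential m \<alpha>) (\<gamma> t) :> (\<chi> i. m i *\<^sub>R (velocity (velocity \<gamma>) t $ i))"
    using asym t by (auto simp: asymptotic_solution_def)
  then have "(potential m \<alpha> has_derivative
      (\<lambda>u. u \<bullet> (\<chi> i. m i *\<^sub>R (velocity (velocity \<gamma>) t $ i)))) (at (\<gamma> t))"
    by (simp add: gderiv_def)
  from has_derivative_unique[OF has_derivative_potential[OF \<gamma>_free] this] t
  have "potential' m \<alpha> (\<gamma> t) u = u \<bullet> (\<chi> i. m i *\<^sub>R (velocity (velocity \<gamma>) t $ i))"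
    by (simp add: less_imp_le)
  also have "\<dots> = inner_M m (velocity (velocity \<gamma>) t) u"
    by (simp add: inner_vec_def[of u] inner_M_def inner_commute)
  finally show ?thesis by simp
qed

lemma kinetic: "inner_M m (velocity \<gamma> t) (velocity \<gamma> t) = 2 * (h + pot t)"
  using energy t by (simp add: has_energy_def norm_M_sq[OF m])

lemma has_vector_derivative_inner_M:
  "(f has_vector_derivative f') (at x) \<Longrightarrow> (g has_vector_derivative g') (at x) \<Longrightarrow>
    ((\<lambda>x. inner_M m (f x) (g x)) has_real_derivative inner_M m (f x) g' + inner_M m f' (g x)) (at x)"
  using bounded_bilinear.has_vector_derivative[OF bounded_bilinear_inner_M]
  by (simp add: has_real_derivative_iff_has_vector_derivative)

text \<open>The Lagrange-Jacobi identity: \<open>dot\<close> is the derivative of r^2/2, and Euler's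
  identity evaluates the potential term.\<close>

lemma ddot: "((\<lambda>t. dot t) has_real_derivative 2 * h + (2 - \<alpha>) * pot t) (at t)"
proof -
  have "\<gamma> t \<in> collision_free" using t by (intro \<gamma>_free) auto
  from has_vector_derivative_inner_M[OF d\<gamma> dvel] show ?thesis
    by (rule DERIV_cong) (simp add: kinetic inner_M_commute[of m "\<gamma> t"] acceleration
      potential'_self[OF \<open>\<gamma> t \<in> collision_free\<close>] algebra_simps)
qed

lemma r_pos_t: "0 < r t" using r_pos t by simp

lemma dr: "((\<lambda>t. r t) has_real_derivative dot t / r t) (at t)"
proof -
  have "0 < inner_M m (\<gamma> t) (\<gamma> t)" using r_pos_t r_sq[of t] by (metis zero_less_power)
  then show ?thesis
    unfolding norm_M_def
    by (auto intro!: derivative_eq_intros has_vector_derivative_inner_M[OF d\<gamma> d\<gamma>]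
      simp: inner_M_commute field_simps)
qed

lemma \<theta>_pos: "0 < \<theta> t" using r_pos_t by (simp add: \<theta>_def)

lemma v\<theta>: "v t * \<theta> t = dot t / (r t)\<^sup>2"
proof -
  have "r t powr (\<alpha> / 2 - 1) * r t powr (- (2 + \<alpha>) / 2) = r t powr (- 2)"
    by (simp add: field_simps flip: powr_add)
  also have "\<dots> = 1 / (r t)\<^sup>2" using r_pos_t by (simp add: powr_minus divide_inverse)
  finally have eq: "r t powr (\<alpha> / 2 - 1) * r t powr (- (2 + \<alpha>) / 2) = 1 / (r t)\<^sup>2" .
  have "v t * \<theta> t = (r t powr (\<alpha> / 2 - 1) * r t powr (- (2 + \<alpha>) / 2)) * dot t"
    by (simp only: v_def \<theta>_def mult_ac)
  then show ?thesis by (simp only: eq) simp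
qed

lemma dL: "(L has_real_derivative v t * \<theta> t) (at t)"
  unfolding L_def[abs_def] v\<theta>
  by (rule DERIV_cong[OF DERIV_chain2[OF DERIV_ln dr]])
    (use r_pos_t in \<open>auto simp: power2_eq_square field_simps\<close>)

lemma dr_powr: "((\<lambda>t. r t powr p) has_real_derivative r t powr p * (p * (v t * \<theta> t))) (at t)"
proof -
  have "((\<lambda>t. r t powr p) has_real_derivative p * r t powr (p - 1) * (dot t / r t)) (at t)"
    by (rule DERIV_chain2[OF has_real_derivative_powr dr]) (rule r_pos_t)
  moreover have "r t powr p = r t powr (p - 1) * r t"
    using r_pos_t powr_add[of "r t" "p - 1" 1] by simp
  ultimately show ?thesis
    unfolding v\<theta> using r_pos_t by (simp add: power2_eq_square mult_ac)
qed

lemma \<theta>_eq: "\<theta> t * r t powr \<alpha> = r t powr (\<alpha> / 2 - 1)"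
proof -
  have "- (2 + \<alpha>) / 2 + \<alpha> = \<alpha> / 2 - 1" by (simp add: field_simps)
  then show ?thesis by (simp add: \<theta>_def flip: powr_add)
qed

text \<open>This is the Lagrange-Jacobi identity in the new time. Writing \<open>w\<close> as
  \<open>b\<close> plus a deviation leaves an autonomous Riccati equation, with everything that
  tends to 0 collected in the second summand.\<close>

lemma dv: "(v has_real_derivative
    ((2 - \<alpha>) / 2 * ((sqrt (2 * b))\<^sup>2 - (v t)\<^sup>2) + (2 * h * r t powr \<alpha> + (2 - \<alpha>) * (w t - b))) * \<theta> t) (at t)"
proof -
  have d: "(v has_real_derivative r t powr (\<alpha> / 2 - 1) * ((\<alpha> / 2 - 1) * (v t * \<theta> t)) * dot t
      + (2 * h + (2 - \<alpha>) * pot t) * r t powr (\<alpha> / 2 - 1)) (at t)"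
    unfolding v_def[abs_def] by (rule DERIV_mult[OF dr_powr ddot, unfolded v_def])
  have eq1: "r t powr (\<alpha> / 2 - 1) * ((\<alpha> / 2 - 1) * (v t * \<theta> t)) * dot t
      = (\<alpha> / 2 - 1) * (v t)\<^sup>2 * \<theta> t"
    by (simp add: v_def power2_eq_square mult_ac)
  have eq2: "(2 * h + (2 - \<alpha>) * pot t) * r t powr (\<alpha> / 2 - 1) =
      (2 * h * r t powr \<alpha> + (2 - \<alpha>) * w t) * \<theta> t"
    unfolding \<theta>_eq[symmetric] w_def by (simp add: algebra_simps)
  have eq3: "(sqrt (2 * b))\<^sup>2 = 2 * b" using b_pos by simp
  show ?thesis
    by (rule DERIV_cong[OF d]) (simp only: eq1 eq2 eq3, simp add: field_simps)
qed

lemma r_v_sq: "r t powr \<alpha> * (dot t)\<^sup>2 / (r t)\<^sup>2 = (v t)\<^sup>2"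
proof -
  have "r t powr \<alpha> = r t powr (\<alpha> / 2 - 1) * r t powr (\<alpha> / 2 - 1) * (r t)\<^sup>2"
  proof -
    have "\<alpha> = \<alpha> / 2 - 1 + (\<alpha> / 2 - 1) + 2" by simp
    then have "r t powr \<alpha> = r t powr (\<alpha> / 2 - 1 + (\<alpha> / 2 - 1) + 2)" by simp
    then show ?thesis using r_pos_t by (simp only: powr_add) simp
  qed
  then show ?thesis using r_pos_t by (simp add: v_def power2_eq_square)
qed

text \<open>Cauchy-Schwarz for \<open>dot\<close> combined with the energy relation, a form of
  Sundman's inequality. The defect is the square of s', as \<open>s'_norm\<close> shows.\<close>

lemma v_sq_le: "(v t)\<^sup>2 \<le> 2 * h * r t powr \<alpha> + 2 * w t"
proof -
  have "\<bar>dot t\<bar>\<^sup>2 \<le> (r t * norm_M m (velocity \<gamma> t))\<^sup>2"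
    by (rule power_mono[OF abs_inner_M_le[OF m]]) simp
  then have "(dot t)\<^sup>2 \<le> (r t)\<^sup>2 * (2 * (h + pot t))"
    by (simp add: power_mult_distrib norm_M_sq[OF m, of "velocity \<gamma> t"] kinetic)
  then have "r t powr \<alpha> * (dot t)\<^sup>2 / (r t)\<^sup>2 \<le> r t powr \<alpha> * ((r t)\<^sup>2 * (2 * (h + pot t))) / (r t)\<^sup>2"
    by (intro divide_right_mono mult_left_mono) auto
  also have "\<dots> = r t powr \<alpha> * (2 * (h + pot t))"
    using r_pos_t by simp
  also have "\<dots> = 2 * h * r t powr \<alpha> + 2 * w t"
    by (simp add: w_def algebra_simps)
  finally show ?thesis by (simp add: r_v_sq)
qed

end

lemma w_eq: "0 \<le> t \<Longrightarrow> ereal t < T \<Longrightarrow> w t = potential m \<alpha> (\<gamma> t /\<^sub>R r t)"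
  using potential_scaleR[of "inverse (r t)" m \<alpha> "\<gamma> t"] r_pos[of t]
  by (simp add: w_def powr_minus inverse_powr)

lemma w_tendsto: "(w \<longlongrightarrow> b) (left_end T)"
proof -
  have "isCont (potential m \<alpha>) s\<^sub>0"
    by (rule has_derivative_continuous[OF has_derivative_potential[OF s0(2)]])
  from isCont_tendsto_compose[OF this s_tendsto] show ?thesis
    by (rule Lim_transform_eventually)
      (use eventually_inside in \<open>eventually_elim, simp add: w_eq\<close>)
qed

lemma r_tendsto_0: "T \<noteq> \<infinity> \<Longrightarrow> ((\<lambda>t. r t) \<longlongrightarrow> 0) (left_end T)"
  using asym tendsto_norm_M[of \<gamma> 0 "left_end T" m] norm_M_eq_0_iff[OF m, of "0 :: real^'d^'n"]
  by (auto simp: asymptotic_solution_def)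

lemma pot_tendsto:
  assumes "T = \<infinity>"
  shows "((\<lambda>t. pot t) \<longlongrightarrow> - h) (left_end T)"
proof -
  have "((\<lambda>t. (norm_M m (velocity \<gamma> t))\<^sup>2 / 2 - h) \<longlongrightarrow> 0 - h) (left_end T)"
    using asym assms by (intro tendsto_intros) (auto simp: asymptotic_solution_def)
  then have "((\<lambda>t. pot t) \<longlongrightarrow> 0 - h) (left_end T)"
    by (rule Lim_transform_eventually)
      (use eventually_inside in \<open>eventually_elim, use energy in \<open>auto simp: has_energy_def\<close>\<close>)
  then show ?thesis by simp
qed

text \<open>In the parabolic case nothing is assumed about \<open>r\<close> itself. As
  \<open>w\<close> tends to the positive number \<open>b\<close>, this identity converts the limit
  of the potential into information on \<open>r\<close>.\<close>

lemma r_powr_eq: "0 \<le> t \<Longrightarrow> ereal t < T \<Longrightarrow> r t powr (- \<alpha>) = pot t / w t"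
  using r_pos[of t] pot_pos[of t] by (simp add: w_def powr_minus divide_inverse)

text \<open>For negative energy \<open>r\<close> would stay bounded while \<open>dot\<close> decreases linearly.\<close>

lemma parabolic_energy:
  assumes "T = \<infinity>"
  shows "h = 0"
proof (rule ccontr)
  assume "h \<noteq> 0"
  have "\<forall>\<^sub>F t in left_end T. 0 \<le> pot t"
    using eventually_inside by eventually_elim (use pot_pos in \<open>auto simp: less_imp_le\<close>)
  from tendsto_lowerbound[OF pot_tendsto[OF assms] this left_end_neq_bot[OF T_pos]] \<open>h \<noteq> 0\<close>
  have h: "h < 0" by simp
  \<comment> \<open>Half of the limit -h/b of r^(-\<alpha>); a positive lower bound for
    r^(-\<alpha>) is an upper bound for r.\<close>
  define c where "c = - h / b / 2"
  have c: "0 < c" "c < - h / b" using h b_pos by (auto simp: c_def field_simps)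
  have "((\<lambda>t. pot t / w t) \<longlongrightarrow> - h / b) (left_end T)"
    using b_pos by (intro tendsto_intros pot_tendsto assms w_tendsto) auto
  from order_tendstoD(1)[OF this c(2)] have ev1: "\<forall>\<^sub>F t in left_end T. c < pot t / w t" .
  have "((\<lambda>t. 2 * h + (2 - \<alpha>) * pot t) \<longlongrightarrow> 2 * h + (2 - \<alpha>) * - h) (left_end T)"
    by (intro tendsto_intros pot_tendsto assms)
  \<comment> \<open>The derivative of \<open>dot\<close> tends to \<alpha>h, which is negative, so
    \<alpha>h/2 is eventually an upper bound for it.\<close>
  moreover have "2 * h + (2 - \<alpha>) * - h < \<alpha> * h / 2" 
    using h \<alpha> by (simp add: algebra_simps mult_pos_neg)
  ultimately have ev2: "\<forall>\<^sub>F t in left_end T. 2 * h + (2 - \<alpha>) * pot t < \<alpha> * h / 2"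
    by (rule order_tendstoD(2))
  have "((\<lambda>t. (norm_M m (velocity \<gamma> t))\<^sup>2 / 2) \<longlongrightarrow> 0) (left_end T)"
    using asym assms by (auto simp: asymptotic_solution_def)
  from order_tendstoD(2)[OF this, of "1/2"]
  have ev3: "\<forall>\<^sub>F t in left_end T. (norm_M m (velocity \<gamma> t))\<^sup>2 / 2 < 1 / 2" by simp
  from eventually_conj[OF ev1 eventually_conj[OF ev2 ev3]] obtain t0 where t0: "0 < t0"
    and 1: "\<And>t. t0 \<le> t \<Longrightarrow> c < pot t / w t"
    and 2: "\<And>t. t0 \<le> t \<Longrightarrow> 2 * h + (2 - \<alpha>) * pot t < \<alpha> * h / 2"
    and 3: "\<And>t. t0 \<le> t \<Longrightarrow> (norm_M m (velocity \<gamma> t))\<^sup>2 / 2 < 1 / 2"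
    unfolding eventually_left_end[OF T_pos] using assms by auto
  define R where "R = c powr (- 1 / \<alpha>)"
  have bound: "\<bar>dot t\<bar> \<le> R" if "t0 \<le> t" for t
  proof -
    have rt: "0 < r t" using that t0 assms by (intro r_pos) auto
    have "c < r t powr (- \<alpha>)" using 1[OF that] that t0 assms by (subst r_powr_eq) auto
    then have "(r t powr (- \<alpha>)) powr (- 1 / \<alpha>) \<le> c powr (- 1 / \<alpha>)"
      using c \<alpha> by (intro powr_mono2') auto
    then have "r t \<le> R" using rt \<alpha> by (simp add: R_def powr_powr)
    moreover have "norm_M m (velocity \<gamma> t) \<le> 1"
      using 3[OF that] by (simp add: abs_square_less_1 norm_M_nonneg[OF m] less_imp_le flip: abs_square_le_1)
    ultimately have "r t * norm_M m (velocity \<gamma> t) \<le> R * 1"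
      using rt norm_M_nonneg[OF m] by (intro mult_mono) auto
    then show ?thesis using abs_inner_M_le[OF m, of "\<gamma> t" "velocity \<gamma> t"] by simp
  qed
  \<comment> \<open>After this time \<open>dot\<close> would have dropped by at least 2R+1, although
    it stays between -R and R.\<close>
  define t where "t = t0 + (2 * R + 1) / (- \<alpha> * h / 2)"
  have R: "0 \<le> R" by (simp add: R_def)
  have ah: "0 < - \<alpha> * h / 2" using \<alpha> h by (simp add: mult_pos_neg)
  have "0 \<le> (2 * R + 1) / (- \<alpha> * h / 2)"
    by (rule divide_nonneg_pos[OF _ ah]) (use R in simp)
  then have t: "t0 \<le> t" unfolding t_def by linarith
  have "dot t - dot t0 \<le> \<alpha> * h / 2 * t - \<alpha> * h / 2 * t0"
    by (rule has_real_derivative_mono[OF t, where f' = "\<lambda>t. 2 * h + (2 - \<alpha>) * pot t" and g' = "\<lambda>_. \<alpha> * h / 2"])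
      (use t0 2 assms ddot in \<open>auto intro!: derivative_eq_intros less_imp_le simp: order_less_le_trans\<close>)
  also have "\<dots> = \<alpha> * h / 2 * (t - t0)" by (simp add: algebra_simps)
  also have "\<dots> = - ((- \<alpha> * h / 2) * ((2 * R + 1) / (- \<alpha> * h / 2)))"
    by (simp add: t_def)
  also have "\<dots> = - (2 * R + 1)" 
  proof -
    have "D * (X / D) = X" if "0 < D" for D X :: real using that by simp
    from this[OF ah] show ?thesis by (simp only:)
  qed
  finally show False using bound[OF t] bound[of t0] by simp
qed

lemma L_at_bot:
  assumes "T \<noteq> \<infinity>"
  shows "filterlim L at_bot (left_end T)"
proof -
  have "filterlim (\<lambda>t. r t) (at_right 0) (left_end T)"
    unfolding filterlim_at
  proof
    show "\<forall>\<^sub>F t in left_end T. r t \<in> {0<..} \<and> r t \<noteq> 0"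
      using eventually_inside
    proof eventually_elim
      case (elim t)
      then show ?case using r_pos[of t] by simp
    qed
  qed (rule r_tendsto_0[OF assms])
  from filterlim_compose[OF ln_at_0 this] show ?thesis by (simp add: L_def[abs_def])
qed

text \<open>With zero energy the potential tends to 0, and so does r^(-\<alpha>) by
  \<open>r_powr_eq\<close>.\<close>

lemma L_at_top:
  assumes "T = \<infinity>"
  shows "filterlim L at_top (left_end T)"
  unfolding filterlim_at_top
proof
  fix Z :: real
  have "((\<lambda>t. pot t / w t) \<longlongrightarrow> - h / b) (left_end T)"
    using b_pos by (intro tendsto_intros pot_tendsto assms w_tendsto) auto
  then have "((\<lambda>t. pot t / w t) \<longlongrightarrow> 0) (left_end T)" by (simp add: parabolic_energy[OF assms])
  from order_tendstoD(2)[OF this, of "exp (- \<alpha> * Z)"]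
  have "\<forall>\<^sub>F t in left_end T. pot t / w t < exp (- \<alpha> * Z)" by simp
  with eventually_inside show "\<forall>\<^sub>F t in left_end T. Z \<le> L t"
  proof eventually_elim
    case (elim t)
    then have "r t powr (- \<alpha>) < exp (- \<alpha> * Z)" and "0 < r t"
      using r_powr_eq r_pos by auto
    then have "- \<alpha> * L t < - \<alpha> * Z" by (simp add: powr_def L_def)
    then show ?case using \<alpha> by simp
  qed
qed

text \<open>In a collision \<open>r\<close> tends to 0, in the parabolic case h is 0; either way the
  energy drops out of the limit.\<close>

lemma hr_tendsto: "((\<lambda>t. h * r t powr \<alpha>) \<longlongrightarrow> 0) (left_end T)"
proof (cases "T = \<infinity>")
  case False
  have "((\<lambda>t. r t powr \<alpha>) \<longlongrightarrow> 0) (left_end T)"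
    by (rule tendsto_zero_powrI[OF r_tendsto_0[OF False] tendsto_const]) (simp_all add: \<alpha> norm_M_nonneg[OF m])
  from tendsto_mult[OF tendsto_const this, of h] show ?thesis by simp
qed (simp add: parabolic_energy)

lemma v_sq_lim:
  "((\<lambda>t. 2 * h * r t powr \<alpha> + 2 * w t) \<longlongrightarrow> 2 * b) (left_end T)"
proof -
  have "((\<lambda>t. 2 * (h * r t powr \<alpha>) + 2 * w t) \<longlongrightarrow> 2 * 0 + 2 * b) (left_end T)"
    by (intro tendsto_intros hr_tendsto w_tendsto)
  then show ?thesis by (simp add: mult.assoc)
qed

sublocale sundman_flow T L v \<theta> "\<lambda>t. 2 * h * r t powr \<alpha> + (2 - \<alpha>) * (w t - b)" "(2 - \<alpha>) / 2" "sqrt (2 * b)"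
proof
  show "((\<lambda>t. 2 * h * r t powr \<alpha> + (2 - \<alpha>) * (w t - b)) \<longlongrightarrow> 0) (left_end T)"
  proof -
    have "((\<lambda>t. 2 * (h * r t powr \<alpha>) + (2 - \<alpha>) * (w t - b)) \<longlongrightarrow> 2 * 0 + (2 - \<alpha>) * (b - b)) (left_end T)"
      by (intro tendsto_intros hr_tendsto w_tendsto)
    then show ?thesis by (simp add: mult.assoc)
  qed
  fix \<delta> :: real assume \<delta>: "0 < \<delta>"
  have "2 * b < (sqrt (2 * b) + \<delta>)\<^sup>2"
    using b_pos \<delta> by (simp add: power2_sum add_pos_pos)
  from order_tendstoD(2)[OF v_sq_lim this] eventually_inside
  show "\<forall>\<^sub>F t in left_end T. \<bar>v t\<bar> \<le> sqrt (2 * b) + \<delta>"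
  proof eventually_elim
    case (elim t)
    then have "\<bar>v t\<bar>\<^sup>2 \<le> (sqrt (2 * b) + \<delta>)\<^sup>2" using v_sq_le[of t] by simp
    then show ?case by (rule power2_le_imp_le) (use b_pos \<delta> in simp)
  qed
qed (use T_pos \<alpha> b_pos dL dv \<theta>_pos in auto)

lemma v_tendsto: "((\<lambda>t. (2 - \<alpha>) / 4 * v t) \<longlongrightarrow> delta_bar m \<alpha> T s\<^sub>0) (left_end T)"
proof (cases "T = \<infinity>")
  case True
  show ?thesis
    unfolding delta_bar_def if_P[OF True] by (intro tendsto_intros tendsto_at_top L_at_top True)
next
  case False
  have "((\<lambda>t. (2 - \<alpha>) / 4 * v t) \<longlongrightarrow> (2 - \<alpha>) / 4 * - sqrt (2 * b)) (left_end T)"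
    by (intro tendsto_intros tendsto_at_bot L_at_bot False)
  then show ?thesis using False by (simp add: delta_bar_def)
qed

lemma v_sq_tendsto: "((\<lambda>t. (v t)\<^sup>2) \<longlongrightarrow> 2 * b) (left_end T)"
proof -
  have "(sqrt (2 * b))\<^sup>2 = 2 * b" "(- sqrt (2 * b))\<^sup>2 = 2 * b" using b_pos by simp_all
  then show ?thesis
    using tendsto_power[OF tendsto_at_top[OF L_at_top], of 2] tendsto_power[OF tendsto_at_bot[OF L_at_bot], of 2]
    by (cases "T = \<infinity>") auto
qed

end

section \<open>The new time\<close>

context asymptotic_orbit
begin

abbreviation "N \<equiv> new_time m \<alpha> \<gamma>"
abbreviation "t\<^sub>o \<equiv> old_time m \<alpha> T \<gamma>"
definition "D = {t. 0 \<le> t \<and> ereal t < T}"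

lemma N_eq: "N t = integral {0..t} \<theta>"
  by (simp add: new_time_def \<theta>_def[abs_def])

lemma continuous_on_\<theta>:
  assumes "ereal t < T"
  shows "continuous_on {0..t} \<theta>"
proof -
  have "r x \<noteq> 0" if "x \<in> {0..t}" for x
    using r_pos[of x] less_T[OF assms, of x] that by simp
  then show ?thesis
    unfolding \<theta>_def[abs_def]
    by (intro continuous_on_powr continuous_on_norm_M continuous_on_const continuous_on_\<gamma>_Icc assms ballI)
qed

lemma N_0: "N 0 = 0"
  by (simp add: N_eq)

lemma continuous_on_N: "ereal t < T \<Longrightarrow> continuous_on {0..t} N"
  unfolding N_eq[abs_def]
  by (intro indefinite_integral_continuous_1 integrable_continuous_real continuous_on_\<theta>)

lemma T_dense:
  assumes "ereal t < T"
  obtains t' where "t < t'" "ereal t' < T"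
  using ereal_dense2[OF assms] by auto

lemma dN:
  assumes t: "0 < t" "ereal t < T"
  shows "(N has_real_derivative \<theta> t) (at t)"
proof -
  \<comment> \<open>A later time makes t an interior point, which turns the derivative within the
    interval into a two-sided one.\<close>
  obtain t' where t': "t < t'" "ereal t' < T" using T_dense[OF t(2)] by blast
  have "((\<lambda>x. integral {0..x} \<theta>) has_real_derivative \<theta> t) (at t within {0..t'})"
    by (rule integral_has_real_derivative[OF continuous_on_\<theta>]) (use t t' in auto)
  then show ?thesis
    using t t' by (simp add: N_eq[abs_def] at_within_Icc_at)
qed

lemma N_strict_mono:
  assumes "0 \<le> x" "x < y" "ereal y < T"
  shows "N x < N y"
proof (rule DERIV_pos_imp_increasing_open[OF assms(2)])
  show "continuous_on {x..y} N"
    by (rule continuous_on_subset[OF continuous_on_N[OF assms(3)]]) (use assms in auto)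
  fix z assume z: "x < z" "z < y"
  then have "0 < z" "ereal z < T" using assms less_T[of y z] by auto
  then show "\<exists>D. (N has_real_derivative D) (at z) \<and> 0 < D"
    by (intro exI[of _ "\<theta> z"] conjI dN \<theta>_pos)
qed

lemma inj_on_N: "inj_on N D"
proof (rule inj_onI)
  fix x y assume "x \<in> D" "y \<in> D" "N x = N y"
  then show "x = y"
    using N_strict_mono[of x y] N_strict_mono[of y x]
    by (cases x y rule: linorder_cases) (simp_all add: D_def)
qed

lemma N_nonneg: "t \<in> D \<Longrightarrow> 0 \<le> N t"
  using N_strict_mono[of 0 t] N_0 by (cases "t = 0") (auto simp: D_def less_imp_le)

text \<open>The logarithmic size of the orbit is a Lipschitz function of the new time, and it is unbounded.\<close>

lemma N_unbounded: "\<exists>t\<in>D. K \<le> N t"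
proof (rule ccontr)
  assume neg: "\<not> (\<exists>t\<in>D. K \<le> N t)"
  have "\<forall>\<^sub>F t in left_end T. (2 - \<alpha>) / 4 * \<bar>v t\<bar> < \<bar>delta_bar m \<alpha> T s\<^sub>0\<bar> + 1"
  proof -
    have "((\<lambda>t. \<bar>(2 - \<alpha>) / 4 * v t\<bar>) \<longlongrightarrow> \<bar>delta_bar m \<alpha> T s\<^sub>0\<bar>) (left_end T)"
      by (intro tendsto_rabs v_tendsto)
    from order_tendstoD(2)[OF this, of "\<bar>delta_bar m \<alpha> T s\<^sub>0\<bar> + 1"] show ?thesis
      using \<alpha> by (simp add: abs_mult)
  qed
  then obtain t0 where t0: "0 < t0" "ereal t0 < T"
    and v: "\<And>t. t0 \<le> t \<Longrightarrow> ereal t < T \<Longrightarrow> (2 - \<alpha>) / 4 * \<bar>v t\<bar> < \<bar>delta_bar m \<alpha> T s\<^sub>0\<bar> + 1"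
    unfolding eventually_left_end[OF T_pos] by auto
  define C where "C = (\<bar>delta_bar m \<alpha> T s\<^sub>0\<bar> + 1) / ((2 - \<alpha>) / 4)"
  have C: "0 < C" using \<alpha> by (simp add: C_def)
  have v: "\<bar>v t\<bar> \<le> C" if "t0 \<le> t" "ereal t < T" for t
    using v[OF that] \<alpha> by (simp add: C_def field_simps)
  have bound: "\<bar>L t\<bar> \<le> \<bar>L t0\<bar> + C * K" if t: "t0 \<le> t" "ereal t < T" for t
  proof -
    have der: "0 < x \<and> ereal x < T \<and> \<bar>v x * \<theta> x\<bar> \<le> C * \<theta> x" if "t0 \<le> x" "x \<le> t" for x
      using that t t0 less_T[of t x] v[of x] \<theta>_pos[of x] by (auto simp: abs_mult)
    have dC: "((\<lambda>x. C * N x) has_real_derivative C * \<theta> x) (at x)" if "t0 \<le> x" "x \<le> t" for x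
      using der[OF that] by (intro DERIV_cmult dN) auto
    have dL': "(L has_real_derivative v x * \<theta> x) (at x)" if "t0 \<le> x" "x \<le> t" for x
      using der[OF that] by (intro dL) auto
    have "L t - L t0 \<le> C * N t - C * N t0"
      by (rule has_real_derivative_mono[OF t(1) dL' dC]) (use der in \<open>auto simp: abs_le_iff\<close>)
    moreover have "(- L t) - (- L t0) \<le> C * N t - C * N t0"
      by (rule has_real_derivative_mono[OF t(1) DERIV_minus[OF dL'] dC]) (use der in \<open>auto simp: abs_le_iff\<close>)
    moreover have "C * N t \<le> C * K"
      using neg C t t0 by (intro mult_left_mono) (auto simp: D_def not_le less_imp_le)
    moreover have "0 \<le> C * N t0"
      using C N_nonneg[of t0] t0 by (auto simp: D_def)
    ultimately show ?thesis by linarith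
  qed
  have "\<forall>\<^sub>F t in left_end T. L t \<le> \<bar>L t0\<bar> + C * K"
    unfolding eventually_left_end[OF T_pos] using t0 bound by (intro exI[of _ t0]) (auto simp: abs_le_iff)
  moreover have "\<forall>\<^sub>F t in left_end T. - (\<bar>L t0\<bar> + C * K) \<le> L t"
    unfolding eventually_left_end[OF T_pos]
  proof (intro exI[of _ t0] conjI t0 allI impI)
    fix t assume "t0 \<le> t \<and> ereal t < T"
    then show "- (\<bar>L t0\<bar> + C * K) \<le> L t" using bound[of t] by linarith
  qed
  ultimately show False
    using unbounded[OF L_at_top] unbounded'[OF L_at_bot] by blast
qed

lemma N_surj:
  assumes "0 \<le> \<tau>"
  shows "\<exists>t\<in>D. N t = \<tau>"
proof -
  obtain t where t: "t \<in> D" "\<tau> \<le> N t" using N_unbounded by blast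
  have "\<exists>x\<ge>0. x \<le> t \<and> N x = \<tau>"
    by (rule IVT') (use t assms continuous_on_N in \<open>auto simp: D_def N_0\<close>)
  then show ?thesis using t less_T[of t] by (auto simp: D_def)
qed

lemma old_time:
  assumes "0 \<le> \<tau>"
  shows "t\<^sub>o \<tau> \<in> D" "N (t\<^sub>o \<tau>) = \<tau>"
proof -
  obtain t where t: "t \<in> D" "N t = \<tau>" using N_surj[OF assms] by blast
  then have "t\<^sub>o \<tau> = t"
    using the_inv_into_f_f[OF inj_on_N t(1)] by (simp add: old_time_def D_def)
  with t show "t\<^sub>o \<tau> \<in> D" "N (t\<^sub>o \<tau>) = \<tau>" by auto
qed

lemma old_time_N: "t \<in> D \<Longrightarrow> t\<^sub>o (N t) = t"
  using the_inv_into_f_f[OF inj_on_N, of t] by (simp add: old_time_def D_def)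

lemma old_time_less: "0 \<le> \<tau> \<Longrightarrow> ereal (t\<^sub>o \<tau>) < T"
  using old_time(1) by (auto simp: D_def)

lemma old_time_nonneg: "0 \<le> \<tau> \<Longrightarrow> 0 \<le> t\<^sub>o \<tau>"
  using old_time(1) by (auto simp: D_def)

lemma old_time_less_iff:
  assumes "t \<in> D" "0 \<le> \<tau>"
  shows "t < t\<^sub>o \<tau> \<longleftrightarrow> N t < \<tau>"
  using N_strict_mono[of t "t\<^sub>o \<tau>"] N_strict_mono[of "t\<^sub>o \<tau>" t] old_time[OF assms(2)] assms(1)
  by (cases t "t\<^sub>o \<tau>" rule: linorder_cases) (auto simp: D_def)

lemma old_time_pos: "0 < \<tau> \<Longrightarrow> 0 < t\<^sub>o \<tau>"
  using old_time_less_iff[of 0 \<tau>] T_pos N_0 by (simp add: D_def zero_ereal_def)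

text \<open>Composition with this carries every limit obtained in the old time over to \<tau>
  \<rightarrow> \<infinity>.\<close>

lemma filterlim_old_time: "filterlim t\<^sub>o (left_end T) at_top"
  unfolding filterlim_iff
proof (intro allI impI)
  fix P assume "eventually P (left_end T)"
  then obtain t0 where t0: "0 < t0" "ereal t0 < T" "\<And>t. t0 \<le> t \<Longrightarrow> ereal t < T \<Longrightarrow> P t"
    unfolding eventually_left_end[OF T_pos] by auto
  have "t0 \<in> D" using t0 by (simp add: D_def)
  show "\<forall>\<^sub>F \<tau> in at_top. P (t\<^sub>o \<tau>)"
    unfolding eventually_at_top_dense
  proof (intro exI[of _ "N t0"] allI impI)
    fix \<tau> assume \<tau>: "N t0 < \<tau>"
    then have "0 \<le> \<tau>" using N_nonneg[OF \<open>t0 \<in> D\<close>] by simp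
    moreover have "t0 < t\<^sub>o \<tau>" using old_time_less_iff[OF \<open>t0 \<in> D\<close> \<open>0 \<le> \<tau>\<close>] \<tau> by simp
    ultimately show "P (t\<^sub>o \<tau>)" using t0(3) old_time_less by simp
  qed
qed

lemma d_old_time:
  assumes \<tau>: "0 < \<tau>"
  shows "(t\<^sub>o has_real_derivative inverse (\<theta> (t\<^sub>o \<tau>))) (at \<tau>)"
proof -
  define t where "t = t\<^sub>o \<tau>"
  have t: "0 < t" "ereal t < T" "N t = \<tau>"
    using old_time_pos[OF \<tau>] old_time_less[of \<tau>] old_time(2)[of \<tau>] \<tau> by (auto simp: t_def)
  obtain t' where t': "t < t'" "ereal t' < T" using T_dense[OF t(2)] by blast
  have in_D: "z \<in> D" if "t / 2 \<le> z" "z \<le> t'" for z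
    using that t t' less_T[of t' z] by (auto simp: D_def)
  have "isCont t\<^sub>o (N t)"
  \<comment> \<open>The window from t/2 to t' contains only positive times below T, where the new
    time is differentiable and \<open>t\<^sub>o\<close> inverts it.\<close>
  proof (rule isCont_inverse_function2[of "t / 2" t t'])
    fix z assume z: "t / 2 \<le> z" "z \<le> t'"
    show "t\<^sub>o (N z) = z" by (rule old_time_N[OF in_D[OF z]])
    show "isCont N z" using in_D[OF z] z t by (intro DERIV_isCont[OF dN]) (auto simp: D_def)
  qed (use t t' in auto)
  then have "isCont t\<^sub>o \<tau>" by (simp add: t)
  moreover have "(N has_real_derivative \<theta> (t\<^sub>o \<tau>)) (at (t\<^sub>o \<tau>))"
    using dN t by (simp add: t_def)
  moreover have "\<theta> (t\<^sub>o \<tau>) \<noteq> 0" using \<theta>_pos[of t] t by (simp add: t_def)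
  ultimately show ?thesis
    using \<tau> old_time(2) by (intro DERIV_inverse_function[where f = N and a = 0 and b = "\<tau> + 1"]) auto
qed

lemma dtau_at: "0 < \<tau> \<Longrightarrow> dtau f \<tau> = vector_derivative f (at \<tau>)"
  unfolding dtau_def by (subst at_within_interior[of \<tau> "{0..}"]) auto

abbreviation "s \<equiv> reg_s m \<alpha> T \<gamma>"
abbreviation "\<rho> \<equiv> reg_rho m \<alpha> T \<gamma>"
definition "s' = dtau s"
definition "k \<tau> = dtau \<rho> \<tau> / \<rho> \<tau>"

text \<open>The function \<rho> is a power of r with exponent (2-\<alpha>)/4, and ln r has
  derivative \<open>v\<close> in the new time. For positive \<tau> the derivative in
  \<open>dtau\<close> is two-sided.\<close>

lemma k_eq:
  assumes \<tau>: "0 < \<tau>"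
  shows "k \<tau> = (2 - \<alpha>) / 4 * v (t\<^sub>o \<tau>)"
proof -
  have t: "0 < t\<^sub>o \<tau>" "ereal (t\<^sub>o \<tau>) < T" using old_time_pos old_time_less \<tau> by auto
  have "(\<rho> has_real_derivative r (t\<^sub>o \<tau>) powr ((2 - \<alpha>) / 4) *
      ((2 - \<alpha>) / 4 * (v (t\<^sub>o \<tau>) * \<theta> (t\<^sub>o \<tau>))) * inverse (\<theta> (t\<^sub>o \<tau>))) (at \<tau>)"
    unfolding reg_rho_def[abs_def] by (rule DERIV_chain2[OF dr_powr[OF t] d_old_time[OF \<tau>]])
  from has_real_derivative_iff_has_vector_derivative[THEN iffD1, OF this]
  have "dtau \<rho> \<tau> = r (t\<^sub>o \<tau>) powr ((2 - \<alpha>) / 4) *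
      ((2 - \<alpha>) / 4 * (v (t\<^sub>o \<tau>) * \<theta> (t\<^sub>o \<tau>))) * inverse (\<theta> (t\<^sub>o \<tau>))"
    using dtau_at[OF \<tau>] vector_derivative_at by metis
  then show ?thesis
    using r_pos_t[OF t] \<theta>_pos[OF t] by (simp add: k_def reg_rho_def)
qed

text \<open>Kinetic energy splits orthogonally into a radial and a tangential part. Rescaled to the
  new time these are the squares of \<open>v\<close> and of s'.\<close>

lemma s'_norm:
  assumes \<tau>: "0 < \<tau>"
  shows "(norm_M m (s' \<tau>))\<^sup>2 = 2 * h * r (t\<^sub>o \<tau>) powr \<alpha> + 2 * w (t\<^sub>o \<tau>) - (v (t\<^sub>o \<tau>))\<^sup>2"
proof -
  define t where "t = t\<^sub>o \<tau>"
  have t: "0 < t" "ereal t < T" using old_time_pos old_time_less \<tau> by (auto simp: t_def)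
  note rt = r_pos_t[OF t]
  \<comment> \<open>The derivative of the normalised configuration in the old time.\<close>
  define u where "u = inverse (r t) *\<^sub>R velocity \<gamma> t - (dot t / (r t)^3) *\<^sub>R \<gamma> t"
  have "((\<lambda>t. inverse (r t)) has_real_derivative - (inverse (r t) * (dot t / r t) * inverse (r t))) (at t)"
    by (rule DERIV_inverse'[OF dr[OF t]]) (use rt in simp)
  from has_vector_derivative_scaleR[OF this d\<gamma>[OF t]]
  have "((\<lambda>t. \<gamma> t /\<^sub>R r t) has_vector_derivative u) (at t)"
    by (rule has_vector_derivative_eq_rhs)
      (simp add: u_def divide_inverse power3_eq_cube mult_ac)
  then have "(((\<lambda>t. \<gamma> t /\<^sub>R r t) \<circ> t\<^sub>o) has_vector_derivative inverse (\<theta> t) *\<^sub>R u) (at \<tau>)"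
    using d_old_time[OF \<tau>]
    by (intro vector_diff_chain_at) (simp_all add: t_def has_real_derivative_iff_has_vector_derivative)
  then have "(s has_vector_derivative inverse (\<theta> t) *\<^sub>R u) (at \<tau>)"
    by (simp add: reg_s_def[abs_def] o_def)
  then have s': "s' \<tau> = inverse (\<theta> t) *\<^sub>R u"
    by (simp add: s'_def dtau_at[OF \<tau>] vector_derivative_at)
  have "inner_M m u u = 2 * (h + pot t) / (r t)\<^sup>2 - (dot t)\<^sup>2 / (r t)^4"
  proof -
    have "inner_M m u u = inverse (r t) * inverse (r t) * (2 * (h + pot t))
        - 2 * (inverse (r t) * (dot t / (r t)^3) * dot t) + (dot t / (r t)^3)\<^sup>2 * (r t)\<^sup>2"
      unfolding u_def r_sq kinetic[OF t, symmetric]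
      by (simp add: inner_M_bilinear_simps inner_M_commute[of m "velocity \<gamma> t" "\<gamma> t"] power2_eq_square
        algebra_simps)
    then show ?thesis
      using rt by (simp add: field_simps power2_eq_square power3_eq_cube power4_eq_xxxx)
  qed
  moreover have "(inverse (\<theta> t))\<^sup>2 = r t powr \<alpha> * (r t)\<^sup>2"
  proof -
    have "(inverse (\<theta> t))\<^sup>2 = r t powr (2 + \<alpha>)"
      unfolding \<theta>_def power2_eq_square by (simp flip: powr_minus powr_add) (simp add: add.commute)
    then show ?thesis using rt by (simp add: powr_add)
  qed
  ultimately have "inner_M m (s' \<tau>) (s' \<tau>) =
      r t powr \<alpha> * (r t)\<^sup>2 * (2 * (h + pot t) / (r t)\<^sup>2 - (dot t)\<^sup>2 / (r t)^4)"
    unfolding s' inner_M_bilinear_simps power2_eq_square[of "inverse (\<theta> t)"] by (simp add: mult.assoc)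
  also have "\<dots> = r t powr \<alpha> * (2 * (h + pot t)) - r t powr \<alpha> * (dot t)\<^sup>2 / (r t)\<^sup>2"
    using rt by (simp add: field_simps power2_eq_square power4_eq_xxxx)
  also have "\<dots> = 2 * h * r t powr \<alpha> + 2 * w t - (v t)\<^sup>2"
    unfolding r_v_sq[OF t] by (simp add: w_def algebra_simps)
  finally show ?thesis by (simp add: norm_M_sq[OF m] t_def)
qed

text \<open>Since \<beta> - 2 = 4\<alpha>/(2-\<alpha>), the exponents multiply to \<alpha>.\<close>

lemma rho_powr:
  assumes "0 \<le> \<tau>"
  shows "\<rho> \<tau> powr (beta_exp \<alpha> - 2) = r (t\<^sub>o \<tau>) powr \<alpha>"
proof -
  have "(2 - \<alpha>) / 4 * (beta_exp \<alpha> - 2) = \<alpha>"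
    using \<alpha> by (simp add: beta_exp_def field_simps)
  then show ?thesis by (simp add: reg_rho_def powr_powr)
qed

lemma s_tendsto_at_top: "(s \<longlongrightarrow> s\<^sub>0) at_top"
  using filterlim_compose[OF s_tendsto filterlim_old_time] by (simp add: reg_s_def[abs_def])

lemma k_tendsto: "(k \<longlongrightarrow> delta_bar m \<alpha> T s\<^sub>0) at_top"
proof -
  have "((\<lambda>\<tau>. (2 - \<alpha>) / 4 * v (t\<^sub>o \<tau>)) \<longlongrightarrow> delta_bar m \<alpha> T s\<^sub>0) at_top"
    by (rule filterlim_compose[OF v_tendsto filterlim_old_time])
  then show ?thesis
    by (rule Lim_transform_eventually) (use eventually_gt_at_top[of 0] in \<open>eventually_elim, simp add: k_eq\<close>)
qed

lemma e_tendsto: "((\<lambda>\<tau>. h * \<rho> \<tau> powr (beta_exp \<alpha> - 2)) \<longlongrightarrow> 0) at_top"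
  using filterlim_compose[OF hr_tendsto filterlim_old_time]
  by (rule Lim_transform_eventually)
    (use eventually_gt_at_top[of 0] in \<open>eventually_elim, simp add: rho_powr\<close>)

lemma s'_tendsto: "(s' \<longlongrightarrow> 0) at_top"
proof -
  have "((\<lambda>t. 2 * h * r t powr \<alpha> + 2 * w t - (v t)\<^sup>2) \<longlongrightarrow> 2 * b - 2 * b) (left_end T)"
    by (intro tendsto_diff v_sq_lim v_sq_tendsto)
  from filterlim_compose[OF this filterlim_old_time]
  have "((\<lambda>\<tau>. 2 * h * r (t\<^sub>o \<tau>) powr \<alpha> + 2 * w (t\<^sub>o \<tau>) - (v (t\<^sub>o \<tau>))\<^sup>2) \<longlongrightarrow> 0) at_top"
    by simp
  then have "((\<lambda>\<tau>. (norm_M m (s' \<tau>))\<^sup>2) \<longlongrightarrow> 0) at_top"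
    by (rule Lim_transform_eventually)
      (use eventually_gt_at_top[of 0] in \<open>eventually_elim, simp add: s'_norm\<close>)
  from tendsto_real_sqrt[OF this] have *: "((\<lambda>\<tau>. norm_M m (s' \<tau>)) \<longlongrightarrow> 0) at_top"
    by (simp add: norm_M_nonneg[OF m])
  obtain a where a: "0 < a" "\<And>u :: real^'d^'n. a * norm u \<le> norm_M m u"
    using norm_M_bounds[OF m] by metis
  have "((\<lambda>\<tau>. norm_M m (s' \<tau>) / a) \<longlongrightarrow> 0 / a) at_top"
    by (intro tendsto_divide * tendsto_const) (use a in simp)
  then have "((\<lambda>\<tau>. norm_M m (s' \<tau>) / a) \<longlongrightarrow> 0) at_top" by simp
  moreover have "\<forall>\<^sub>F \<tau> in at_top. norm (s' \<tau>) \<le> norm_M m (s' \<tau>) / a"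
    by (intro always_eventually allI) (use a in \<open>simp add: field_simps\<close>)
  ultimately show ?thesis by (rule Lim_null_comparison[rotated])
qed

lemma s_props:
  assumes "0 \<le> \<tau>"
  shows "s \<tau> \<in> collision_free" "norm_M m (s \<tau>) = 1"
  using collision_free_scaleR[of "inverse (r (t\<^sub>o \<tau>))" "\<gamma> (t\<^sub>o \<tau>)"] r_pos[of "t\<^sub>o \<tau>"] \<gamma>_free[of "t\<^sub>o \<tau>"]
    old_time_nonneg[OF assms] old_time_less[OF assms]
  by (auto simp: reg_s_def norm_M_scaleR[OF m])

lemma W_hess_y:
  assumes "0 \<le> \<tau>"
  shows "W_hess m \<alpha> c (reg_y m \<alpha> T \<gamma> \<tau>) u u' = W_hess m \<alpha> c (s \<tau>) u u'"
  using r_pos[of "t\<^sub>o \<tau>"] old_time_nonneg[OF assms] old_time_less[OF assms]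
  by (simp add: reg_y_def W_hess_scaleR[OF m] reg_rho_def)

lemma y_free:
  assumes "0 \<le> \<tau>"
  shows "reg_y m \<alpha> T \<gamma> \<tau> \<in> collision_free"
  using r_pos[of "t\<^sub>o \<tau>"] old_time_nonneg[OF assms] old_time_less[OF assms] s_props[OF assms]
    collision_free_scaleR[of "\<rho> \<tau>" "s \<tau>"]
  by (simp add: reg_y_def reg_rho_def)

text \<open>The positions are continuous and collision-free on a compact interval that includes time
  0, which provides S. No limit of the velocity at 0 is assumed; instead the squares of
  \<open>v\<close> and of s' add up to 2h r^\<alpha> + 2w, and this depends on positions
  only.\<close>

lemma bounded_coefficients:
  assumes "0 < \<tau>\<^sub>0"
  obtains S C where "compact S" "S \<subseteq> collision_free" "0 \<le> C"
    "\<forall>\<tau>. 0 < \<tau> \<and> \<tau> \<le> \<tau>\<^sub>0 \<longrightarrow> s \<tau> \<in> S \<and> norm_M m (s' \<tau>) \<le> C \<and> \<bar>k \<tau>\<bar> \<le> C \<and>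
      \<bar>h * \<rho> \<tau> powr (beta_exp \<alpha> - 2)\<bar> \<le> C"
proof -
  define t0 where "t0 = t\<^sub>o \<tau>\<^sub>0"
  have t0: "0 \<le> t0" "ereal t0 < T" using old_time_nonneg old_time_less assms by (auto simp: t0_def)
  have t_le: "t\<^sub>o \<tau> \<in> {0..t0}" if "0 < \<tau>" "\<tau> \<le> \<tau>\<^sub>0" for \<tau>
    using old_time_less_iff[of t0 \<tau>] old_time[of \<tau>] old_time[of \<tau>\<^sub>0] that assms
    by (auto simp: t0_def D_def not_less[symmetric])
  have c\<gamma>: "continuous_on {0..t0} \<gamma>" by (rule continuous_on_\<gamma>_Icc[OF t0(2)])
  have rp: "0 < r t" "\<gamma> t \<in> collision_free" if "t \<in> {0..t0}" for t
    using that t0 less_T[of t0 t] r_pos[of t] \<gamma>_free[of t] by auto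
  have cr: "continuous_on {0..t0} (\<lambda>t. r t powr \<alpha>)"
    by (intro continuous_on_powr continuous_on_norm_M continuous_on_const c\<gamma> ballI)
      (use rp in \<open>auto simp: less_imp_neq[symmetric]\<close>)
  have cw: "continuous_on {0..t0} w"
    unfolding w_def[abs_def] using rp
    by (intro continuous_on_mult cr continuous_on_potential c\<gamma>) auto
  define S where "S = (\<lambda>t. \<gamma> t /\<^sub>R r t) ` {0..t0}"
  have "compact S"
    unfolding S_def
    by (intro compact_continuous_image continuous_on_scaleR continuous_on_inverse continuous_on_norm_M c\<gamma>)
      (use rp in \<open>auto simp: less_imp_neq[symmetric]\<close>)
  moreover have "S \<subseteq> collision_free"
  proof
    fix x assume "x \<in> S"
    then obtain t where "t \<in> {0..t0}" "x = \<gamma> t /\<^sub>R r t" by (auto simp: S_def)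
    then show "x \<in> collision_free"
      using rp[of t] collision_free_scaleR[of "inverse (r t)" "\<gamma> t"] by simp
  qed
  moreover have "s \<tau> \<in> S" if "0 < \<tau>" "\<tau> \<le> \<tau>\<^sub>0" for \<tau>
    using t_le[OF that] by (auto simp: S_def reg_s_def)
  moreover
  have "compact ((\<lambda>t. 2 * h * r t powr \<alpha> + 2 * w t) ` {0..t0})"
    by (intro compact_continuous_image continuous_intros cr cw) auto
  then obtain C1 where "\<forall>x\<in>(\<lambda>t. 2 * h * r t powr \<alpha> + 2 * w t) ` {0..t0}. norm x \<le> C1"
    using compact_imp_bounded bounded_iff by metis
  then have C1: "2 * h * r t powr \<alpha> + 2 * w t \<le> C1" if "t \<in> {0..t0}" for t
    using that by (simp add: abs_le_iff)
  have "compact ((\<lambda>t. h * r t powr \<alpha>) ` {0..t0})"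
    by (intro compact_continuous_image continuous_intros cr) auto
  then obtain C2 where "\<forall>x\<in>(\<lambda>t. h * r t powr \<alpha>) ` {0..t0}. norm x \<le> C2"
    using compact_imp_bounded bounded_iff by metis
  then have C2: "\<bar>h * r t powr \<alpha>\<bar> \<le> C2" if "t \<in> {0..t0}" for t
    using that by simp
  \<comment> \<open>The summand 1 makes C at least 1, so that C^2 dominates |C1| and a bound on a
    square passes to its root.\<close>
  define C where "C = 1 + \<bar>C1\<bar> + \<bar>C2\<bar>"
  have le_C: "x \<le> C" if "x\<^sup>2 \<le> C1" for x
  proof -
    have "x\<^sup>2 \<le> C\<^sup>2" using that mult_mono[of 1 C "\<bar>C1\<bar>" C] by (auto simp: C_def power2_eq_square)
    then show ?thesis by (rule power2_le_imp_le) (simp add: C_def)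
  qed
  have v_le: "(v (t\<^sub>o \<tau>))\<^sup>2 \<le> C1" and s'_le: "(norm_M m (s' \<tau>))\<^sup>2 \<le> C1" if "0 < \<tau>" "\<tau> \<le> \<tau>\<^sub>0" for \<tau>
    using C1[OF t_le[OF that]] v_sq_le[OF old_time_pos[OF that(1)] old_time_less[OF less_imp_le[OF that(1)]]]
      s'_norm[OF that(1)] zero_le_power2[of "v (t\<^sub>o \<tau>)"]
    by linarith+
  have "\<bar>k \<tau>\<bar> \<le> C" if "0 < \<tau>" "\<tau> \<le> \<tau>\<^sub>0" for \<tau>
  proof -
    have "\<bar>k \<tau>\<bar> \<le> 1 * \<bar>v (t\<^sub>o \<tau>)\<bar>"
      unfolding k_eq[OF that(1)] abs_mult using \<alpha> by (intro mult_right_mono) auto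
    also have "\<dots> \<le> C" using le_C[of "\<bar>v (t\<^sub>o \<tau>)\<bar>"] v_le[OF that] by simp
    finally show ?thesis .
  qed
  moreover have "norm_M m (s' \<tau>) \<le> C" if "0 < \<tau>" "\<tau> \<le> \<tau>\<^sub>0" for \<tau>
    by (rule le_C[OF s'_le[OF that]])
  moreover have "\<bar>h * \<rho> \<tau> powr (beta_exp \<alpha> - 2)\<bar> \<le> C" if "0 < \<tau>" "\<tau> \<le> \<tau>\<^sub>0" for \<tau>
    using C2[OF t_le[OF that]] that by (simp add: rho_powr C_def)
  ultimately show ?thesis by (intro that[of S C]) (simp_all add: C_def)
qed

end

section \<open>Square integrable primitives\<close>

text \<open>On a set of finite measure L^2 is contained in L^1, because |x| \<le> 1 + |x|^2.\<close>

lemma set_integrable_norm_of_sq: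
  fixes g :: "real \<Rightarrow> 'a::euclidean_space"
  assumes [measurable]: "g \<in> borel_measurable lborel"
    and sq: "set_integrable lborel A (\<lambda>t. (norm (g t))\<^sup>2)"
    and A: "A \<in> sets lborel" "emeasure lborel A < \<infinity>"
  shows "set_integrable lborel A g"
proof (rule set_integrable_bound)
  show "set_integrable lborel A (\<lambda>t. 1 + (norm (g t))\<^sup>2)"
    by (intro set_integral_add sq) (use A in \<open>simp add: set_integrable_def\<close>)
  have "norm x \<le> 1 + (norm x)\<^sup>2" for x :: 'a
  proof -
    have "0 \<le> (norm x - 1)\<^sup>2" by simp
    then have "2 * norm x \<le> 1 + (norm x)\<^sup>2" by (simp add: power2_diff)
    then show ?thesis using norm_ge_zero[of x] by linarith
  qed
  then show "AE x in lborel. x \<in> A \<longrightarrow> norm (g x) \<le> norm (1 + (norm (g x))\<^sup>2)"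
    by auto
  show "set_borel_measurable lborel A g"
    using A(1) by (simp add: set_borel_measurable_def)
qed

lemma set_integral_singleton:
  fixes f :: "real \<Rightarrow> 'a::euclidean_space"
  shows "(LINT t:{a}|lborel. f t) = 0"
  unfolding set_lebesgue_integral_def
proof (rule integral_eq_zero_AE)
  show "AE t in lborel. indicator {a} t *\<^sub>R f t = 0"
    using AE_lborel_singleton[of a] by eventually_elim auto
qed

lemma set_integral_inner_left:
  fixes g :: "real \<Rightarrow> 'a::euclidean_space"
  assumes "set_integrable lborel A g"
  shows "(LINT t:A|lborel. g t) \<bullet> c = (LINT t:A|lborel. g t \<bullet> c)"
    and "set_integrable lborel A (\<lambda>t. g t \<bullet> c)"
  using integral_inner_left[of c lborel "\<lambda>x. indicator A x *\<^sub>R g x"]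
    integrable_inner_left[of c lborel "\<lambda>x. indicator A x *\<^sub>R g x"] assms
  by (simp_all add: set_lebesgue_integral_def set_integrable_def)

text \<open>The square \<open>[a, t]\<^sup>2\<close> is cut along its diagonal, and the two halves contribute equally.\<close>

lemma integral_primitive_mult_real:
  fixes g :: "real \<Rightarrow> real"
  assumes g: "set_integrable lborel {a..t} g"
    and f: "\<And>x. a \<le> x \<Longrightarrow> x \<le> t \<Longrightarrow> f x = (LINT u:{a..x}|lborel. g u)"
    and "a \<le> t"
  shows "(LINT x:{a..t}|lborel. f x * g x) = (f t)\<^sup>2 / 2"
proof -
  define G where "G x = indicator {a..t} x *\<^sub>R g x" for x
  have G: "integrable lborel G"
    using g by (simp add: G_def[abs_def] set_integrable_def)
  then have [measurable]: "G \<in> borel_measurable borel" by simp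
  define H where "H x u = (if u \<le> x then G x * G u else 0)" for x u
  have H_meas[measurable]: "case_prod H \<in> borel_measurable (lborel \<Otimes>\<^sub>M lborel)"
    unfolding H_def by measurable
  have GG: "integrable (lborel \<Otimes>\<^sub>M lborel) (\<lambda>z. G (fst z) * G (snd z))"
  proof (rule lborel_pair.Fubini_integrable)
    show "integrable lborel (\<lambda>x. \<integral>y. norm (G (fst (x, y)) * G (snd (x, y))) \<partial>lborel)"
      using G by (simp add: abs_mult)
    show "AE x in lborel. integrable lborel (\<lambda>y. G (fst (x, y)) * G (snd (x, y)))"
      using G by simp
  qed measurable
  have H: "integrable (lborel \<Otimes>\<^sub>M lborel) (case_prod H)"
    by (rule Bochner_Integration.integrable_bound[OF GG H_meas]) (auto simp: H_def)
  define I where "I = (\<integral>x. \<integral>u. H x u \<partial>lborel \<partial>lborel)"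
  have inner1: "(\<integral>u. H x u \<partial>lborel) = indicator {a..t} x *\<^sub>R (f x * g x)" for x
  proof (cases "x \<in> {a..t}")
    case True
    have "(\<integral>u. H x u \<partial>lborel) = (\<integral>u. g x * (indicator {a..x} u *\<^sub>R g u) \<partial>lborel)"
      by (rule Bochner_Integration.integral_cong) (use True in \<open>auto simp: H_def G_def indicator_def\<close>)
    also have "\<dots> = g x * f x"
      using True f[of x] by (simp add: set_lebesgue_integral_def)
    finally show ?thesis using True by simp
  next
    case False
    then have "H x u = 0" for u by (auto simp: H_def G_def)
    with False show ?thesis by simp
  qed
  then have I_eq: "I = (LINT x:{a..t}|lborel. f x * g x)"
    by (simp add: I_def set_lebesgue_integral_def)
  have int1: "integrable lborel (\<lambda>x. \<integral>u. H x u \<partial>lborel)"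
    by (rule lborel_pair.integrable_fst[OF H])
  have int2: "integrable lborel (\<lambda>u. \<integral>x. H x u \<partial>lborel)"
    by (rule lborel_pair.integrable_snd[OF H])
  have "I = (\<integral>u. \<integral>x. H x u \<partial>lborel \<partial>lborel)"
    unfolding I_def using lborel_pair.Fubini_integral[OF H] by simp
  then have "I + I = (\<integral>x. ((\<integral>u. H x u \<partial>lborel) + (\<integral>u. H u x \<partial>lborel)) \<partial>lborel)"
    unfolding Bochner_Integration.integral_add[OF int1 int2] by (simp add: I_def)
  also have "\<dots> = (\<integral>x. G x * (\<integral>u. G u \<partial>lborel) \<partial>lborel)"
  proof (rule Bochner_Integration.integral_cong[OF refl])
    fix x
    have i1: "integrable lborel (H x)"
      by (rule Bochner_Integration.integrable_bound[OF integrable_mult_right[OF G, of "G x"]])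
        (auto simp: H_def[abs_def])
    have i2: "integrable lborel (\<lambda>u. H u x)"
      by (rule Bochner_Integration.integrable_bound[OF integrable_mult_right[OF G, of "G x"]])
        (auto simp: H_def abs_mult mult.commute[of "\<bar>G x\<bar>"])
    have "(\<integral>u. H x u \<partial>lborel) + (\<integral>u. H u x \<partial>lborel) = (\<integral>u. H x u + H u x \<partial>lborel)"
      by (rule Bochner_Integration.integral_add[OF i1 i2, symmetric])
    also have "\<dots> = (\<integral>u. G x * G u \<partial>lborel)"
    proof (rule integral_cong_AE)
      \<comment> \<open>Off the diagonal exactly one of the conditions u \<le> x and x \<le> u
        holds; on it both do, but it is a null set.\<close>
      show "AE u in lborel. H x u + H u x = G x * G u"
        using AE_lborel_singleton[of x] by eventually_elim (auto simp: H_def)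
    qed (use i1 i2 in auto)
    finally show "(\<integral>u. H x u \<partial>lborel) + (\<integral>u. H u x \<partial>lborel) = G x * (\<integral>u. G u \<partial>lborel)" by simp
  qed
  also have "\<dots> = (\<integral>u. G u \<partial>lborel)\<^sup>2" by (simp add: power2_eq_square)
  also have "(\<integral>u. G u \<partial>lborel) = f t"
    using f[of t] \<open>a \<le> t\<close> by (simp add: G_def set_lebesgue_integral_def)
  finally show ?thesis by (simp add: I_eq)
qed

lemma set_integrable_inner_of_sq:
  fixes g :: "real \<Rightarrow> 'a::euclidean_space"
  assumes [measurable]: "f \<in> borel_measurable lborel" "g \<in> borel_measurable lborel" "A \<in> sets lborel"
    and "set_integrable lborel A (\<lambda>t. (norm (f t))\<^sup>2)" "set_integrable lborel A (\<lambda>t. (norm (g t))\<^sup>2)"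
  shows "set_integrable lborel A (\<lambda>t. f t \<bullet> g t)"
proof (rule set_integrable_bound)
  show "set_integrable lborel A (\<lambda>t. (norm (f t))\<^sup>2 + (norm (g t))\<^sup>2)"
    by (intro set_integral_add assms)
  have "\<bar>x \<bullet> y\<bar> \<le> (norm x)\<^sup>2 + (norm y)\<^sup>2" for x y :: 'a
  proof -
    have "\<bar>x \<bullet> y\<bar> \<le> norm x * norm y" by (rule Cauchy_Schwarz_ineq2)
    moreover have "2 * (norm x * norm y) \<le> (norm x)\<^sup>2 + (norm y)\<^sup>2"
      using sum_squares_bound[of "norm x" "norm y"] by (simp add: mult.assoc)
    moreover have "0 \<le> norm x * norm y" by simp
    ultimately show ?thesis by linarith
  qed
  then show "AE x in lborel. x \<in> A \<longrightarrow> norm (f x \<bullet> g x) \<le> norm ((norm (f x))\<^sup>2 + (norm (g x))\<^sup>2)"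
    by auto
  show "set_borel_measurable lborel A (\<lambda>t. f t \<bullet> g t)"
    by (simp add: set_borel_measurable_def)
qed

text \<open>The scalar identity is applied to each coordinate in \<open>Basis\<close> and the
  results are added.\<close>

lemma integral_primitive_inner:
  fixes g :: "real \<Rightarrow> 'a::euclidean_space"
  assumes meas: "f \<in> borel_measurable lborel" "g \<in> borel_measurable lborel"
    and f2: "set_integrable lborel {a..t} (\<lambda>t. (norm (f t))\<^sup>2)"
    and g2: "set_integrable lborel {a..t} (\<lambda>t. (norm (g t))\<^sup>2)"
    and f: "\<And>x. a \<le> x \<Longrightarrow> x \<le> t \<Longrightarrow> f x = (LINT u:{a..x}|lborel. g u)"
    and "a \<le> t"
  shows "(LINT x:{a..t}|lborel. f x \<bullet> g x) = (norm (f t))\<^sup>2 / 2"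
proof -
  note [measurable] = meas
  have g: "set_integrable lborel {a..t} g"
    by (rule set_integrable_norm_of_sq[OF meas(2) g2]) (auto simp: emeasure_lborel_Icc_eq)
  have gx: "set_integrable lborel {a..x} g" if "a \<le> x" "x \<le> t" for x
    by (rule set_integrable_subset[OF g]) (use that in auto)
  have i: "(LINT x:{a..t}|lborel. (f x \<bullet> b) * (g x \<bullet> b)) = (f t \<bullet> b)\<^sup>2 / 2" for b
    by (rule integral_primitive_mult_real[where f = "\<lambda>x. f x \<bullet> b", OF set_integral_inner_left(2)[OF g]])
      (use \<open>a \<le> t\<close> f set_integral_inner_left(1)[OF gx] in auto)
  have int: "set_integrable lborel {a..t} (\<lambda>x. (f x \<bullet> b) * (g x \<bullet> b))" if "b \<in> Basis" for b
  proof -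
    have *: "set_integrable lborel {a..t} (\<lambda>x. (norm (F x \<bullet> b))\<^sup>2)"
      if F: "set_integrable lborel {a..t} (\<lambda>x. (norm (F x))\<^sup>2)" and [measurable]: "F \<in> borel_measurable lborel"
      for F :: "real \<Rightarrow> 'a"
    proof (rule set_integrable_bound[OF F])
      show "AE x in lborel. x \<in> {a..t} \<longrightarrow> norm ((norm (F x \<bullet> b))\<^sup>2) \<le> norm ((norm (F x))\<^sup>2)"
      proof (intro AE_I2 impI)
        show "norm ((norm (F x \<bullet> b))\<^sup>2) \<le> norm ((norm (F x))\<^sup>2)" for x
          using power_mono[OF Basis_le_norm[OF \<open>b \<in> Basis\<close>, of "F x"], where n = 2] by simp
      qed
    qed (simp add: set_borel_measurable_def)
    from set_integrable_inner_of_sq[of "\<lambda>x. f x \<bullet> b" "\<lambda>x. g x \<bullet> b" "{a..t}"]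
    show ?thesis using *[OF f2 meas(1)] *[OF g2 meas(2)] by simp
  qed
  have "(LINT x:{a..t}|lborel. f x \<bullet> g x) = (LINT x:{a..t}|lborel. \<Sum>b\<in>Basis. (f x \<bullet> b) * (g x \<bullet> b))"
    by (simp only: euclidean_inner[of "f _" "g _"])
  also have "\<dots> = (\<integral>x. (\<Sum>b\<in>Basis. indicator {a..t} x *\<^sub>R ((f x \<bullet> b) * (g x \<bullet> b))) \<partial>lborel)"
    unfolding set_lebesgue_integral_def scaleR_sum_right ..
  also have "\<dots> = (\<Sum>b\<in>Basis. LINT x:{a..t}|lborel. (f x \<bullet> b) * (g x \<bullet> b))"
    unfolding set_lebesgue_integral_def
    by (rule Bochner_Integration.integral_sum) (rule int[unfolded set_integrable_def])
  also have "\<dots> = (\<Sum>b\<in>Basis. (f t \<bullet> b)\<^sup>2 / 2)"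
    by (simp only: i)
  also have "\<dots> = (norm (f t))\<^sup>2 / 2"
  proof -
    have "(norm (f t))\<^sup>2 = (\<Sum>b\<in>Basis. (f t \<bullet> b)\<^sup>2)"
      unfolding power2_norm_eq_inner by (subst euclidean_inner) (simp add: power2_eq_square)
    then show ?thesis by (simp add: sum_divide_distrib)
  qed
  finally show ?thesis .
qed

text \<open>The boundary term at infinity vanishes because the square of \<open>f\<close> is integrable.\<close>

lemma integral_primitive_inner_half_line:
  fixes g :: "real \<Rightarrow> 'a::euclidean_space"
  assumes meas: "f \<in> borel_measurable lborel" "g \<in> borel_measurable lborel"
    and f2: "set_integrable lborel {a..} (\<lambda>t. (norm (f t))\<^sup>2)"
    and g2: "set_integrable lborel {a..} (\<lambda>t. (norm (g t))\<^sup>2)"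
    and f: "\<And>x. a \<le> x \<Longrightarrow> f x = (LINT u:{a..x}|lborel. g u)"
  shows "(LINT x:{a..}|lborel. f x \<bullet> g x) = 0"
proof -
  define l where "l = (LINT x:{a..}|lborel. f x \<bullet> g x)"
  have int: "set_integrable lborel {a..} (\<lambda>x. f x \<bullet> g x)"
    by (rule set_integrable_inner_of_sq[OF meas _ f2 g2]) auto
  have sub: "set_integrable lborel {c..t} (\<lambda>t. (norm (F t))\<^sup>2)"
    if "set_integrable lborel {a..} (\<lambda>t. (norm (F t))\<^sup>2)" "a \<le> c" for F :: "real \<Rightarrow> 'a" and c t
    by (rule set_integrable_subset[OF that(1)]) (use that(2) in auto)
  have "((\<lambda>t. LINT x:{a..t}|lborel. f x \<bullet> g x) \<longlongrightarrow> l) at_top"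
    unfolding l_def by (rule tendsto_set_lebesgue_integral_at_top[OF _ int]) auto
  then have lim: "((\<lambda>t. (norm (f t))\<^sup>2 / 2) \<longlongrightarrow> l) at_top"
    by (rule Lim_transform_eventually)
      (use eventually_ge_at_top[of a] in \<open>eventually_elim,
        intro integral_primitive_inner[OF meas sub[OF f2] sub[OF g2] f], auto\<close>)
  have "0 \<le> l"
    by (rule tendsto_lowerbound[OF lim]) auto
  moreover have "\<not> 0 < l"
  proof
    assume "0 < l"
    then have "\<forall>\<^sub>F t in at_top. l / 2 < (norm (f t))\<^sup>2 / 2"
      using order_tendstoD(1)[OF lim, of "l / 2"] by simp
    from eventually_conj[OF this eventually_ge_at_top[of a]]
    obtain t0 where "\<And>t. t0 \<le> t \<Longrightarrow> l / 2 < (norm (f t))\<^sup>2 / 2 \<and> a \<le> t"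
      by (auto simp: eventually_at_top_linorder)
    then have t0: "a \<le> t0" "\<And>t. t0 \<le> t \<Longrightarrow> l \<le> (norm (f t))\<^sup>2" by force+
    define K where "K = (LINT x:{a..}|lborel. (norm (f x))\<^sup>2)"
    \<comment> \<open>The length is chosen so that l times n equals K + l, which exceeds the whole
      integral of |f|^2.\<close>
    define n where "n = K / l + 1"
    have "0 \<le> K" unfolding K_def set_lebesgue_integral_def by (rule Bochner_Integration.integral_nonneg) simp
    then have n: "0 < n" using \<open>0 < l\<close> by (simp add: n_def add_nonneg_pos)
    have "l * n = (LINT x:{t0..t0 + n}|lborel. l)"
      using n by (simp add: set_lebesgue_integral_def)
    also have "\<dots> \<le> (LINT x:{t0..t0 + n}|lborel. (norm (f x))\<^sup>2)"
      by (rule set_integral_mono[OF _ sub[OF f2 t0(1)]]) (use t0(2) n in \<open>auto simp: set_integrable_def emeasure_lborel_Icc_eq\<close>)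
    also have "\<dots> \<le> K"
      unfolding K_def set_lebesgue_integral_def
      by (rule integral_mono[OF sub[OF f2 t0(1), unfolded set_integrable_def] f2[unfolded set_integrable_def]])
        (use t0(1) in \<open>auto simp: indicator_def\<close>)
    also have "\<dots> < l * n" using \<open>0 < l\<close> by (simp add: n_def field_simps)
    finally show False by simp
  qed
  ultimately show ?thesis by (simp add: l_def)
qed

text \<open>Cauchy-Schwarz on an interval, obtained by expanding the nonnegative integral of (|g| -
  \<mu>)^2, where \<mu> is the mean of |g|.\<close>

lemma square_integral_le:
  fixes g :: "real \<Rightarrow> 'a::euclidean_space"
  assumes [measurable]: "g \<in> borel_measurable lborel"
    and g2: "set_integrable lborel {c..t} (\<lambda>t. (norm (g t))\<^sup>2)" and "c < t"
  shows "(norm (LINT u:{c..t}|lborel. g u))\<^sup>2 \<le> (t - c) * (LINT u:{c..t}|lborel. (norm (g u))\<^sup>2)"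
proof -
  have g: "set_integrable lborel {c..t} g"
    by (rule set_integrable_norm_of_sq[OF assms(1) g2]) (auto simp: emeasure_lborel_Icc_eq)
  have ng: "set_integrable lborel {c..t} (\<lambda>u. norm (g u))"
    by (rule set_integrable_norm[OF g])
  define I1 where "I1 = (LINT u:{c..t}|lborel. norm (g u))"
  define I2 where "I2 = (LINT u:{c..t}|lborel. (norm (g u))\<^sup>2)"
  define \<mu> where "\<mu> = I1 / (t - c)"
  have const: "set_integrable lborel {c..t} (\<lambda>_. k)" "(LINT u:{c..t}|lborel. k) = k * (t - c)" for k :: real
    using \<open>c < t\<close> by (simp_all add: set_integrable_def set_lebesgue_integral_def)
  have "0 \<le> (LINT u:{c..t}|lborel. (norm (g u) - \<mu>)\<^sup>2)"
    unfolding set_lebesgue_integral_def by (rule Bochner_Integration.integral_nonneg) simp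
  also have "\<dots> = (LINT u:{c..t}|lborel. ((norm (g u))\<^sup>2 - 2 * \<mu> * norm (g u)) + \<mu>\<^sup>2)"
    by (simp add: power2_diff algebra_simps)
  also have "\<dots> = I2 - 2 * \<mu> * I1 + \<mu>\<^sup>2 * (t - c)"
    using g2 ng const by (simp add: set_integral_add set_integral_diff I1_def I2_def del: diff_add_eq)
  also have "\<dots> = I2 - I1\<^sup>2 / (t - c)"
  proof -
    have "I2 - 2 * (I1 / k) * I1 + (I1 / k)\<^sup>2 * k = I2 - I1\<^sup>2 / k" if "k \<noteq> 0" for k
      using that by (simp add: power2_eq_square field_simps)
    then show ?thesis using \<open>c < t\<close> by (simp add: \<mu>_def)
  qed
  finally have "I1\<^sup>2 \<le> (t - c) * I2"
    using \<open>c < t\<close> by (simp add: field_simps)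
  moreover have "norm (LINT u:{c..t}|lborel. g u) \<le> I1"
    unfolding I1_def using integral_norm_bound[of lborel "\<lambda>x. indicator {c..t} x *\<^sub>R g x"]
    by (simp add: set_lebesgue_integral_def)
  then have "(norm (LINT u:{c..t}|lborel. g u))\<^sup>2 \<le> I1\<^sup>2"
    by (intro power_mono) auto
  ultimately show ?thesis by (simp add: I2_def)
qed

text \<open>As f vanishes at c, Cauchy-Schwarz bounds |f|^2 pointwise by (d-c) times the integral of
  |g|^2. One more integration over the cell gives the second factor.\<close>

lemma poincare_cell:
  fixes g :: "real \<Rightarrow> 'a::euclidean_space"
  assumes meas: "g \<in> borel_measurable lborel"
    and f2: "set_integrable lborel {c..d} (\<lambda>t. (norm (f t))\<^sup>2)"
    and g2: "set_integrable lborel {c..d} (\<lambda>t. (norm (g t))\<^sup>2)"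
    and f: "\<And>x. c \<le> x \<Longrightarrow> x \<le> d \<Longrightarrow> f x = (LINT u:{c..x}|lborel. g u)"
    and "c < d"
  shows "(LINT t:{c..d}|lborel. (norm (f t))\<^sup>2) \<le> (d - c)\<^sup>2 * (LINT t:{c..d}|lborel. (norm (g t))\<^sup>2)"
proof -
  define I where "I = (LINT t:{c..d}|lborel. (norm (g t))\<^sup>2)"
  have I: "0 \<le> I"
    unfolding I_def set_lebesgue_integral_def by (rule Bochner_Integration.integral_nonneg) simp
  have pt: "(norm (f x))\<^sup>2 \<le> (d - c) * I" if x: "x \<in> {c..d}" for x
  proof (cases "x = c")
    case True
    have "f c = 0" using f[of c] \<open>c < d\<close> by (simp add: set_integral_singleton)
    then show ?thesis using True I \<open>c < d\<close> by simp
  next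
    case False
    have g2': "set_integrable lborel {c..x} (\<lambda>t. (norm (g t))\<^sup>2)"
      by (rule set_integrable_subset[OF g2]) (use x in auto)
    have "(norm (f x))\<^sup>2 \<le> (x - c) * (LINT u:{c..x}|lborel. (norm (g u))\<^sup>2)"
      using square_integral_le[OF meas g2'] f[of x] x False by auto
    also have "\<dots> \<le> (d - c) * I"
    proof (intro mult_mono)
      show "(LINT u:{c..x}|lborel. (norm (g u))\<^sup>2) \<le> I"
        unfolding I_def set_lebesgue_integral_def
        by (rule integral_mono[OF g2'[unfolded set_integrable_def] g2[unfolded set_integrable_def]])
          (use x in \<open>auto simp: indicator_def\<close>)
      show "0 \<le> (LINT u:{c..x}|lborel. (norm (g u))\<^sup>2)"
        unfolding set_lebesgue_integral_def by (rule Bochner_Integration.integral_nonneg) simp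
    qed (use x in auto)
    finally show ?thesis .
  qed
  have "(LINT t:{c..d}|lborel. (norm (f t))\<^sup>2) \<le> (LINT t:{c..d}|lborel. (d - c) * I)"
    by (rule set_integral_mono[OF f2]) (use pt in \<open>auto simp: set_integrable_def emeasure_lborel_Icc_eq\<close>)
  also have "\<dots> = (d - c)\<^sup>2 * I"
    using \<open>c < d\<close> by (simp add: set_lebesgue_integral_def power2_eq_square)
  finally show ?thesis by (simp add: I_def)
qed

lemma set_integral_split:
  fixes f :: "real \<Rightarrow> 'a::euclidean_space"
  assumes "set_integrable lborel {a..c} f" "a \<le> b" "b \<le> c"
  shows "(LINT t:{a..c}|lborel. f t) = (LINT t:{a..b}|lborel. f t) + (LINT t:{b..c}|lborel. f t)"
proof -
  have "{a..c} = {a..b} \<union> {b..c}" using assms(2,3) by auto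
  moreover have "(LINT t:{a..b} \<union> {b..c}|lborel. f t) = (LINT t:{a..b}|lborel. f t) + (LINT t:{b..c}|lborel. f t)"
  proof (rule set_integral_Un_AE)
    show "AE x in lborel. \<not> (x \<in> {a..b} \<and> x \<in> {b..c})"
      using AE_lborel_singleton[of b] by eventually_elim auto
  qed (use assms(2-) in \<open>auto intro!: set_integrable_subset[OF assms(1)]\<close>)
  ultimately show ?thesis by simp
qed

lemma set_integral_split_half_line:
  fixes f :: "real \<Rightarrow> 'a::euclidean_space"
  assumes "set_integrable lborel {a..} f" "a \<le> b"
  shows "(LINT t:{a..}|lborel. f t) = (LINT t:{a..b}|lborel. f t) + (LINT t:{b..}|lborel. f t)"
proof -
  have "{a..} = {a..b} \<union> {b..}" using assms(2) by auto
  moreover have "(LINT t:{a..b} \<union> {b..}|lborel. f t) = (LINT t:{a..b}|lborel. f t) + (LINT t:{b..}|lborel. f t)"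
  proof (rule set_integral_Un_AE)
    show "AE x in lborel. \<not> (x \<in> {a..b} \<and> x \<in> {b..})"
      using AE_lborel_singleton[of b] by eventually_elim auto
  qed (use assms(2-) in \<open>auto intro!: set_integrable_subset[OF assms(1)]\<close>)
  ultimately show ?thesis by simp
qed

text \<open>Every cell starts at a zero of f, so the cell estimates add up and the constant depends
  on the mesh d alone, not on the length of the interval.\<close>

lemma poincare_grid:
  fixes g :: "real \<Rightarrow> 'a::euclidean_space"
  assumes meas: "g \<in> borel_measurable lborel"
    and f2: "set_integrable lborel {0..} (\<lambda>t. (norm (f t))\<^sup>2)"
    and g2: "set_integrable lborel {0..} (\<lambda>t. (norm (g t))\<^sup>2)"
    and f: "\<And>c x. 0 \<le> c \<Longrightarrow> c \<le> x \<Longrightarrow> f x = f c + (LINT u:{c..x}|lborel. g u)"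
    and "0 < d" and zero: "\<And>i. i \<le> k \<Longrightarrow> f (real i * d) = 0"
  shows "(LINT t:{0..real k * d}|lborel. (norm (f t))\<^sup>2) \<le> d\<^sup>2 * (LINT t:{0..real k * d}|lborel. (norm (g t))\<^sup>2)"
  using zero
proof (induction k)
  case 0
  show ?case by (simp add: set_integral_singleton)
next
  case (Suc k)
  have sub: "set_integrable lborel {a..b} F" if "set_integrable lborel {0..} F" "0 \<le> a" for a b and F :: "real \<Rightarrow> real"
    by (rule set_integrable_subset[OF that(1)]) (use that in auto)
  define c where "c = real k * d"
  have c: "0 \<le> c" "real (Suc k) * d = c + d" using \<open>0 < d\<close> by (auto simp: c_def algebra_simps)
  have fc: "f c = 0" using Suc.prems[of k] by (simp add: c_def)
  have "(LINT t:{c..c + d}|lborel. (norm (f t))\<^sup>2) \<le> (c + d - c)\<^sup>2 * (LINT t:{c..c + d}|lborel. (norm (g t))\<^sup>2)"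
    by (rule poincare_cell[OF meas sub[OF f2 c(1)] sub[OF g2 c(1)]]) (use f[OF c(1)] fc \<open>0 < d\<close> in auto)
  moreover have "(LINT t:{0..c}|lborel. (norm (f t))\<^sup>2) \<le> d\<^sup>2 * (LINT t:{0..c}|lborel. (norm (g t))\<^sup>2)"
    unfolding c_def using Suc.prems by (intro Suc.IH) auto
  moreover have "(LINT t:{0..c + d}|lborel. F t) = (LINT t:{0..c}|lborel. F t) + (LINT t:{c..c + d}|lborel. F t)"
    if "set_integrable lborel {0..} F" for F :: "real \<Rightarrow> real"
    by (rule set_integral_split[OF sub[OF that]]) (use c \<open>0 < d\<close> in auto)
  ultimately show ?case
    unfolding c(2) using f2 g2 by (simp add: algebra_simps)
qed

section \<open>Negative spectral subspaces\<close>

text \<open>Fewer equations than unknowns: Gaussian elimination by induction on the equations. If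
  equation k is not trivial, an unknown \<open>b0\<close> with nonzero coefficient is
  eliminated.\<close>

lemma homogeneous_system_solution:
  fixes l :: "'j \<Rightarrow> 'b \<Rightarrow> real"
  assumes "finite J" "finite B" "card J < card B"
  shows "\<exists>c. (\<forall>j\<in>J. (\<Sum>b\<in>B. c b * l j b) = 0) \<and> (\<exists>b\<in>B. c b \<noteq> 0)"
  using assms
proof (induction J arbitrary: B l rule: finite_induct)
  case empty
  then have "B \<noteq> {}" by auto
  then show ?case by (intro exI[of _ "\<lambda>_. 1"]) auto
next
  case (insert k J)
  show ?case
  proof (cases "\<forall>b\<in>B. l k b = 0")
    case True
    have "card J < card B" using insert by simp
    then show ?thesis using insert.IH[OF insert.prems(1), of l] True by auto
  next
    case False
    then obtain b0 where b0: "b0 \<in> B" "l k b0 \<noteq> 0" by blast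
    \<comment> \<open>The coefficients left after equation k has been solved for the unknown
      \<open>b0\<close>; \<open>z\<close> below is the value this solution assigns to it.\<close>
    define l' where "l' j b = l j b - l j b0 * l k b / l k b0" for j b
    have "card J < card (B - {b0})" using insert b0 by simp
    from insert.IH[OF _ this, of l'] insert.prems(1) obtain c b1 where
      c: "\<And>j. j \<in> J \<Longrightarrow> (\<Sum>b\<in>B - {b0}. c b * l' j b) = 0" and b1: "b1 \<in> B - {b0}" "c b1 \<noteq> 0"
      by auto
    define z where "z = - (\<Sum>b\<in>B - {b0}. c b * l k b) / l k b0"
    define c' where "c' = c(b0 := z)"
    have split: "(\<Sum>b\<in>B. c' b * l j b) = z * l j b0 + (\<Sum>b\<in>B - {b0}. c b * l j b)" for j
      using b0 insert.prems(1) by (subst sum.remove[of B b0]) (auto simp: c'_def intro!: sum.cong)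
    have "(\<Sum>b\<in>B. c' b * l j b) = 0" if "j \<in> insert k J" for j
    proof (cases "j = k")
      case True
      then show ?thesis using b0 by (simp add: split z_def)
    next
      case False
      then have "0 = (\<Sum>b\<in>B - {b0}. c b * l' j b)" using c that by simp
      also have "\<dots> = (\<Sum>b\<in>B - {b0}. c b * l j b - l j b0 / l k b0 * (c b * l k b))"
        by (intro sum.cong) (auto simp: l'_def algebra_simps)
      also have "\<dots> = (\<Sum>b\<in>B - {b0}. c b * l j b) - l j b0 / l k b0 * (\<Sum>b\<in>B - {b0}. c b * l k b)"
        by (simp add: sum_subtractf sum_distrib_left)
      finally show ?thesis by (simp add: split z_def mult.commute)
    qed
    moreover have "c' b1 \<noteq> 0" "b1 \<in> B" using b1 by (auto simp: c'_def)
    ultimately show ?thesis by blast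
  qed
qed

text \<open>Independent functions outnumbering the scalar conditions would admit a nontrivial
  combination that satisfies all conditions. It would vanish identically, contrary to
  independence.\<close>

lemma fun_dim_le:
  fixes V :: "('t \<Rightarrow> 'v::real_inner) set" and pts :: "('t \<times> 'v) set"
  assumes "finite pts"
    and closed: "\<And>B c. finite B \<Longrightarrow> B \<subseteq> V \<Longrightarrow> (\<lambda>t. \<Sum>b\<in>B. c b *\<^sub>R b t) \<in> V"
    and zero: "\<And>f. f \<in> V \<Longrightarrow> \<forall>(t, e)\<in>pts. f t \<bullet> e = 0 \<Longrightarrow> \<forall>t. f t = 0"
  shows "fun_dim V \<le> enat (card pts)"
  unfolding fun_dim_def
proof (rule Sup_least)
  fix x assume "x \<in> {enat (card B) |B. finite B \<and> B \<subseteq> V \<and> lin_indep_set B}"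
  then obtain B where x: "x = enat (card B)" and B: "finite B" "B \<subseteq> V" "lin_indep_set B" by blast
  have "card B \<le> card pts"
  proof (rule ccontr)
    assume "\<not> card B \<le> card pts"
    then obtain c where c: "\<forall>p\<in>pts. (\<Sum>b\<in>B. c b * (b (fst p) \<bullet> snd p)) = 0" "\<exists>b\<in>B. c b \<noteq> 0"
      using homogeneous_system_solution[OF assms(1) B(1), of "\<lambda>p b. b (fst p) \<bullet> snd p"] by auto
    have "\<forall>t. (\<Sum>b\<in>B. c b *\<^sub>R b t) = 0"
      by (rule zero[OF closed[OF B(1,2)]]) (use c(1) in \<open>auto simp: inner_sum_left\<close>)
    then have "\<forall>b\<in>B. c b = 0" using B(3) by (simp add: lin_indep_set_def)
    with c(2) show False by blast
  qed
  then show "x \<le> enat (card pts)" by (simp add: x)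
qed

locale spectral_resolution =
  fixes H :: "('t \<Rightarrow> 'v::real_vector) set" and ip A E
  assumes spec: "is_spectral_measure H ip A E"
    and ip_nonneg: "\<And>f. f \<in> H \<Longrightarrow> 0 \<le> ip f f"
begin

context
  fixes f assumes f: "f \<in> H"
begin

lemma E_mem: "S \<in> sets borel \<Longrightarrow> E S f \<in> H"
  using spec f by (auto simp: is_spectral_measure_def orth_projection_def bounded_selfadjoint_def)

text \<open>For a selfadjoint idempotent this number is the square of the norm of
  \<open>E S f\<close>.\<close>

lemma ip_E_nonneg:
  assumes S: "S \<in> sets borel"
  shows "0 \<le> ip (E S f) f"
proof -
  have "E S (E S f) = E S f" and "ip (E S (E S f)) f = ip (E S f) (E S f)"
    using spec f S E_mem[OF S] by (auto simp: is_spectral_measure_def orth_projection_def bounded_selfadjoint_def)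
  then show ?thesis using ip_nonneg[OF E_mem[OF S]] by simp
qed

lemma E_sums:
  fixes S :: "nat \<Rightarrow> real set"
  assumes "range S \<subseteq> sets borel" "disjoint_family S"
  shows "(\<lambda>k. ip (E (S k) f) f) sums ip (E (\<Union>k. S k) f) f"
  using spec f assms unfolding is_spectral_measure_def by blast

text \<open>Countable additivity for a sequence of empty sets makes a constant series converge,
  which forces the constant to be 0.\<close>

lemma ip_E_empty: "ip (E {} f) f = 0"
proof -
  have "(\<lambda>k::nat. ip (E {} f) f) sums ip (E {} f) f"
    using E_sums[of "\<lambda>_. {}"] by (simp add: disjoint_family_on_def)
  from sums_summable[OF this] have "(\<lambda>k::nat. ip (E {} f) f) \<longlonglongrightarrow> 0"
    by (rule summable_LIMSEQ_zero)
  then show ?thesis by (simp add: LIMSEQ_const_iff)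
qed

text \<open>\<open>measure_of\<close> returns the null measure unless the set function is positive
  and countably additive, so both are checked before a value can be read off.\<close>

lemma emeasure_scalar_measure:
  assumes "S \<in> sets borel"
  shows "emeasure (scalar_measure ip E f) S = ennreal (ip (E S f) f)"
  unfolding scalar_measure_def
proof (rule emeasure_measure_of_sigma)
  show "sigma_algebra UNIV (sets (borel :: real measure))"
    using sets.sigma_algebra_axioms[of "borel :: real measure"] by simp
  show "positive (sets borel) (\<lambda>S. ennreal (ip (E S f) f))"
    by (simp add: positive_def ip_E_empty)
  show "countably_additive (sets borel) (\<lambda>S. ennreal (ip (E S f) f))"
    unfolding countably_additive_def
  proof (intro allI impI)
    fix S :: "nat \<Rightarrow> real set"
    assume S: "range S \<subseteq> sets borel" "disjoint_family S"
    have "0 \<le> ip (E (S k) f) f" for k using S(1) by (intro ip_E_nonneg) auto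
    then show "(\<Sum>k. ennreal (ip (E (S k) f) f)) = ennreal (ip (E (\<Union>k. S k) f) f)"
      by (rule suminf_ennreal_eq[OF _ E_sums[OF S]])
  qed
qed (rule assms)

lemma sets_scalar_measure: "sets (scalar_measure ip E f) = sets borel"
  and space_scalar_measure: "space (scalar_measure ip E f) = UNIV"
  using sets.sigma_sets_eq[of "borel :: real measure"]
  by (simp_all add: scalar_measure_def sets_measure_of_conv space_measure_of_conv)

text \<open>The scalar measure of f gives no mass to {0..}. The integral of x is therefore negative
  unless the measure is null, and its total mass is \<open>ip f f\<close>.\<close>

lemma negative_spectral_subspace:
  assumes Ef: "E {..<0} f = f" and "0 \<le> ip (A f) f"
  shows "ip f f = 0"
proof -
  let ?\<mu> = "scalar_measure ip E f"
  have int: "integrable ?\<mu> (\<lambda>x. x)" and Af: "ip (A f) f = (\<integral>x. x \<partial>?\<mu>)"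
    using spec f by (auto simp: is_spectral_measure_def)
  have "E ({0..} \<inter> {..<0}) f = E {0..} (E {..<0} f)"
    using spec f unfolding is_spectral_measure_def by (metis atLeast_borel lessThan_borel)
  moreover have "{0..} \<inter> {..<0 :: real} = {}" by auto
  ultimately have "emeasure ?\<mu> {0..} = 0"
    using Ef ip_E_empty by (simp add: emeasure_scalar_measure)
  then have "AE x in ?\<mu>. x \<notin> {0..}"
    by (intro AE_not_in) (simp add: null_sets_def sets_scalar_measure)
  then have neg: "AE x in ?\<mu>. x < 0" by eventually_elim auto
  have "(\<integral>x. - x \<partial>?\<mu>) = - ip (A f) f" using int by (simp add: Af)
  moreover have "AE x in ?\<mu>. 0 \<le> - x" using neg by eventually_elim simp
  then have "0 \<le> (\<integral>x. - x \<partial>?\<mu>)" by (rule integral_nonneg_AE)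
  ultimately have "(\<integral>x. - x \<partial>?\<mu>) = 0" using assms(2) by simp
  then have "AE x in ?\<mu>. - x = 0"
    using integral_nonneg_eq_0_iff_AE[of ?\<mu> "\<lambda>x. - x"] int \<open>AE x in ?\<mu>. 0 \<le> - x\<close> by simp
  with neg have "AE x in ?\<mu>. False" by eventually_elim simp
  then have "emeasure ?\<mu> (space ?\<mu>) = 0" 
    by (subst (asm) AE_iff_null) (auto simp: null_sets_def)
  then have "ennreal (ip (E UNIV f) f) = 0"
    by (simp add: space_scalar_measure emeasure_scalar_measure)
  moreover have "E UNIV f = f" using spec f by (simp add: is_spectral_measure_def)
  ultimately show ?thesis using ip_nonneg[OF f] by (simp add: ennreal_eq_0_iff)
qed

end

lemma E_range:
  assumes "f \<in> E {..<0} ` H"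
  shows "f \<in> H" "E {..<0} f = f"
  using spec assms by (auto simp: is_spectral_measure_def orth_projection_def bounded_selfadjoint_def)

text \<open>The range of the projection is its set of fixed points, which is closed under linear
  combinations because the projection is linear.\<close>

lemma E_range_sum:
  assumes H: "(\<lambda>_. 0) \<in> H" "\<And>f g. f \<in> H \<Longrightarrow> g \<in> H \<Longrightarrow> (\<lambda>t. f t + g t) \<in> H"
    "\<And>f c. f \<in> H \<Longrightarrow> (\<lambda>t. c *\<^sub>R f t) \<in> H"
    and "finite B" "B \<subseteq> E {..<0} ` H"
  shows "(\<lambda>t. \<Sum>b\<in>B. c b *\<^sub>R b t) \<in> E {..<0} ` H"
proof -
  have bs: "bounded_selfadjoint H ip (E {..<0})"
    using spec by (auto simp: is_spectral_measure_def orth_projection_def)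
  have add: "E {..<0} (\<lambda>t. f t + g t) = (\<lambda>t. E {..<0} f t + E {..<0} g t)" if "f \<in> H" "g \<in> H" for f g
    using bs that by (simp add: bounded_selfadjoint_def)
  have scale: "E {..<0} (\<lambda>t. c *\<^sub>R f t) = (\<lambda>t. c *\<^sub>R E {..<0} f t)" if "f \<in> H" for f c
    using bs that by (simp add: bounded_selfadjoint_def)
  have "(\<lambda>t. \<Sum>b\<in>B. c b *\<^sub>R b t) \<in> H \<and>
      E {..<0} (\<lambda>t. \<Sum>b\<in>B. c b *\<^sub>R b t) = (\<lambda>t. \<Sum>b\<in>B. c b *\<^sub>R b t)"
    using assms(4,5)
  proof (induction B rule: finite_induct)
    case empty
    show ?case using scale[OF H(1), of 0] H(1) by simp
  next
    case (insert x B)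
    have x: "x \<in> H" "E {..<0} x = x" using E_range[of x] insert.prems by auto
    have "(\<lambda>t. c x *\<^sub>R x t) \<in> H" "E {..<0} (\<lambda>t. c x *\<^sub>R x t) = (\<lambda>t. c x *\<^sub>R x t)"
      using H(3)[OF x(1)] scale[OF x(1)] x(2) by auto
    moreover have "(\<lambda>t. \<Sum>b\<in>B. c b *\<^sub>R b t) \<in> H"
      "E {..<0} (\<lambda>t. \<Sum>b\<in>B. c b *\<^sub>R b t) = (\<lambda>t. \<Sum>b\<in>B. c b *\<^sub>R b t)"
      using insert by auto
    ultimately show ?case
      using insert.hyps H(2) add by simp
  qed
  then have 1: "(\<lambda>t. \<Sum>b\<in>B. c b *\<^sub>R b t) \<in> H"
    and 2: "E {..<0} (\<lambda>t. \<Sum>b\<in>B. c b *\<^sub>R b t) = (\<lambda>t. \<Sum>b\<in>B. c b *\<^sub>R b t)"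
    by (rule conjunct1, rule conjunct2)
  show ?thesis using imageI[OF 1, of "E {..<0}"] unfolding 2 .
qed

end

section \<open>The Sobolev space as a space of functions\<close>

context
  fixes m :: "'n::finite \<Rightarrow> real"
  assumes m: "\<forall>i. 0 < m i"
begin

lemma borel_measurable_norm_M [measurable]:
  fixes f :: "real \<Rightarrow> real^'d^'n"
  assumes [measurable]: "f \<in> borel_measurable M"
  shows "(\<lambda>t. norm_M m (f t)) \<in> borel_measurable M"
  by (rule borel_measurable_continuous_on[OF _ assms]) (intro continuous_on_norm_M continuous_on_id)

lemma norm_M_add_sq_le: "(norm_M m (u + v))\<^sup>2 \<le> 2 * (norm_M m u)\<^sup>2 + 2 * (norm_M m v)\<^sup>2"
proof -
  have "0 \<le> (norm_M m (u - v))\<^sup>2" by simp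
  then show ?thesis
    by (simp add: norm_M_sq[OF m] inner_M_bilinear_simps inner_M_commute[of m v u])
qed

lemma L2_add:
  fixes f g :: "real \<Rightarrow> real^'d^'n"
  assumes "f \<in> L2_space m" "g \<in> L2_space m"
  shows "(\<lambda>t. f t + g t) \<in> L2_space m"
proof -
  have [measurable]: "f \<in> borel_measurable lborel" "g \<in> borel_measurable lborel"
    using assms by (auto simp: L2_space_def)
  have "set_integrable lborel {0..} (\<lambda>t. (norm_M m (f t + g t))\<^sup>2)"
  proof (rule set_integrable_bound)
    show "set_integrable lborel {0..} (\<lambda>t. 2 * (norm_M m (f t))\<^sup>2 + 2 * (norm_M m (g t))\<^sup>2)"
      using assms by (intro set_integral_add set_integrable_mult_right) (auto simp: L2_space_def)
    show "AE x in lborel. x \<in> {0..} \<longrightarrow> norm ((norm_M m (f x + g x))\<^sup>2) \<le>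
        norm (2 * (norm_M m (f x))\<^sup>2 + 2 * (norm_M m (g x))\<^sup>2)"
      using norm_M_add_sq_le by (auto simp: abs_of_nonneg)
  qed (simp add: set_borel_measurable_def)
  then show ?thesis
    using assms by (auto simp: L2_space_def subspace_add[OF subspace_Xspace])
qed

lemma L2_scale:
  fixes f :: "real \<Rightarrow> real^'d^'n"
  assumes "f \<in> L2_space m"
  shows "(\<lambda>t. c *\<^sub>R f t) \<in> L2_space m"
proof -
  have [measurable]: "f \<in> borel_measurable lborel" using assms by (auto simp: L2_space_def)
  have "set_integrable lborel {0..} (\<lambda>t. c\<^sup>2 * (norm_M m (f t))\<^sup>2)"
    using assms by (intro set_integrable_mult_right) (auto simp: L2_space_def)
  then show ?thesis
    using assms
    by (auto simp: L2_space_def norm_M_scaleR[OF m] power_mult_distrib subspace_scale[OF subspace_Xspace])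
qed

lemma L2_set_integrable:
  fixes f :: "real \<Rightarrow> real^'d^'n"
  assumes "f \<in> L2_space m" "0 \<le> a"
  shows "set_integrable lborel {a..t} f"
proof -
  have f[measurable]: "f \<in> borel_measurable lborel" using assms by (auto simp: L2_space_def)
  obtain k where k: "0 < k" "\<And>u :: real^'d^'n. k * norm u \<le> norm_M m u"
    using norm_M_bounds[OF m] by metis
  have "set_integrable lborel {a..t} (\<lambda>t. (norm (f t))\<^sup>2)"
  proof (rule set_integrable_bound)
    show "set_integrable lborel {a..t} (\<lambda>t. (1 / k\<^sup>2) * (norm_M m (f t))\<^sup>2)"
      by (intro set_integrable_mult_right)
        (rule set_integrable_subset[of _ "{0..}"], use assms in \<open>auto simp: L2_space_def\<close>)
    have "(norm u)\<^sup>2 \<le> (1 / k\<^sup>2) * (norm_M m u)\<^sup>2" for u :: "real^'d^'n"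
      using power_mono[OF k(2)[of u], of 2] k(1) by (simp add: power_mult_distrib field_simps)
    then show "AE x in lborel. x \<in> {a..t} \<longrightarrow> norm ((norm (f x))\<^sup>2) \<le> norm (1 / k\<^sup>2 * (norm_M m (f x))\<^sup>2)"
      by (auto simp: abs_mult)
  qed (simp add: set_borel_measurable_def)
  then show ?thesis by (intro set_integrable_norm_of_sq[OF f]) (auto simp: emeasure_lborel_Icc_eq)
qed

lemma weak_deriv_add:
  fixes \<eta> \<xi> :: "real \<Rightarrow> real^'d^'n"
  assumes "is_weak_deriv m \<eta> g" "is_weak_deriv m \<xi> k"
  shows "is_weak_deriv m (\<lambda>t. \<eta> t + \<xi> t) (\<lambda>t. g t + k t)"
proof -
  have L2: "g \<in> L2_space m" "k \<in> L2_space m" using assms by (auto simp: is_weak_deriv_def)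
  have add: "(LINT u:{0..t}|lborel. g u + k u) = (LINT u:{0..t}|lborel. g u) + (LINT u:{0..t}|lborel. k u)" for t
    by (intro set_integral_add L2_set_integrable L2) auto
  have 1: "\<eta> t = \<eta> 0 + (LINT u:{0..t}|lborel. g u)" and 2: "\<xi> t = \<xi> 0 + (LINT u:{0..t}|lborel. k u)"
    if "0 \<le> t" for t
    using assms that unfolding is_weak_deriv_def by blast+
  have "\<eta> t + \<xi> t = (\<eta> 0 + \<xi> 0) + (LINT u:{0..t}|lborel. g u + k u)" if "0 \<le> t" for t
    unfolding add by (rule trans[OF arg_cong2[where f = "(+)", OF 1[OF that] 2[OF that]]]) (simp only: add_ac)
  then show ?thesis
    using L2_add[OF L2] unfolding is_weak_deriv_def by blast
qed

lemma weak_deriv_scale: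
  fixes \<eta> :: "real \<Rightarrow> real^'d^'n"
  assumes "is_weak_deriv m \<eta> g"
  shows "is_weak_deriv m (\<lambda>t. c *\<^sub>R \<eta> t) (\<lambda>t. c *\<^sub>R g t)"
proof -
  have L2: "g \<in> L2_space m" and eq: "\<And>t. 0 \<le> t \<Longrightarrow> \<eta> t = \<eta> 0 + (LINT u:{0..t}|lborel. g u)"
    using assms unfolding is_weak_deriv_def by blast+
  have "c *\<^sub>R \<eta> t = c *\<^sub>R \<eta> 0 + (LINT u:{0..t}|lborel. c *\<^sub>R g u)" if "0 \<le> t" for t
    by (subst eq[OF that]) (simp add: scaleR_add_right)
  then show ?thesis using L2_scale[OF L2] unfolding is_weak_deriv_def by blast
qed

lemma W12_0_zero: "(\<lambda>_. 0) \<in> W12_0 m"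
proof -
  have "(\<lambda>_. 0) \<in> L2_space m"
    using subspace_0[OF subspace_Xspace] norm_M_eq_0_iff[OF m]
    by (auto simp: L2_space_def set_integrable_def)
  then show ?thesis by (auto simp: W12_0_def is_weak_deriv_def intro!: exI[of _ "\<lambda>_. 0"])
qed

lemma W12_0_add: "\<eta> \<in> W12_0 m \<Longrightarrow> \<xi> \<in> W12_0 m \<Longrightarrow> (\<lambda>t. \<eta> t + \<xi> t) \<in> W12_0 m"
  unfolding W12_0_def by (auto intro: L2_add weak_deriv_add)

lemma W12_0_scale: "\<eta> \<in> W12_0 m \<Longrightarrow> (\<lambda>t. c *\<^sub>R \<eta> t) \<in> W12_0 m"
  unfolding W12_0_def by (auto intro: L2_scale weak_deriv_scale)

lemma weak_deriv: "\<eta> \<in> W12_0 m \<Longrightarrow> is_weak_deriv m \<eta> (weak_deriv m \<eta>)"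
  using someI_ex[of "is_weak_deriv m \<eta>"] by (simp add: W12_0_def weak_deriv_def)

lemma inner_W12_nonneg: "0 \<le> inner_W12 m \<eta> \<eta>"
  unfolding inner_W12_def set_lebesgue_integral_def
  by (rule Bochner_Integration.integral_nonneg) (simp add: inner_M_self_nonneg[OF m])

text \<open>The weak derivative vanishes almost everywhere and \<eta> is its primitive from 0, so
  \<eta> vanishes at every point. \<open>fun_dim\<close> counts functions and not classes, hence the
  pointwise form.\<close>

lemma inner_W12_eq_0:
  fixes \<eta> :: "real \<Rightarrow> real^'d^'n"
  assumes \<eta>: "\<eta> \<in> W12_0 m" and "inner_W12 m \<eta> \<eta> = 0"
  shows "\<eta> t = 0"
proof (cases "t \<le> 0")
  case True
  then show ?thesis using \<eta> by (simp add: W12_0_def)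
next
  case False
  define g where "g = weak_deriv m \<eta>"
  have "0 \<le> t" using False by simp
  then have g: "g \<in> L2_space m" and eq: "\<eta> t = \<eta> 0 + (LINT u:{0..t}|lborel. g u)"
    using weak_deriv[OF \<eta>] unfolding is_weak_deriv_def g_def by blast+
  have \<eta>': "\<eta> \<in> L2_space m" "\<eta> 0 = 0" using \<eta> by (auto simp: W12_0_def)
  define F where "F t = indicator {0..} t * (inner_M m (g t) (g t) + inner_M m (\<eta> t) (\<eta> t))" for t :: real
  have "integrable lborel F"
    using set_integral_add(1)[of lborel "{0..}" "\<lambda>t. (norm_M m (g t))\<^sup>2" "\<lambda>t. (norm_M m (\<eta> t))\<^sup>2"] g \<eta>'
    by (simp add: L2_space_def F_def[abs_def] set_integrable_def norm_M_sq[OF m])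
  moreover have "0 \<le> F t" for t
    by (simp add: F_def inner_M_self_nonneg[OF m])
  moreover have "integral\<^sup>L lborel F = 0"
    using assms(2) by (simp add: inner_W12_def set_lebesgue_integral_def F_def[abs_def] g_def)
  ultimately have "AE t in lborel. F t = 0"
    using integral_nonneg_eq_0_iff_AE[of lborel F] by simp
  then have "AE u in lborel. indicator {0..t} u *\<^sub>R g u = 0"
  proof eventually_elim
    case (elim u)
    show ?case
    proof (cases "u \<in> {0..t}")
      case True
      then have "inner_M m (g u) (g u) = 0"
        using elim inner_M_self_nonneg[OF m, of "g u"] inner_M_self_nonneg[OF m, of "\<eta> u"]
        by (simp add: F_def)
      then show ?thesis by (simp add: inner_M_self_eq_0_iff[OF m])
    qed simp
  qed
  then have "(LINT u:{0..t}|lborel. g u) = 0"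
    unfolding set_lebesgue_integral_def by (rule integral_eq_zero_AE)
  then show ?thesis using eq \<eta>'(2) by simp
qed

end

section \<open>Positivity of the quadratic form\<close>

text \<open>Homogeneity reduces the estimate to unit vectors, where compactness of K times the
  sphere applies.\<close>

lemma quadratic_bound:
  fixes G :: "'p::metric_space \<Rightarrow> 'z::euclidean_space \<Rightarrow> real"
  assumes "compact K" and cont: "continuous_on (K \<times> UNIV) (\<lambda>x. G (fst x) (snd x))"
    and hom: "\<And>p c z. G p (c *\<^sub>R z) = c\<^sup>2 * G p z"
  shows "\<exists>C\<ge>0. \<forall>p\<in>K. \<forall>z. \<bar>G p z\<bar> \<le> C * (norm z)\<^sup>2"
proof -
  have "compact ((\<lambda>x. G (fst x) (snd x)) ` (K \<times> sphere 0 1))"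
    by (intro compact_continuous_image continuous_on_subset[OF cont] compact_Times assms(1) compact_sphere) auto
  then have "bounded ((\<lambda>x. G (fst x) (snd x)) ` (K \<times> sphere 0 1))" by (rule compact_imp_bounded)
  then obtain C where C: "\<forall>x\<in>(\<lambda>x. G (fst x) (snd x)) ` (K \<times> sphere 0 1). norm x \<le> C"
    unfolding bounded_iff by blast
  have "\<bar>G p z\<bar> \<le> \<bar>C\<bar> * (norm z)\<^sup>2" if "p \<in> K" for p z
  proof (cases "z = 0")
    case True
    then show ?thesis using hom[of p 0 0] by simp
  next
    case False
    define e where "e = z /\<^sub>R norm z"
    have "(p, e) \<in> K \<times> sphere 0 1" using that False by (simp add: e_def)
    then have "\<bar>G p e\<bar> \<le> C" using C by fastforce
    moreover have "G p z = (norm z)\<^sup>2 * G p e" using hom[of p "norm z" e] False by (simp add: e_def)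
    ultimately show ?thesis by (simp add: abs_mult mult.commute mult_right_mono)
  qed
  then show ?thesis by (intro exI[of _ "\<bar>C\<bar>"]) auto
qed

text \<open>Uniform continuity on a small ball times the unit sphere controls the forms on unit
  vectors. Homogeneity makes the error relative to |z|^2, uniformly in z.\<close>

lemma quadratic_perturbation:
  fixes G :: "'p::euclidean_space \<Rightarrow> 'z::euclidean_space \<Rightarrow> real"
  assumes "open S" "p\<^sub>0 \<in> S" and cont: "continuous_on (S \<times> UNIV) (\<lambda>x. G (fst x) (snd x))"
    and hom: "\<And>p c z. G p (c *\<^sub>R z) = c\<^sup>2 * G p z" and "0 < \<epsilon>"
  shows "\<exists>\<delta>>0. \<forall>p z. dist p p\<^sub>0 < \<delta> \<longrightarrow> \<bar>G p z - G p\<^sub>0 z\<bar> \<le> \<epsilon> * (norm z)\<^sup>2"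
proof -
  obtain r where r: "0 < r" "cball p\<^sub>0 r \<subseteq> S"
    using open_contains_cball[THEN iffD1, OF assms(1)] assms(2) by blast
  have "uniformly_continuous_on (cball p\<^sub>0 r \<times> sphere 0 1) (\<lambda>x. G (fst x) (snd x))"
    by (intro compact_uniformly_continuous continuous_on_subset[OF cont] compact_Times compact_cball compact_sphere)
      (use r in auto)
  then obtain d where d: "0 < d" "\<And>x x'. x \<in> cball p\<^sub>0 r \<times> sphere 0 1 \<Longrightarrow> x' \<in> cball p\<^sub>0 r \<times> sphere 0 1 \<Longrightarrow>
      dist x' x < d \<Longrightarrow> dist (G (fst x') (snd x')) (G (fst x) (snd x)) < \<epsilon>"
    unfolding uniformly_continuous_on_def using \<open>0 < \<epsilon>\<close> by meson
  have "\<bar>G p z - G p\<^sub>0 z\<bar> \<le> \<epsilon> * (norm z)\<^sup>2" if p: "dist p p\<^sub>0 < min r d" for p z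
  proof (cases "z = 0")
    case True
    then show ?thesis using hom[of p 0 0] hom[of p\<^sub>0 0 0] by simp
  next
    case False
    define e where "e = z /\<^sub>R norm z"
    have "norm e = 1" using False by (simp add: e_def)
    then have "dist (G p e) (G p\<^sub>0 e) < \<epsilon>"
      using d(2)[of "(p\<^sub>0, e)" "(p, e)"] p r(1) by (simp add: dist_Pair_Pair dist_commute)
    then have "\<bar>G p e - G p\<^sub>0 e\<bar> * (norm z)\<^sup>2 \<le> \<epsilon> * (norm z)\<^sup>2"
      by (intro mult_right_mono) (auto simp: dist_real_def)
    moreover have "G q z = (norm z)\<^sup>2 * G q e" for q using hom[of q "norm z" e] False by (simp add: e_def)
    then have "G p z - G p\<^sub>0 z = (G p e - G p\<^sub>0 e) * (norm z)\<^sup>2"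
      by (simp add: algebra_simps)
    then have "\<bar>G p z - G p\<^sub>0 z\<bar> = \<bar>G p e - G p\<^sub>0 e\<bar> * (norm z)\<^sup>2"
      by (simp add: abs_mult)
    ultimately show ?thesis by simp
  qed
  then show ?thesis by (intro exI[of _ "min r d"]) (use r d in auto)
qed

lemma W_hess_quadratic:
  assumes m: "\<forall>i. 0 < m i" and n: "2 \<le> CARD('n)" and x: "(x :: real^'d^'n) \<in> collision_free"
  shows "W_hess m \<alpha> b x (c *\<^sub>R u) (c *\<^sub>R u) = c\<^sup>2 * W_hess m \<alpha> b x u u"
proof -
  have "(c *\<^sub>R u) $ i - (c *\<^sub>R u) $ j = c *\<^sub>R (u $ i - u $ j)" for i j
    by (simp add: scaleR_diff_right)
  then have p: "potential' m \<alpha> x (c *\<^sub>R u) = c * potential' m \<alpha> x u"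
    "potential'' m \<alpha> x (c *\<^sub>R u) (c *\<^sub>R u) = c\<^sup>2 * potential'' m \<alpha> x u u"
    by (simp_all add: potential'_def potential''_def sum_distrib_left power2_eq_square algebra_simps)
  show ?thesis
    by (simp add: W_hess_def weighted_potential''_def norm_M_powr'_def norm_M_powr''_def p
      inner_M_bilinear_simps power2_eq_square algebra_simps)
qed

context asymptotic_orbit
begin

abbreviation "c \<equiv> c_coef \<alpha>"
abbreviation "\<beta> \<equiv> beta_exp \<alpha>"
abbreviation "e \<tau> \<equiv> h * \<rho> \<tau> powr (\<beta> - 2)"
abbreviation "\<delta>\<^sub>0 \<equiv> delta_bar m \<alpha> T s\<^sub>0"

text \<open>The coefficient forms depend on the orbit only through \<open>s\<close>, \<open>s'\<close>, \<open>\<rho>'/\<rho>\<close> and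
  \<open>h \<rho>\<^bsup>\<beta>-2\<^esup>\<close>; here these are free parameters \<open>x\<close>, \<open>\<sigma>\<close>, \<open>\<kappa>\<close> and \<open>\<epsilon>\<close>.\<close>

definition P_form :: "real^'d^'n \<Rightarrow> real^'d^'n \<Rightarrow> real" where
  "P_form x \<xi> = c * (inner_M m x \<xi>)\<^sup>2 + inner_M m \<xi> \<xi>"

definition Q_form :: "real^'d^'n \<Rightarrow> real^'d^'n \<Rightarrow> real \<Rightarrow> real^'d^'n \<Rightarrow> real^'d^'n \<Rightarrow> real" where
  "Q_form x \<sigma> \<kappa> \<eta> \<xi> = c * \<kappa> * (inner_M m \<eta> \<xi> - inner_M m x \<eta> * inner_M m x \<xi>)
     + c * (inner_M m \<sigma> \<eta> * inner_M m x \<xi>)"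

definition R_form :: "real^'d^'n \<Rightarrow> real^'d^'n \<Rightarrow> real \<Rightarrow> real \<Rightarrow> real^'d^'n \<Rightarrow> real" where
  "R_form x \<sigma> \<kappa> \<epsilon> \<eta> = (c * \<kappa>\<^sup>2 + \<beta> * (\<beta> - 2) * \<epsilon>) * (inner_M m x \<eta>)\<^sup>2
     + (2 * b - c * \<kappa>\<^sup>2 + \<beta> * \<epsilon>) * inner_M m \<eta> \<eta> + c * (inner_M m \<sigma> \<eta>)\<^sup>2
     - 2 * c * \<kappa> * (inner_M m x \<eta> * inner_M m \<sigma> \<eta>) + W_hess m \<alpha> b x \<eta> \<eta>"

definition index_form where
  "index_form x \<sigma> \<kappa> \<epsilon> \<eta> \<xi> = P_form x \<xi> + 2 * Q_form x \<sigma> \<kappa> \<eta> \<xi> + R_form x \<sigma> \<kappa> \<epsilon> \<eta>"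

lemma continuous_on_Q_form:
  assumes "continuous_on A f1" "continuous_on A f2" "continuous_on A f3" "continuous_on A f4" "continuous_on A f5"
  shows "continuous_on A (\<lambda>p. Q_form (f1 p) (f2 p) (f3 p) (f4 p) (f5 p))"
  unfolding Q_form_def
  by (intro continuous_on_add continuous_on_diff continuous_on_mult continuous_on_const continuous_on_inner_M assms)

lemma continuous_on_R_form:
  assumes "continuous_on A f1" "continuous_on A f2" "continuous_on A f3" "continuous_on A f4" "continuous_on A f5"
    "f1 ` A \<subseteq> collision_free"
  shows "continuous_on A (\<lambda>p. R_form (f1 p) (f2 p) (f3 p) (f4 p) (f5 p))"
  unfolding R_form_def
  by (intro continuous_on_add continuous_on_diff continuous_on_mult continuous_on_const continuous_on_inner_M
      continuous_on_power continuous_on_W_hess[OF m n] assms)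

lemma continuous_on_index_form:
  assumes "continuous_on A f1" "continuous_on A f2" "continuous_on A f3" "continuous_on A f4" "continuous_on A f5"
    "continuous_on A f6" "f1 ` A \<subseteq> collision_free"
  shows "continuous_on A (\<lambda>p. index_form (f1 p) (f2 p) (f3 p) (f4 p) (f5 p) (f6 p))"
  unfolding index_form_def P_form_def
  by (intro continuous_on_add continuous_on_mult continuous_on_const continuous_on_inner_M continuous_on_power
      continuous_on_Q_form continuous_on_R_form assms)

lemma Q_form_scaleR: "Q_form x \<sigma> \<kappa> (j *\<^sub>R \<eta>) (l *\<^sub>R \<xi>) = j * l * Q_form x \<sigma> \<kappa> \<eta> \<xi>"
  by (simp add: Q_form_def inner_M_bilinear_simps algebra_simps)

lemma R_form_scaleR:
  assumes "x \<in> collision_free"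
  shows "R_form x \<sigma> \<kappa> \<epsilon> (j *\<^sub>R \<eta>) = j\<^sup>2 * R_form x \<sigma> \<kappa> \<epsilon> \<eta>"
  unfolding R_form_def W_hess_quadratic[OF m n assms]
  by (simp add: inner_M_bilinear_simps power2_eq_square algebra_simps)

lemma index_form_scaleR:
  assumes "x \<in> collision_free"
  shows "index_form x \<sigma> \<kappa> \<epsilon> (j *\<^sub>R \<eta>) (j *\<^sub>R \<xi>) = j\<^sup>2 * index_form x \<sigma> \<kappa> \<epsilon> \<eta> \<xi>"
  unfolding index_form_def R_form_scaleR[OF assms] Q_form_scaleR P_form_def
  by (simp add: inner_M_bilinear_simps power2_eq_square algebra_simps)

lemma c_nonneg: "0 \<le> c"
proof -
  have "1 \<le> (4 / (2 - \<alpha>))\<^sup>2" using \<alpha> by (intro one_le_power) (simp add: field_simps)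
  then show ?thesis by (simp add: c_coef_def)
qed

lemma P_form_ge: "inner_M m \<xi> \<xi> \<le> P_form x \<xi>"
  using c_nonneg by (simp add: P_form_def)

abbreviation integrand where
  "integrand \<tau> \<eta> \<xi> \<equiv> inner_M m (P_coef m \<alpha> T \<gamma> \<tau> \<xi>) \<xi>
     + inner_M m (Q_coef m \<alpha> T \<gamma> \<tau> \<eta>) \<xi>
     + inner_M m (adjoint_M m (Q_coef m \<alpha> T \<gamma> \<tau>) \<xi>) \<eta>
     + inner_M m (R_tilde m \<alpha> T s\<^sub>0 \<gamma> h \<tau> \<eta>) \<eta>"

text \<open>The terms with Q and with its adjoint contribute equally, which explains the factor 2 in
  \<open>index_form\<close>. Membership of \<eta> in \<open>Xspace m\<close> is what lets the Riesz
  representatives behind the adjoint and the Hessian be evaluated.\<close>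

lemma integrand_eq:
  assumes \<tau>: "0 \<le> \<tau>" and \<eta>: "\<eta> \<in> Xspace m"
  shows "integrand \<tau> \<eta> \<xi> = index_form (s \<tau>) (s' \<tau>) (k \<tau>) (e \<tau>) \<eta> \<xi>"
proof -
  have P: "inner_M m (P_coef m \<alpha> T \<gamma> \<tau> \<xi>) \<xi> = P_form (s \<tau>) \<xi>"
    by (simp add: P_coef_def Let_def tensor_M_def P_form_def inner_M_bilinear_simps power2_eq_square)
  have Q: "inner_M m (Q_coef m \<alpha> T \<gamma> \<tau> \<eta>) \<xi> = Q_form (s \<tau>) (s' \<tau>) (k \<tau>) \<eta> \<xi>"
    by (simp add: Q_coef_def Let_def tensor_M_def Q_form_def s'_def k_def inner_M_bilinear_simps)
  have "linear (Q_coef m \<alpha> T \<gamma> \<tau>)"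
    by (rule linearI) (simp_all add: Q_coef_def Let_def tensor_M_def inner_M_bilinear_simps algebra_simps)
  from inner_adjoint_M[OF m this \<eta>]
  have Q': "inner_M m (adjoint_M m (Q_coef m \<alpha> T \<gamma> \<tau>) \<xi>) \<eta> = Q_form (s \<tau>) (s' \<tau>) (k \<tau>) \<eta> \<xi>"
    by (simp add: inner_M_commute[of m \<xi>] Q)
  have R: "inner_M m (R_tilde m \<alpha> T s\<^sub>0 \<gamma> h \<tau> \<eta>) \<eta> = R_form (s \<tau>) (s' \<tau>) (k \<tau>) (e \<tau>) \<eta>"
    unfolding R_tilde_def bounded_bilinear.add_left[OF bounded_bilinear_inner_M]
      inner_hessian_M_W[OF m n y_free[OF \<tau>] \<eta>] W_hess_y[OF \<tau>]
    by (simp add: R_coef_def Let_def tensor_M_def R_form_def s'_def k_def inner_M_bilinear_simps power2_eq_square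
      mult.assoc algebra_simps)
  show ?thesis by (simp add: P Q Q' R index_form_def)
qed

text \<open>The origin of the constant in the [BS]-condition. Only the square of the limit of
  \<rho>'/\<rho> enters, so collision and parabolic motion give the same value.\<close>

lemma c_delta_sq: "2 * b - c * \<delta>\<^sub>0\<^sup>2 = (2 - \<alpha>)\<^sup>2 / 8 * b"
proof -
  have "(sqrt (2 * b))\<^sup>2 = 2 * b" using b_pos by simp
  then have "\<delta>\<^sub>0\<^sup>2 = ((2 - \<alpha>) / 4)\<^sup>2 * (2 * b)"
    by (simp only: delta_bar_def power2_minus power_mult_distrib split: if_split) simp
  then have "2 * b - c * \<delta>\<^sub>0\<^sup>2 = 2 * b - (16 / (2 - \<alpha>)\<^sup>2 - 1) * ((2 - \<alpha>)\<^sup>2 / 16 * (2 * b))"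
    by (simp add: c_coef_def power_divide)
  moreover have "2 * b - (16 / q - 1) * (q / 16 * (2 * b)) = q / 8 * b" if "q \<noteq> 0" for q
    using that by (simp add: field_simps)
  moreover have "(2 - \<alpha>)\<^sup>2 \<noteq> 0" using \<alpha> by simp
  ultimately show ?thesis by metis
qed

text \<open>Together with the agreement of the two Hessians at a central configuration, this
  identifies the [BS]-condition as positivity of the limiting zero-order coefficient.\<close>

lemma R_form_limit:
  assumes u: "u \<in> Xspace m"
  shows "R_form s\<^sub>0 0 \<delta>\<^sub>0 0 u = inner_M m (R_tilde_0 m \<alpha> T s\<^sub>0 u) u"
proof -
  have "R_form s\<^sub>0 0 \<delta>\<^sub>0 0 u = c * \<delta>\<^sub>0\<^sup>2 * (inner_M m s\<^sub>0 u)\<^sup>2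
      + (2 * b - c * \<delta>\<^sub>0\<^sup>2) * inner_M m u u + W_hess m \<alpha> b s\<^sub>0 u u"
    by (simp add: R_form_def inner_M_bilinear_simps)
  then show ?thesis
    unfolding c_delta_sq R_tilde_0_def bounded_bilinear.add_left[OF bounded_bilinear_inner_M]
      inner_hessian_M_U_tilde[OF m n s0(2) u] W_hess_central_configuration[OF m cc u u, symmetric]
    by (simp add: tensor_M_def inner_M_bilinear_simps power2_eq_square)
qed

text \<open>A positive continuous function on the compact unit sphere of \<open>Xspace m\<close> has
  a positive minimum, and homogeneity extends the estimate to all centred vectors.\<close>

lemma limit_form_ge:
  assumes BS: "BS_condition m \<alpha> T s\<^sub>0"
  shows "\<exists>c0>0. \<forall>u\<in>Xspace m. c0 * (norm u)\<^sup>2 \<le> R_form s\<^sub>0 0 \<delta>\<^sub>0 0 u"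
proof -
  let ?S = "sphere 0 1 \<inter> Xspace m :: (real^'d^'n) set"
  have cpt: "compact ?S"
    by (intro compact_Int_closed compact_sphere closed_subspace subspace_Xspace)
  \<comment> \<open>A minimum exists only on a nonempty set; the central configuration supplies a
    point of the sphere.\<close>
  have "s\<^sub>0 \<noteq> 0" using collision_free_nonzero[OF n s0(2)] .
  then have "s\<^sub>0 /\<^sub>R norm s\<^sub>0 \<in> ?S" using s0(1) subspace_scale[OF subspace_Xspace] by simp
  then have ne: "?S \<noteq> {}" by blast
  have "continuous_on ?S (R_form s\<^sub>0 0 \<delta>\<^sub>0 0)"
    using continuous_on_R_form[of ?S "\<lambda>_. s\<^sub>0" "\<lambda>_. 0" "\<lambda>_. \<delta>\<^sub>0" "\<lambda>_. 0" "\<lambda>u. u"] s0(2)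
    by (simp add: image_subset_iff)
  from continuous_attains_inf[OF cpt ne this]
  obtain u0 where u0: "u0 \<in> ?S" "\<And>u. u \<in> ?S \<Longrightarrow> R_form s\<^sub>0 0 \<delta>\<^sub>0 0 u0 \<le> R_form s\<^sub>0 0 \<delta>\<^sub>0 0 u"
    by blast
  define c0 where "c0 = R_form s\<^sub>0 0 \<delta>\<^sub>0 0 u0"
  have "u0 \<in> Xspace m" "u0 \<noteq> 0" using u0(1) by auto
  then have "0 < c0" using BS by (simp add: c0_def R_form_limit BS_condition_def)
  moreover have "c0 * (norm u)\<^sup>2 \<le> R_form s\<^sub>0 0 \<delta>\<^sub>0 0 u" if u: "u \<in> Xspace m" for u
  proof (cases "u = 0")
    case True
    then show ?thesis using R_form_scaleR[OF s0(2), of 0 \<delta>\<^sub>0 0 0 u] by simp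
  next
    case False
    then have "u /\<^sub>R norm u \<in> ?S" using u subspace_scale[OF subspace_Xspace] by simp
    from u0(2)[OF this] have "c0 * (norm u)\<^sup>2 \<le> R_form s\<^sub>0 0 \<delta>\<^sub>0 0 (u /\<^sub>R norm u) * (norm u)\<^sup>2"
      by (simp add: c0_def mult_right_mono)
    also have "\<dots> = R_form s\<^sub>0 0 \<delta>\<^sub>0 0 u"
      using R_form_scaleR[OF s0(2), of 0 \<delta>\<^sub>0 0 "norm u" "u /\<^sub>R norm u"] False by simp
    finally show ?thesis .
  qed
  ultimately show ?thesis by blast
qed

text \<open>The remaining cross term is a total derivative.\<close>

lemma tail_bound:
  assumes BS: "BS_condition m \<alpha> T s\<^sub>0"
  shows "\<exists>\<tau>\<^sub>0>0. \<forall>\<tau>\<ge>\<tau>\<^sub>0. \<forall>\<eta>\<in>Xspace m. \<forall>\<xi>. 2 * Q_form s\<^sub>0 0 \<delta>\<^sub>0 \<eta> \<xi> \<le> integrand \<tau> \<eta> \<xi>"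
proof -
  obtain c0 where c0: "0 < c0" "\<And>u. u \<in> Xspace m \<Longrightarrow> c0 * (norm u)\<^sup>2 \<le> R_form s\<^sub>0 0 \<delta>\<^sub>0 0 u"
    using limit_form_ge[OF BS] by blast
  obtain a where a: "0 < a" "\<And>u :: real^'d^'n. a * norm u \<le> norm_M m u"
    using norm_M_bounds[OF m] by metis
  \<comment> \<open>The error in \<eta> is absorbed by the limit of R, which is at least c0
    |\<eta>|^2, and the error in \<xi> by P, which is at least a^2 |\<xi>|^2.\<close>
  define \<epsilon> where "\<epsilon> = min c0 (a\<^sup>2)"
  define S where "S = (collision_free :: (real^'d^'n) set) \<times> (UNIV :: ((real^'d^'n) \<times> real \<times> real) set)"
  \<comment> \<open>Homogeneity of the form is available at collision-free points; the value 0
    elsewhere makes it hold for every parameter, as \<open>quadratic_perturbation\<close>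
    requires.\<close>
  define G where "G p z = (if fst p \<in> collision_free then
    index_form (fst p) (fst (snd p)) (fst (snd (snd p))) (snd (snd (snd p))) (fst z) (snd z) else 0)"
    for p :: "(real^'d^'n) \<times> (real^'d^'n) \<times> real \<times> real" and z :: "(real^'d^'n) \<times> (real^'d^'n)"
  define p0 where "p0 = (s\<^sub>0, 0 :: real^'d^'n, \<delta>\<^sub>0, 0 :: real)"
  have cont: "continuous_on (S \<times> UNIV) (\<lambda>x. G (fst x) (snd x))"
  proof (rule continuous_on_cong[THEN iffD1, OF refl])
    show "continuous_on (S \<times> UNIV) (\<lambda>x. index_form (fst (fst x)) (fst (snd (fst x))) (fst (snd (snd (fst x))))
        (snd (snd (snd (fst x)))) (fst (snd x)) (snd (snd x)))"
      by (intro continuous_on_index_form continuous_on_fst continuous_on_snd continuous_on_id) (auto simp: S_def)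
  qed (auto simp: S_def G_def)
  have hom: "G p (j *\<^sub>R z) = j\<^sup>2 * G p z" for p j z
    by (simp add: G_def index_form_scaleR)
  have "open S" unfolding S_def by (intro open_Times open_collision_free open_UNIV)
  moreover have "p0 \<in> S" using s0(2) by (simp add: S_def p0_def)
  moreover have "0 < \<epsilon>" using c0 a by (simp add: \<epsilon>_def)
  ultimately have "\<exists>\<delta>>0. \<forall>p z. dist p p0 < \<delta> \<longrightarrow> \<bar>G p z - G p0 z\<bar> \<le> \<epsilon> * (norm z)\<^sup>2"
    by (intro quadratic_perturbation[OF _ _ cont hom])
  then obtain \<delta> where \<delta>: "0 < \<delta>" "\<And>p z. dist p p0 < \<delta> \<Longrightarrow> \<bar>G p z - G p0 z\<bar> \<le> \<epsilon> * (norm z)\<^sup>2"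
    by blast
  have "((\<lambda>\<tau>. (s \<tau>, s' \<tau>, k \<tau>, e \<tau>)) \<longlongrightarrow> p0) at_top"
    unfolding p0_def by (intro tendsto_Pair s_tendsto_at_top s'_tendsto k_tendsto e_tendsto)
  from tendstoD[OF this \<delta>(1)] obtain \<tau>1 where \<tau>1: "\<And>\<tau>. \<tau>1 \<le> \<tau> \<Longrightarrow> dist (s \<tau>, s' \<tau>, k \<tau>, e \<tau>) p0 < \<delta>"
    unfolding eventually_at_top_linorder by blast
  show ?thesis
  proof (intro exI[of _ "max 1 \<tau>1"] conjI allI impI ballI)
    fix \<tau> and \<eta> \<xi> :: "real^'d^'n" assume \<tau>: "max 1 \<tau>1 \<le> \<tau>" and \<eta>: "\<eta> \<in> Xspace m"
    have "G (s \<tau>, s' \<tau>, k \<tau>, e \<tau>) (\<eta>, \<xi>) = integrand \<tau> \<eta> \<xi>"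
      using \<tau> s_props(1)[of \<tau>] by (subst integrand_eq[OF _ \<eta>]) (simp_all add: G_def)
    moreover have "G p0 (\<eta>, \<xi>) = P_form s\<^sub>0 \<xi> + 2 * Q_form s\<^sub>0 0 \<delta>\<^sub>0 \<eta> \<xi> + R_form s\<^sub>0 0 \<delta>\<^sub>0 0 \<eta>"
      using s0(2) by (simp add: G_def p0_def index_form_def)
    moreover have "\<bar>G (s \<tau>, s' \<tau>, k \<tau>, e \<tau>) (\<eta>, \<xi>) - G p0 (\<eta>, \<xi>)\<bar> \<le> \<epsilon> * (norm (\<eta>, \<xi>))\<^sup>2"
      using \<tau> by (intro \<delta>(2) \<tau>1) simp
    moreover have "\<epsilon> * (norm (\<eta>, \<xi>))\<^sup>2 = \<epsilon> * (norm \<eta>)\<^sup>2 + \<epsilon> * (norm \<xi>)\<^sup>2"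
      by (simp add: norm_Pair distrib_left)
    moreover have "\<epsilon> * (norm \<eta>)\<^sup>2 \<le> R_form s\<^sub>0 0 \<delta>\<^sub>0 0 \<eta>"
      by (rule order_trans[OF mult_right_mono c0(2)[OF \<eta>]]) (auto simp: \<epsilon>_def)
    moreover have "\<epsilon> * (norm \<xi>)\<^sup>2 \<le> a\<^sup>2 * (norm \<xi>)\<^sup>2"
      by (intro mult_right_mono) (auto simp: \<epsilon>_def)
    moreover have "a\<^sup>2 * (norm \<xi>)\<^sup>2 \<le> inner_M m \<xi> \<xi>"
      using power_mono[OF a(2)[of \<xi>], of 2] a(1) by (simp add: power_mult_distrib norm_M_sq[OF m])
    ultimately show "2 * Q_form s\<^sub>0 0 \<delta>\<^sub>0 \<eta> \<xi> \<le> integrand \<tau> \<eta> \<xi>"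
      using P_form_ge[of \<xi> s\<^sub>0] by linarith
  qed simp
qed

text \<open>P dominates the identity. A weighted Young inequality charges the cross term mostly to
  \<eta>, so that half of |\<xi>|^2 survives at the price of a large C.\<close>

lemma initial_bound:
  assumes "0 < \<tau>\<^sub>0"
  shows "\<exists>C\<ge>0. \<forall>\<tau>. 0 < \<tau> \<longrightarrow> \<tau> \<le> \<tau>\<^sub>0 \<longrightarrow> (\<forall>\<eta>\<in>Xspace m. \<forall>\<xi>.
    (norm_M m \<xi>)\<^sup>2 / 2 - C * (norm_M m \<eta>)\<^sup>2 \<le> integrand \<tau> \<eta> \<xi>)"
proof -
  obtain S C where S: "compact S" "S \<subseteq> collision_free" and C: "0 \<le> C"
    and b: "\<forall>\<tau>. 0 < \<tau> \<and> \<tau> \<le> \<tau>\<^sub>0 \<longrightarrow> s \<tau> \<in> S \<and> norm_M m (s' \<tau>) \<le> C \<and> \<bar>k \<tau>\<bar> \<le> C \<and> \<bar>e \<tau>\<bar> \<le> C"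
    by (rule bounded_coefficients[OF assms])
  obtain a where a: "0 < a" "\<And>u :: real^'d^'n. a * norm u \<le> norm_M m u"
    using norm_M_bounds[OF m] by metis
  have a_sq: "a\<^sup>2 * (norm u)\<^sup>2 \<le> (norm_M m u)\<^sup>2" for u :: "real^'d^'n"
    using power_mono[OF a(2)[of u], of 2] a(1) by (simp add: power_mult_distrib)
  define K where "K = S \<times> cball (0 :: real^'d^'n) (C / a) \<times> {- C..C} \<times> {- C..C}"
  have K: "compact K"
    unfolding K_def by (intro compact_Times S compact_cball compact_Icc)
  have mem: "(s \<tau>, s' \<tau>, k \<tau>, e \<tau>) \<in> K" if "0 < \<tau>" "\<tau> \<le> \<tau>\<^sub>0" for \<tau>
  proof -
    have "norm_M m (s' \<tau>) \<le> C" using b that by blast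
    then have "a * norm (s' \<tau>) \<le> C" using a(2)[of "s' \<tau>"] by linarith
    then have "norm (s' \<tau>) \<le> C / a" using a(1) by (simp add: field_simps)
    moreover have "- C \<le> k \<tau>" "k \<tau> \<le> C" "- C \<le> e \<tau>" "e \<tau> \<le> C"
      using b that by (auto simp: abs_le_iff)
    ultimately show ?thesis using b that by (simp add: K_def)
  qed
  define Gq where "Gq p z = Q_form (fst p) (fst (snd p)) (fst (snd (snd p))) (fst z) (snd z)"
    for p :: "(real^'d^'n) \<times> (real^'d^'n) \<times> real \<times> real" and z :: "(real^'d^'n) \<times> (real^'d^'n)"
  define Gr where "Gr p z = (if fst p \<in> collision_free then
    R_form (fst p) (fst (snd p)) (fst (snd (snd p))) (snd (snd (snd p))) z else 0)"
    for p :: "(real^'d^'n) \<times> (real^'d^'n) \<times> real \<times> real" and z :: "real^'d^'n"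
  have "continuous_on (K \<times> UNIV) (\<lambda>x. Gq (fst x) (snd x))"
    unfolding Gq_def by (intro continuous_on_Q_form continuous_on_fst continuous_on_snd continuous_on_id)
  moreover have "Gq p (l *\<^sub>R z) = l\<^sup>2 * Gq p z" for p l z
    by (simp add: Gq_def Q_form_scaleR power2_eq_square)
  ultimately have "\<exists>C\<ge>0. \<forall>p\<in>K. \<forall>z. \<bar>Gq p z\<bar> \<le> C * (norm z)\<^sup>2"
    by (rule quadratic_bound[OF K])
  then obtain Cq where Cq: "0 \<le> Cq" "\<And>p z. p \<in> K \<Longrightarrow> \<bar>Gq p z\<bar> \<le> Cq * (norm z)\<^sup>2"
    by blast
  have "continuous_on (K \<times> UNIV) (\<lambda>x. Gr (fst x) (snd x))"
  proof (rule continuous_on_cong[THEN iffD1, OF refl])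
    show "continuous_on (K \<times> UNIV) (\<lambda>x. R_form (fst (fst x)) (fst (snd (fst x))) (fst (snd (snd (fst x))))
        (snd (snd (snd (fst x)))) (snd x))"
      using S(2) by (intro continuous_on_R_form continuous_on_fst continuous_on_snd continuous_on_id) (auto simp: K_def)
  qed (use S(2) in \<open>auto simp: K_def Gr_def\<close>)
  moreover have "Gr p (l *\<^sub>R z) = l\<^sup>2 * Gr p z" for p l z
    by (simp add: Gr_def R_form_scaleR)
  ultimately have "\<exists>C\<ge>0. \<forall>p\<in>K. \<forall>z. \<bar>Gr p z\<bar> \<le> C * (norm z)\<^sup>2"
    by (rule quadratic_bound[OF K])
  then obtain Cr where Cr: "0 \<le> Cr" "\<And>p z. p \<in> K \<Longrightarrow> \<bar>Gr p z\<bar> \<le> Cr * (norm z)\<^sup>2"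
    by blast
  \<comment> \<open>The cross term is estimated at the pair (l \<eta>, \<xi>/l), where it has the
    same value. This l gives Cq/l^2 \<le> a^2/4, so the doubled term costs at most a^2/2 |\<xi>|^2,
    which is at most half of the squared mass norm of \<xi>.\<close>
  define l where "l = sqrt (1 + 4 * Cq / a\<^sup>2)"
  have l: "1 \<le> l" "l\<^sup>2 = 1 + 4 * Cq / a\<^sup>2" using Cq(1) by (auto simp: l_def)
  define C' where "C' = (2 * Cq * l\<^sup>2 + Cr) / a\<^sup>2"
  show ?thesis
  proof (intro exI[of _ C'] conjI allI impI ballI)
    show C': "0 \<le> C'" using Cq Cr by (simp add: C'_def)
    fix \<tau> and \<eta> \<xi> :: "real^'d^'n" assume \<tau>: "0 < \<tau>" "\<tau> \<le> \<tau>\<^sub>0" and \<eta>: "\<eta> \<in> Xspace m"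
    have free: "s \<tau> \<in> collision_free" using s_props(1)[of \<tau>] \<tau> by simp
    have eq: "integrand \<tau> \<eta> \<xi> = P_form (s \<tau>) \<xi> + 2 * Q_form (s \<tau>) (s' \<tau>) (k \<tau>) \<eta> \<xi>
        + R_form (s \<tau>) (s' \<tau>) (k \<tau>) (e \<tau>) \<eta>"
      using \<tau> by (subst integrand_eq[OF _ \<eta>]) (simp_all add: index_form_def)
    have "\<bar>Q_form (s \<tau>) (s' \<tau>) (k \<tau>) \<eta> \<xi>\<bar> = \<bar>Gq (s \<tau>, s' \<tau>, k \<tau>, e \<tau>) (l *\<^sub>R \<eta>, inverse l *\<^sub>R \<xi>)\<bar>"
      using l(1) by (simp add: Gq_def Q_form_scaleR)
    also have "\<dots> \<le> Cq * (norm (l *\<^sub>R \<eta>, inverse l *\<^sub>R \<xi>))\<^sup>2"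
      by (rule Cq(2)[OF mem[OF \<tau>]])
    also have "\<dots> = Cq * l\<^sup>2 * (norm \<eta>)\<^sup>2 + Cq / l\<^sup>2 * (norm \<xi>)\<^sup>2"
      by (simp add: norm_Pair power_mult_distrib algebra_simps divide_inverse power_inverse)
    also have "a\<^sup>2 / 4 * l\<^sup>2 = a\<^sup>2 / 4 + Cq"
      using a(1) by (simp add: l(2) field_simps)
    then have "Cq / l\<^sup>2 \<le> a\<^sup>2 / 4"
      using l(1) by (subst pos_divide_le_eq) auto
    then have "Cq / l\<^sup>2 * (norm \<xi>)\<^sup>2 \<le> a\<^sup>2 / 4 * (norm \<xi>)\<^sup>2"
      by (rule mult_right_mono) simp
    finally have Q: "\<bar>Q_form (s \<tau>) (s' \<tau>) (k \<tau>) \<eta> \<xi>\<bar> \<le> Cq * l\<^sup>2 * (norm \<eta>)\<^sup>2 + a\<^sup>2 / 4 * (norm \<xi>)\<^sup>2"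
      by simp
    have R: "\<bar>R_form (s \<tau>) (s' \<tau>) (k \<tau>) (e \<tau>) \<eta>\<bar> \<le> Cr * (norm \<eta>)\<^sup>2"
      using Cr(2)[OF mem[OF \<tau>], of \<eta>] free by (simp add: Gr_def)
    have "(2 * Cq * l\<^sup>2 + Cr) * (norm \<eta>)\<^sup>2 = C' * (a\<^sup>2 * (norm \<eta>)\<^sup>2)"
      using a(1) by (simp add: C'_def)
    also have "\<dots> \<le> C' * (norm_M m \<eta>)\<^sup>2"
      by (rule mult_left_mono[OF a_sq C'])
    finally have "(2 * Cq * l\<^sup>2 + Cr) * (norm \<eta>)\<^sup>2 \<le> C' * (norm_M m \<eta>)\<^sup>2" .
    then have "2 * (Cq * l\<^sup>2 * (norm \<eta>)\<^sup>2) + Cr * (norm \<eta>)\<^sup>2 \<le> C' * (norm_M m \<eta>)\<^sup>2"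
      by (simp add: algebra_simps)
    moreover have "(norm_M m \<xi>)\<^sup>2 \<le> P_form (s \<tau>) \<xi>"
      using P_form_ge[of \<xi> "s \<tau>"] by (simp add: norm_M_sq[OF m])
    ultimately show "(norm_M m \<xi>)\<^sup>2 / 2 - C' * (norm_M m \<eta>)\<^sup>2 \<le> integrand \<tau> \<eta> \<xi>"
      unfolding eq using Q R a_sq[of \<xi>] by linarith
  qed
qed

lemma weak_deriv_increment:
  assumes "is_weak_deriv m \<eta> g" "0 \<le> a" "a \<le> x"
  shows "\<eta> x = \<eta> a + (LINT u:{a..x}|lborel. g u)"
proof -
  have g: "g \<in> L2_space m" using assms(1) by (simp add: is_weak_deriv_def)
  have eq: "\<eta> t = \<eta> 0 + (LINT u:{0..t}|lborel. g u)" if "0 \<le> t" for t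
    using assms(1) that unfolding is_weak_deriv_def by blast
  have "(LINT u:{0..x}|lborel. g u) = (LINT u:{0..a}|lborel. g u) + (LINT u:{a..x}|lborel. g u)"
    by (rule set_integral_split[OF L2_set_integrable[OF m g]]) (use assms in auto)
  then have "\<eta> x = (\<eta> 0 + (LINT u:{0..a}|lborel. g u)) + (LINT u:{a..x}|lborel. g u)"
    using eq[of x] assms(2,3) by (simp add: add.assoc)
  then show ?thesis using eq[OF assms(2)] by (simp only:)
qed

lemma set_integral_bounded_linear:
  fixes g :: "real \<Rightarrow> real^'d^'n" and A :: "real^'d^'n \<Rightarrow> 'b::euclidean_space"
  assumes "bounded_linear A" "set_integrable lborel S g"
  shows "A (LINT u:S|lborel. g u) = (LINT u:S|lborel. A (g u))"
  using integral_bounded_linear[OF assms(1) assms(2)[unfolded set_integrable_def]]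
  by (simp add: set_lebesgue_integral_def linear_scale[OF bounded_linear.linear[OF assms(1)]])

text \<open>With frozen coefficients the integrand is the derivative of c \<delta> (|\<eta>|^2 -
  <\<open>s\<^sub>0\<close>, \<eta>>^2) with \<delta> constant. The boundary term vanishes at a by
  hypothesis and at infinity by square integrability.\<close>

lemma cross_term_integral:
  assumes \<eta>: "\<eta> \<in> W12_0 m" and a: "0 \<le> a" "\<eta> a = 0"
  shows "set_integrable lborel {a..} (\<lambda>t. 2 * Q_form s\<^sub>0 0 \<delta>\<^sub>0 (\<eta> t) (weak_deriv m \<eta> t))"
    and "(LINT t:{a..}|lborel. 2 * Q_form s\<^sub>0 0 \<delta>\<^sub>0 (\<eta> t) (weak_deriv m \<eta> t)) = 0"
proof -
  define g where "g = weak_deriv m \<eta>"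
  have wd: "is_weak_deriv m \<eta> g" unfolding g_def by (rule weak_deriv[OF m \<eta>])
  have L2: "\<eta> \<in> L2_space m" "g \<in> L2_space m"
    using \<eta> wd by (auto simp: W12_0_def is_weak_deriv_def)
  have meas[measurable]: "\<eta> \<in> borel_measurable lborel" "g \<in> borel_measurable lborel"
    using L2 by (auto simp: L2_space_def)
  \<comment> \<open>Used for A = \<open>mass_scale m\<close>, which yields the full inner product,
    and for A = pairing with \<open>s\<^sub>0\<close>, which yields the radial part. Both are
    bounded by the mass norm, so square integrability carries over.\<close>
  have key: "set_integrable lborel {a..} (\<lambda>t. A (\<eta> t) \<bullet> A (g t)) \<and> (LINT t:{a..}|lborel. A (\<eta> t) \<bullet> A (g t)) = 0"
    if A: "bounded_linear A" and le: "\<And>u. norm (A u) \<le> norm_M m u" for A :: "real^'d^'n \<Rightarrow> 'b::euclidean_space"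
  proof -
    have A_meas: "(\<lambda>t. A (F t)) \<in> borel_measurable lborel" if "F \<in> borel_measurable lborel" for F
      by (rule borel_measurable_continuous_on[OF linear_continuous_on[OF A] that])
    have sq: "set_integrable lborel {a..} (\<lambda>t. (norm (A (F t)))\<^sup>2)" if F: "F \<in> L2_space m" for F
    proof (rule set_integrable_bound)
      show "set_integrable lborel {a..} (\<lambda>t. (norm_M m (F t))\<^sup>2)"
        by (rule set_integrable_subset[of _ "{0..}"]) (use F a in \<open>auto simp: L2_space_def\<close>)
      show "AE x in lborel. x \<in> {a..} \<longrightarrow> norm ((norm (A (F x)))\<^sup>2) \<le> norm ((norm_M m (F x))\<^sup>2)"
      proof (intro AE_I2 impI)
        show "norm ((norm (A (F x)))\<^sup>2) \<le> norm ((norm_M m (F x))\<^sup>2)" for x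
          using power_mono[OF le[of "F x"], where n = 2] by simp
      qed
      have [measurable]: "(\<lambda>t. A (F t)) \<in> borel_measurable lborel"
        by (rule A_meas) (use F in \<open>simp add: L2_space_def\<close>)
      show "set_borel_measurable lborel {a..} (\<lambda>x. (norm (A (F x)))\<^sup>2)"
        by (simp add: set_borel_measurable_def)
    qed
    have prim: "A (\<eta> x) = (LINT u:{a..x}|lborel. A (g u))" if "a \<le> x" for x
    proof -
      have "\<eta> x = (LINT u:{a..x}|lborel. g u)"
        using weak_deriv_increment[OF wd a(1) that] a(2) by simp
      then show ?thesis
        using set_integral_bounded_linear[OF A L2_set_integrable[OF m L2(2) a(1)]] by simp
    qed
    show ?thesis
      by (intro conjI set_integrable_inner_of_sq integral_primitive_inner_half_line A_meas meas sq L2 prim) auto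
  qed
  have e1: "set_integrable lborel {a..} (\<lambda>t. inner_M m (\<eta> t) (g t))" "(LINT t:{a..}|lborel. inner_M m (\<eta> t) (g t)) = 0"
    using key[OF bounded_linear_mass_scale[of m]]
    by (simp_all add: norm_M_mass_scale[OF m] inner_M_mass_scale[OF m])
  have "norm (inner_M m s\<^sub>0 u) \<le> norm_M m u" for u
    using abs_inner_M_le[OF m, of s\<^sub>0 u] by (simp add: s0(3))
  from key[OF bounded_bilinear.bounded_linear_right[OF bounded_bilinear_inner_M, of m s\<^sub>0] this]
  have e2: "set_integrable lborel {a..} (\<lambda>t. inner_M m s\<^sub>0 (\<eta> t) * inner_M m s\<^sub>0 (g t))"
    "(LINT t:{a..}|lborel. inner_M m s\<^sub>0 (\<eta> t) * inner_M m s\<^sub>0 (g t)) = 0"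
    by simp_all
  have eq: "2 * Q_form s\<^sub>0 0 \<delta>\<^sub>0 (\<eta> t) (g t) =
      2 * c * \<delta>\<^sub>0 * (inner_M m (\<eta> t) (g t) - inner_M m s\<^sub>0 (\<eta> t) * inner_M m s\<^sub>0 (g t))" for t
    by (simp add: Q_form_def inner_M_bilinear_simps)
  show "set_integrable lborel {a..} (\<lambda>t. 2 * Q_form s\<^sub>0 0 \<delta>\<^sub>0 (\<eta> t) (weak_deriv m \<eta> t))"
    unfolding g_def[symmetric] eq by (intro set_integrable_mult_right set_integral_diff(1) e1 e2)
  show "(LINT t:{a..}|lborel. 2 * Q_form s\<^sub>0 0 \<delta>\<^sub>0 (\<eta> t) (weak_deriv m \<eta> t)) = 0"
    unfolding g_def[symmetric] eq set_integral_mult_right set_integral_diff(2)[OF e1(1) e2(1)] e1(2) e2(2)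
    by simp
qed

lemma quad_form_nonneg:
  assumes BS: "BS_condition m \<alpha> T s\<^sub>0"
  shows "\<exists>d. \<exists>K::nat. \<forall>\<eta>\<in>W12_0 m. (\<forall>i\<le>K. \<eta> (real i * d) = 0) \<longrightarrow>
    0 \<le> quad_form m \<alpha> T s\<^sub>0 \<gamma> h \<eta>"
proof -
  obtain \<tau>\<^sub>0 where \<tau>\<^sub>0: "0 < \<tau>\<^sub>0" and tail: "\<And>\<tau> \<eta> \<xi>. \<tau>\<^sub>0 \<le> \<tau> \<Longrightarrow> \<eta> \<in> Xspace m \<Longrightarrow>
      2 * Q_form s\<^sub>0 0 \<delta>\<^sub>0 \<eta> \<xi> \<le> integrand \<tau> \<eta> \<xi>"
    using tail_bound[OF BS] by blast
  obtain C where C: "0 \<le> C" and init: "\<And>\<tau> \<eta> \<xi>. 0 < \<tau> \<Longrightarrow> \<tau> \<le> \<tau>\<^sub>0 \<Longrightarrow> \<eta> \<in> Xspace m \<Longrightarrow>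
      (norm_M m \<xi>)\<^sup>2 / 2 - C * (norm_M m \<eta>)\<^sup>2 \<le> integrand \<tau> \<eta> \<xi>"
    using initial_bound[OF \<tau>\<^sub>0] by blast
  \<comment> \<open>With this many cells d (2C+1) \<le> 1, hence d \<le> 1 and 2Cd \<le> 1, so that
    C d^2 \<le> 1/2. The Poincare inequality then lets the surviving half of |\<eta>'|^2 pay for C
    |\<eta>|^2.\<close>
  define K where "K = nat \<lceil>\<tau>\<^sub>0 * (2 * C + 1)\<rceil> + 1"
  define d where "d = \<tau>\<^sub>0 / real K"
  have K: "0 < real K" "\<tau>\<^sub>0 * (2 * C + 1) \<le> real K"
    using real_nat_ceiling_ge[of "\<tau>\<^sub>0 * (2 * C + 1)"] by (auto simp: K_def)
  have d: "0 < d" "real K * d = \<tau>\<^sub>0" using \<tau>\<^sub>0 K by (simp_all add: d_def)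
  have "d * (2 * C + 1) \<le> 1" using K by (simp add: d_def field_simps)
  then have "d * (2 * C) + d \<le> 1" by (simp add: distrib_left)
  moreover have "0 \<le> d * (2 * C)" using d C by simp
  ultimately have "d \<le> 1" "d * (2 * C) \<le> 1" using d(1) by linarith+
  then have "d * (d * (2 * C)) \<le> 1 * 1" using d C by (intro mult_mono) auto
  then have dC: "C * d\<^sup>2 \<le> 1 / 2" by (simp add: power2_eq_square mult_ac)
  show ?thesis
  proof (intro exI[of _ d] exI[of _ K] ballI impI)
    fix \<eta> :: "real \<Rightarrow> real^'d^'n" assume \<eta>: "\<eta> \<in> W12_0 m" and zero: "\<forall>i\<le>K. \<eta> (real i * d) = 0"
    define g where "g = weak_deriv m \<eta>"
    have wd: "is_weak_deriv m \<eta> g" unfolding g_def by (rule weak_deriv[OF m \<eta>])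
    have L2: "\<eta> \<in> L2_space m" "g \<in> L2_space m"
      using \<eta> wd by (auto simp: W12_0_def is_weak_deriv_def)
    have X: "\<eta> t \<in> Xspace m" for t using L2(1) by (simp add: L2_space_def)
    have sq: "set_integrable lborel {0..} (\<lambda>t. (norm_M m (\<eta> t))\<^sup>2)" "set_integrable lborel {0..} (\<lambda>t. (norm_M m (g t))\<^sup>2)"
      using L2 by (auto simp: L2_space_def)
    define I where "I t = integrand t (\<eta> t) (g t)" for t
    have quad: "quad_form m \<alpha> T s\<^sub>0 \<gamma> h \<eta> = (LINT t:{0..}|lborel. I t)"
      by (simp add: quad_form_def Let_def I_def g_def)
    show "0 \<le> quad_form m \<alpha> T s\<^sub>0 \<gamma> h \<eta>"
    \<comment> \<open>A non-integrable integrand has integral 0 by convention, so this case split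
      stands in for a proof that the form converges.\<close>
    proof (cases "set_integrable lborel {0..} I")
      case False
      then show ?thesis
        by (simp add: quad set_integrable_def set_lebesgue_integral_def not_integrable_integral_eq)
    next
      case True
      have sub: "set_integrable lborel {0..\<tau>\<^sub>0} F" if "set_integrable lborel {0..} F" for F :: "real \<Rightarrow> real"
        by (rule set_integrable_subset[OF that]) auto
      have g_meas: "(\<lambda>t. mass_scale m (g t)) \<in> borel_measurable lborel"
        by (rule borel_measurable_continuous_on[OF linear_continuous_on[OF bounded_linear_mass_scale]])
          (use L2(2) in \<open>simp add: L2_space_def\<close>)
      have "(LINT t:{0..real K * d}|lborel. (norm (mass_scale m (\<eta> t)))\<^sup>2) \<le>
          d\<^sup>2 * (LINT t:{0..real K * d}|lborel. (norm (mass_scale m (g t)))\<^sup>2)"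
      proof (rule poincare_grid[OF g_meas])
        show "set_integrable lborel {0..} (\<lambda>t. (norm (mass_scale m (\<eta> t)))\<^sup>2)"
          "set_integrable lborel {0..} (\<lambda>t. (norm (mass_scale m (g t)))\<^sup>2)"
          using sq by (simp_all add: norm_M_mass_scale[OF m])
        show "mass_scale m (\<eta> (real i * d)) = 0" if "i \<le> K" for i
          using zero that by (simp add: mass_scale_eq_0_iff[OF m])
        fix a x :: real assume ax: "0 \<le> a" "a \<le> x"
        show "mass_scale m (\<eta> x) = mass_scale m (\<eta> a) + (LINT u:{a..x}|lborel. mass_scale m (g u))"
          unfolding weak_deriv_increment[OF wd ax] linear_add[OF bounded_linear.linear[OF bounded_linear_mass_scale]]
            set_integral_bounded_linear[OF bounded_linear_mass_scale L2_set_integrable[OF m L2(2) ax(1)]] ..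
      qed (rule d(1))
      then have poincare: "(LINT t:{0..\<tau>\<^sub>0}|lborel. (norm_M m (\<eta> t))\<^sup>2) \<le> d\<^sup>2 * (LINT t:{0..\<tau>\<^sub>0}|lborel. (norm_M m (g t))\<^sup>2)"
        by (simp add: d(2) norm_M_mass_scale[OF m])
      define Ig where "Ig = (LINT t:{0..\<tau>\<^sub>0}|lborel. (norm_M m (g t))\<^sup>2)"
      have "0 \<le> Ig"
        unfolding Ig_def set_lebesgue_integral_def by (rule Bochner_Integration.integral_nonneg) simp
      have low: "set_integrable lborel {0..\<tau>\<^sub>0} (\<lambda>t. (norm_M m (g t))\<^sup>2 / 2)"
        "set_integrable lborel {0..\<tau>\<^sub>0} (\<lambda>t. C * (norm_M m (\<eta> t))\<^sup>2)"
        by (intro set_integrable_divide set_integrable_mult_right sub sq impI)+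
      have "0 \<le> Ig / 2 - (C * d\<^sup>2) * Ig"
        using mult_right_mono[OF dC \<open>0 \<le> Ig\<close>] by simp
      also have "\<dots> \<le> Ig / 2 - C * (LINT t:{0..\<tau>\<^sub>0}|lborel. (norm_M m (\<eta> t))\<^sup>2)"
        using mult_left_mono[OF poincare C] by (simp add: Ig_def mult.assoc)
      also have "\<dots> = (LINT t:{0..\<tau>\<^sub>0}|lborel. (norm_M m (g t))\<^sup>2 / 2 - C * (norm_M m (\<eta> t))\<^sup>2)"
        unfolding set_integral_diff(2)[OF low] by (simp add: Ig_def)
      also have "\<dots> \<le> (LINT t:{0..\<tau>\<^sub>0}|lborel. I t)"
      proof (rule set_integral_mono_AE[OF set_integral_diff(1)[OF low] sub[OF True]])
        \<comment> \<open>The initial estimate speaks of positive times only; the time 0 is a null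
          set.\<close>
        show "AE t\<in>{0..\<tau>\<^sub>0} in lborel. (norm_M m (g t))\<^sup>2 / 2 - C * (norm_M m (\<eta> t))\<^sup>2 \<le> I t"
          using AE_lborel_singleton[of 0] by eventually_elim (auto simp: I_def intro!: init X)
      qed
      finally have "0 \<le> (LINT t:{0..\<tau>\<^sub>0}|lborel. I t)" .
      moreover have "0 \<le> (LINT t:{\<tau>\<^sub>0..}|lborel. I t)"
      proof -
        \<comment> \<open>The last grid point K d is exactly the cut, so the same conditions that
          serve the Poincare inequality also remove the boundary term of the tail.\<close>
        have "\<eta> \<tau>\<^sub>0 = 0" using zero d(2) by force
        note cross = cross_term_integral[OF \<eta> less_imp_le[OF \<tau>\<^sub>0] this, folded g_def]
        have "set_integrable lborel {\<tau>\<^sub>0..} I"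
          by (rule set_integrable_subset[OF True]) (use \<tau>\<^sub>0 in auto)
        from set_integral_mono[OF cross(1) this] show ?thesis
          using tail[OF _ X] unfolding cross(2) by (simp add: I_def)
      qed
      ultimately show ?thesis
        unfolding quad set_integral_split_half_line[OF True less_imp_le[OF \<tau>\<^sub>0]] by simp
    qed
  qed
qed

end

theorem theorem3p8:
  fixes m :: "'n::finite \<Rightarrow> real"
    and \<alpha> h :: real
    and T :: ereal
    and s\<^sub>0 :: "real^'d^'n"
    and \<gamma> :: "real \<Rightarrow> real^'d^'n"
    and \<iota> :: enat
  assumes "2 \<le> CARD('n)" and "2 \<le> CARD('d)"
    and "\<And>i. 0 < m i"
    and "0 < \<alpha>" and "\<alpha> < 2"
    and "central_configuration m \<alpha> s\<^sub>0"
    and "s0_asymptotic_solution m \<alpha> T s\<^sub>0 \<gamma>"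
    and "\<gamma> 0 \<in> Xhat m"
    and "has_energy m \<alpha> T \<gamma> h"
    and "BS_condition m \<alpha> T s\<^sub>0"
    and "has_spectral_index m \<alpha> T s\<^sub>0 \<gamma> h \<iota>"
  shows "\<iota> < \<infinity>"
proof -
  have m: "\<forall>i. 0 < m i" using assms(3) by simp
  interpret asymptotic_orbit m \<alpha> h T s\<^sub>0 \<gamma>
    by unfold_locales (use assms m in simp_all)
  obtain A E where quad: "\<forall>\<eta>\<in>W12_0 m. quad_form m \<alpha> T s\<^sub>0 \<gamma> h \<eta> = inner_W12 m (A \<eta>) \<eta>"
    and spec: "is_spectral_measure (W12_0 m) (inner_W12 m) A E"
    and \<iota>: "\<iota> = fun_dim (E {..<0} ` W12_0 m)"
    using assms(11) unfolding has_spectral_index_def by blast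
  interpret spectral_resolution "W12_0 m" "inner_W12 m" A E
    by unfold_locales (rule spec, rule inner_W12_nonneg[OF m])
  from quad_form_nonneg[OF assms(10)] obtain d and K :: nat
    where nonneg: "\<forall>\<eta>\<in>W12_0 m. (\<forall>i\<le>K. \<eta> (real i * d) = 0) \<longrightarrow> 0 \<le> quad_form m \<alpha> T s\<^sub>0 \<gamma> h \<eta>"
    by (elim exE)
  \<comment> \<open>Each vector condition at a grid point is split into its coordinates, which gives
    at most (K+1) n d scalar conditions, d in this count being the dimension.\<close>
  define pts where "pts = (\<lambda>i. real i * d) ` {..K} \<times> (Basis :: (real^'d^'n) set)"
  have "fun_dim (E {..<0} ` W12_0 m) \<le> enat (card pts)"
  proof (rule fun_dim_le)
    show "finite pts" by (simp add: pts_def)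
    show "(\<lambda>t. \<Sum>\<eta>\<in>B. a \<eta> *\<^sub>R \<eta> t) \<in> E {..<0} ` W12_0 m"
      if "finite B" "B \<subseteq> E {..<0} ` W12_0 m" for B a
      by (rule E_range_sum[OF W12_0_zero[OF m] W12_0_add[OF m] W12_0_scale[OF m] that])
    fix \<eta> assume \<eta>: "\<eta> \<in> E {..<0} ` W12_0 m" and pts: "\<forall>(t, v)\<in>pts. \<eta> t \<bullet> v = 0"
    note \<eta> = E_range[OF \<eta>]
    have "\<eta> (real i * d) = 0" if "i \<le> K" for i
    proof (rule euclidean_eqI)
      fix v :: "real^'d^'n" assume "v \<in> Basis"
      with that have "(real i * d, v) \<in> pts"
        unfolding pts_def by (intro SigmaI imageI) simp_all
      from bspec[OF pts this] show "\<eta> (real i * d) \<bullet> v = 0 \<bullet> v" by simp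
    qed
    then have "0 \<le> inner_W12 m (A \<eta>) \<eta>"
      using nonneg quad \<eta>(1) by simp
    from negative_spectral_subspace[OF \<eta> this] show "\<forall>t. \<eta> t = 0"
      using inner_W12_eq_0[OF m \<eta>(1)] by blast
  qed
  then show ?thesis unfolding \<iota> by (rule order_le_less_trans) simp
qed

end
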